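(* Let $G$ be a finite group and $V$ a complex irreducible representation of $G$, with $n=\dim V$, Schur index $m=m_{\mathbb{Q}}(V)$, fields $K\subseteq L$ and central idempotent $e_V$ as in the context. Write $\operatorname{Gal}(L/K)=\{\tau_1=1,\ldots,\tau_m\}$. Let $\ell_1,\ldots,\ell_n$ be any $n$ primitive orthogonal idempotents in the simple algebra $L[G]\,e_V$ with $e_V=\ell_1+\cdots+\ell_n$. Then there exist $\frac{n}{m}$ primitive orthogonal idempotents $\{u_s^1\}_{s=1}^{n/m}$ in different left ideals $J_s=L[G]\,\ell_{j_s}$ (with $j_s\in\{1,\ldots,n\}$) such that the following hold. (1) The element $u_s^h=\tau_h(u_s^1)$ is a primitive generating idempotent for the left ideal $\tau_h(J_s)=L[G]\,\tau_h(\ell_{j_s})$, for each $\tau_h\in\operatorname{Gal}(L/K)$ and each $s\in\{1,\ldots,\frac nm\}$. (2) $u_s^h\,u_t^l=u_s^h$ if $l=h$ and $t=s$, and $u_s^h\,u_t^l=0$ otherwise. (3) The algebra $L[G]\,e_V$ decomposes as the direct orthogonal sum of the left ideals generated by the $\tau_h(u_s^1)$, $1\le h\le m$, $1\le s\le \frac nm$, and furthermore $$e_V=\sum_{s=1}^{n/m}\sum_{h=1}^m u_s^h=\sum_{s=1}^{n/m}\ \sum_{\sigma\in\operatorname{Gal}(L/K)}\sigma(u_s^1).$$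
   Context: $K$ is the field obtained by adjoining to $\mathbb{Q}$ the values of the character $\chi_V$ of $V$. $L\supseteq K$ is a field of definition of $V$ (i.e. $V$ can be realized by matrices over $L$) with $[L:K]=m=m_{\mathbb{Q}}(V)$, the Schur index of $V$, and such that $L/\mathbb{Q}$ is Galois. Then $\operatorname{Gal}(L/K)$ has $m$ elements; Galois groups act on group algebras coefficientwise. The central idempotent is $e_V=\frac{\dim V}{|G|}\sum_{g\in G}\chi_V(g^{-1})\,g\in K[G]$. *)

theory Defs
  imports "HOL-Algebra.Embedded_Algebras" "HOL-Algebra.Generated_Fields" "Jordan_Normal_Form.VS_Connect"
begin

text \<open>
  All fields are subfields of the complex numbers, viewed through the library structure
  \<^term>\<open>class_ring :: complex ring\<close>.  For subfields \<open>F \<subseteq> L\<close>, the equation \<open>[L : F] = d\<close> is the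
  library predicate \<open>ring.dimension class_ring d F L\<close>, which includes finiteness of the degree.
\<close>

section \<open>Complex matrix representations\<close>

definition matrix_rep :: "('g, 'b) monoid_scheme \<Rightarrow> nat \<Rightarrow> ('g \<Rightarrow> complex mat) \<Rightarrow> bool" where
  "matrix_rep G n \<rho> \<longleftrightarrow> \<rho> \<in> hom G (units_of (ring_mat TYPE(complex) n ()))"

definition irreducible_rep :: "('g, 'b) monoid_scheme \<Rightarrow> nat \<Rightarrow> ('g \<Rightarrow> complex mat) \<Rightarrow> bool" where
  "irreducible_rep G n \<rho> \<longleftrightarrow> matrix_rep G n \<rho> \<and> 0 < n \<and>
     (\<forall>W. subspace class_ring W (module_vec TYPE(complex) n) \<and>
          (\<forall>g\<in>carrier G. \<forall>w\<in>W. \<rho> g *\<^sub>v w \<in> W)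
        \<longrightarrow> W = {0\<^sub>v n} \<or> W = carrier_vec n)"

definition rep_char :: "('g \<Rightarrow> complex mat) \<Rightarrow> 'g \<Rightarrow> complex" where
  "rep_char \<rho> g = sum_list (diag_mat (\<rho> g))"

definition character_field :: "('g, 'b) monoid_scheme \<Rightarrow> ('g \<Rightarrow> complex mat) \<Rightarrow> complex set" where
  "character_field G \<rho> = generate_field class_ring (rep_char \<rho> ` carrier G)"

definition realizable_over ::
    "('g, 'b) monoid_scheme \<Rightarrow> nat \<Rightarrow> ('g \<Rightarrow> complex mat) \<Rightarrow> complex set \<Rightarrow> bool" where
  "realizable_over G n \<rho> F \<longleftrightarrow>
     (\<exists>\<phi> P Q. matrix_rep G n \<phi> \<and>
        (\<forall>g\<in>carrier G. elements_mat (\<phi> g) \<subseteq> F \<and> similar_mat_wit (\<rho> g) (\<phi> g) P Q))"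

text \<open>
  The Schur index over the rationals: the least degree over the character field of a field
  over which the representation can be realized.
\<close>

definition schur_index :: "('g, 'b) monoid_scheme \<Rightarrow> nat \<Rightarrow> ('g \<Rightarrow> complex mat) \<Rightarrow> nat" where
  "schur_index G n \<rho> =
     (LEAST d. \<exists>F. subfield F class_ring \<and> character_field G \<rho> \<subseteq> F \<and>
        ring.dimension class_ring d (character_field G \<rho>) F \<and> realizable_over G n \<rho> F)"

section \<open>Galois groups\<close>

text \<open>
  Automorphisms of \<open>L\<close> are represented by functions that are \<^term>\<open>undefined\<close> outside \<open>L\<close>,
  so that each of them occurs exactly once.
\<close>

definition Gal :: "complex set \<Rightarrow> complex set \<Rightarrow> (complex \<Rightarrow> complex) set" where
  "Gal L F = {\<sigma> \<in> ring_iso (class_ring\<lparr>carrier := L\<rparr>) (class_ring\<lparr>carrier := L\<rparr>) \<inter> extensional L.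
                \<forall>x\<in>F. \<sigma> x = x}"

definition galois_extension :: "complex set \<Rightarrow> complex set \<Rightarrow> bool" where
  "galois_extension F L \<longleftrightarrow>
     subfield F class_ring \<and> subfield L class_ring \<and> F \<subseteq> L \<and>
     ring.finite_dimension class_ring F L \<and>
     {x \<in> L. \<forall>\<sigma>\<in>Gal L F. \<sigma> x = x} = F"

section \<open>Group algebras\<close>

text \<open>
  An element \<open>\<Sum>g\<in>G. a(g) g\<close> of the group algebra is its coefficient function \<open>a\<close>, set to \<open>0\<close>
  outside the carrier of the group.  Since field automorphisms fix \<open>0\<close>, the coefficientwise
  action of \<open>\<sigma>\<close> is the composition \<open>\<sigma> \<circ> a\<close>.
\<close>

definition group_algebra ::
    "complex set \<Rightarrow> ('g, 'b) monoid_scheme \<Rightarrow> ('g \<Rightarrow> complex) ring" where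
  "group_algebra L G = \<lparr>
     carrier = {a. (\<forall>g\<in>carrier G. a g \<in> L) \<and> (\<forall>g. g \<notin> carrier G \<longrightarrow> a g = 0)},
     monoid.mult = (\<lambda>a b g. if g \<in> carrier G
                      then \<Sum>h\<in>carrier G. a h * b (inv\<^bsub>G\<^esub> h \<otimes>\<^bsub>G\<^esub> g) else 0),
     one = (\<lambda>g. if g = \<one>\<^bsub>G\<^esub> then 1 else 0),
     ring.zero = (\<lambda>g. 0),
     add = (\<lambda>a b g. a g + b g)\<rparr>"

definition central_idem ::
    "('g, 'b) monoid_scheme \<Rightarrow> nat \<Rightarrow> ('g \<Rightarrow> complex mat) \<Rightarrow> 'g \<Rightarrow> complex" where
  "central_idem G n \<rho> = (\<lambda>g. if g \<in> carrier G
     then of_nat n / of_nat (card (carrier G)) * rep_char \<rho> (inv\<^bsub>G\<^esub> g) else 0)"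

text \<open>
  Below, \<open>PIdl\<^bsub>R\<^esub> a\<close> is the library's set of all products \<open>x \<otimes> a\<close>; as the rings here are
  noncommutative, it is the principal left ideal \<open>R a\<close>.
\<close>

text \<open>The algebra \<open>R e\<close> for a central idempotent \<open>e\<close>; its unit is \<open>e\<close>.\<close>

definition block_algebra :: "'a ring \<Rightarrow> 'a \<Rightarrow> 'a ring" where
  "block_algebra R e = R\<lparr>carrier := PIdl\<^bsub>R\<^esub> e, one := e\<rparr>"

definition primitive_idem :: "('a, 'b) ring_scheme \<Rightarrow> 'a \<Rightarrow> bool" where
  "primitive_idem R e \<longleftrightarrow>
     e \<in> carrier R \<and> e \<otimes>\<^bsub>R\<^esub> e = e \<and> e \<noteq> \<zero>\<^bsub>R\<^esub> \<and>
     (\<forall>a\<in>carrier R. \<forall>b\<in>carrier R.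
        a \<otimes>\<^bsub>R\<^esub> a = a \<and> b \<otimes>\<^bsub>R\<^esub> b = b \<and> a \<otimes>\<^bsub>R\<^esub> b = \<zero>\<^bsub>R\<^esub> \<and> b \<otimes>\<^bsub>R\<^esub> a = \<zero>\<^bsub>R\<^esub> \<and>
        e = a \<oplus>\<^bsub>R\<^esub> b \<longrightarrow> a = \<zero>\<^bsub>R\<^esub> \<or> b = \<zero>\<^bsub>R\<^esub>)"

definition orthogonal_idems :: "('a, 'b) ring_scheme \<Rightarrow> 'i set \<Rightarrow> ('i \<Rightarrow> 'a) \<Rightarrow> bool" where
  "orthogonal_idems R I v \<longleftrightarrow>
     (\<forall>i\<in>I. v i \<in> carrier R \<and> v i \<otimes>\<^bsub>R\<^esub> v i = v i) \<and>
     (\<forall>i\<in>I. \<forall>k\<in>I. i \<noteq> k \<longrightarrow> v i \<otimes>\<^bsub>R\<^esub> v k = \<zero>\<^bsub>R\<^esub>)"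

text \<open>
  \<open>B\<close> is the direct sum of the left ideals generated by the \<open>v i\<close> (the summation map from the
  product of these ideals is a bijection onto \<open>B\<close>), the \<open>v i\<close> being orthogonal idempotents.
\<close>

definition direct_orthogonal_sum ::
    "('a, 'b) ring_scheme \<Rightarrow> 'a set \<Rightarrow> 'i set \<Rightarrow> ('i \<Rightarrow> 'a) \<Rightarrow> bool" where
  "direct_orthogonal_sum R B I v \<longleftrightarrow>
     orthogonal_idems R I v \<and>
     bij_betw (\<lambda>f. \<Oplus>\<^bsub>R\<^esub>i\<in>I. f i) (\<Pi>\<^sub>E i\<in>I. PIdl\<^bsub>R\<^esub> (v i)) B"

end

(*
  Over L the block L[G] e is a full matrix algebra, and the left ideal of each l_i corresponds to the
  line spanned by the rows of a matrix of rank one. The sum of the Galois conjugates of a minimal left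
  ideal J is Galois stable, so it contains nonzero K-rational elements, namely traces. A nonzero
  K-rational element x of the block has rank at least m: if the left ideal C[G] x has a nonscalar
  endomorphism given by right multiplication with a K-rational element, one passes to an eigenspace,
  which divides the dimension by the degree of the eigenvalue; in the end the representation is
  realized over an extension of K of degree at most the rank of x. Hence the m conjugates of J are
  independent, and Galois-stable sums of this kind intersect trivially or contain J. Greedily one finds
  n/m of the ideals L[G] l_j all of whose conjugates together decompose the block. The components of e
  in this decomposition are orthogonal idempotents, and as e is fixed by the Galois group, uniqueness
  of the components shows that the Galois group permutes them.
*)

theory Submission
  imports Defs "HOL-Library.Function_Algebras" "HOL-Algebra.Finite_Extensions"
    "HOL-Computational_Algebra.Fundamental_Theorem_Algebra"
begin

section \<open>Subfields of the complex numbers\<close>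

text \<open>Everything is counted over the complex numbers: spans, dimensions and independence are
  complex. Rationality is recovered by one device, a linear retraction of the complex numbers onto a
  subfield \<open>F\<close>: applied to the coefficients of a relation or an expansion with
  \<open>F\<close>-rational data, it yields one with coefficients in \<open>F\<close>. The obstacle
  is that matrices and Galois action do not fit together. The map \<open>\<Phi>\<close> uses a
  representation with entries in \<open>L\<close>, so the rows of a conjugate \<sigma>(x) are not
  the conjugated rows of x. Row spaces serve for counting, conjugation is carried out on coefficient
  functions, and the \<open>K\<close>-rational element e cuts out the block. The factor n in the
  bounds appears because the left ideal of an element of rank r has dimension n r: a realization
  over a field of degree d with d n \<le> n r gives d \<le> r, and m \<le> d by minimality. That
  \<open>K\<close> is the fixed field of Gal(L/K) is derived from |Gal(L/K)| = m = [L:K] by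
  Dedekind's independence of automorphisms.\<close>

lemma domain_class_ring: "domain (class_ring :: complex ring)"
  using class_field by (rule field.axioms)

lemma ring_class_ring: "ring (class_ring :: complex ring)"
  using domain_class_ring by (intro cring.axioms(1) domain.axioms(1))

abbreviation (input) csubfield :: "complex set \<Rightarrow> bool" where
  "csubfield F \<equiv> subfield F class_ring"

lemma subfield_complexD:
  assumes "csubfield F"
  shows "0 \<in> F" "1 \<in> F" "x \<in> F \<Longrightarrow> y \<in> F \<Longrightarrow> x + y \<in> F"
    "x \<in> F \<Longrightarrow> - x \<in> F" "x \<in> F \<Longrightarrow> y \<in> F \<Longrightarrow> x - y \<in> F" "x \<in> F \<Longrightarrow> y \<in> F \<Longrightarrow> x * y \<in> F"
    "x \<in> F \<Longrightarrow> inverse x \<in> F" "x \<in> F \<Longrightarrow> y \<in> F \<Longrightarrow> x / y \<in> F"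
proof -
  note sr = subfieldE(1)[OF assms]
  have zero: "0 \<in> F" and one: "1 \<in> F"
    and add: "\<And>x y. x \<in> F \<Longrightarrow> y \<in> F \<Longrightarrow> x + y \<in> F"
    and mult: "\<And>x y. x \<in> F \<Longrightarrow> y \<in> F \<Longrightarrow> x * y \<in> F"
    and neg: "\<And>x. x \<in> F \<Longrightarrow> - x \<in> F"
    using subringE(2)[OF sr] subringE(3)[OF sr] subringE(5)[OF sr] subringE(6)[OF sr] subringE(7)[OF sr]
    by (auto simp: class_ring_simps)
  have inv: "inverse x \<in> F" if "x \<in> F" for x
  proof (cases "x = 0")
    case False
    then show ?thesis
      using ring.subfield_m_inv(1)[OF ring_class_ring assms, of x] that
      by (simp add: class_ring_simps)
  qed (use zero in simp)
  show "0 \<in> F" "1 \<in> F" "x \<in> F \<Longrightarrow> y \<in> F \<Longrightarrow> x + y \<in> F"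
    "x \<in> F \<Longrightarrow> - x \<in> F" "x \<in> F \<Longrightarrow> y \<in> F \<Longrightarrow> x * y \<in> F" "x \<in> F \<Longrightarrow> inverse x \<in> F"
    by (fact zero one add neg mult inv)+
  show "x \<in> F \<Longrightarrow> y \<in> F \<Longrightarrow> x - y \<in> F" using add[OF _ neg, of x y] by simp
  show "x \<in> F \<Longrightarrow> y \<in> F \<Longrightarrow> x / y \<in> F" using mult[OF _ inv, of x y] by (simp add: divide_inverse)
qed

lemma subfield_complex_sum:
  assumes "csubfield F" "\<And>i. i \<in> I \<Longrightarrow> f i \<in> F"
  shows "(\<Sum>i\<in>I. f i) \<in> F"
  using assms(2) subfield_complexD[OF assms(1)] by (induction I rule: infinite_finite_induct) auto

lemma subfield_complex_of_nat:
  assumes "csubfield F"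
  shows "of_nat k \<in> F"
  using subfield_complexD[OF assms] by (induction k) auto

text \<open>A projection of the complex numbers onto \<open>F\<close> as \<open>F\<close>-vector
  spaces. It is linear but not multiplicative: only factors from \<open>F\<close> may be pulled out,
  which is why the data it meets have to be \<open>F\<close>-rational.\<close>

definition linear_retraction :: "complex set \<Rightarrow> (complex \<Rightarrow> complex) \<Rightarrow> bool" where
  "linear_retraction F \<theta> \<longleftrightarrow> range \<theta> \<subseteq> F \<and> (\<forall>x y. \<theta> (x + y) = \<theta> x + \<theta> y) \<and>
     (\<forall>c\<in>F. \<forall>x. \<theta> (c * x) = c * \<theta> x) \<and> \<theta> 1 = 1"

lemma linear_retractionD:
  assumes "linear_retraction F \<theta>"
  shows "\<theta> x \<in> F" "\<theta> (x + y) = \<theta> x + \<theta> y" "c \<in> F \<Longrightarrow> \<theta> (c * x) = c * \<theta> x"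
    "c \<in> F \<Longrightarrow> \<theta> (x * c) = \<theta> x * c" "c \<in> F \<Longrightarrow> \<theta> c = c" "\<theta> 1 = 1" "\<theta> 0 = 0"
proof -
  show 1: "\<theta> x \<in> F" "\<theta> (x + y) = \<theta> x + \<theta> y" "c \<in> F \<Longrightarrow> \<theta> (c * x) = c * \<theta> x" "\<theta> 1 = 1"
    for c x y using assms unfolding linear_retraction_def by auto
  show "c \<in> F \<Longrightarrow> \<theta> (x * c) = \<theta> x * c" using 1(3)[of c x] by (simp add: mult.commute)
  show "c \<in> F \<Longrightarrow> \<theta> c = c" using 1(3)[of c 1] 1(4) by simp
  show "\<theta> 0 = 0" using 1(2)[of 0 0] by simp
qed

lemma linear_retraction_sum:
  assumes "linear_retraction F \<theta>"
  shows "\<theta> (\<Sum>i\<in>I. f i) = (\<Sum>i\<in>I. \<theta> (f i))"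
  by (induction I rule: infinite_finite_induct) (simp_all add: linear_retractionD[OF assms])

text \<open>The kernel is chosen first: by Zorn's lemma there is an \<open>F\<close>-subspace
  \<open>H\<close> maximal among those that avoid 1. Maximality makes \<open>H\<close> a complement
  of \<open>F\<close>, and \<open>\<theta>\<close> is the projection along it.\<close>

lemma linear_retraction_exists:
  assumes F: "csubfield F"
  obtains \<theta> where "linear_retraction F \<theta>"
proof -
  note Fs = subfield_complexD[OF F]
  define HH where "HH = {H :: complex set. 0 \<in> H \<and> (\<forall>x\<in>H. \<forall>y\<in>H. x + y \<in> H) \<and>
    (\<forall>c\<in>F. \<forall>x\<in>H. c * x \<in> H) \<and> 1 \<notin> H}"
  have "\<exists>H\<in>HH. \<forall>Y\<in>HH. H \<subseteq> Y \<longrightarrow> Y = H"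
  proof (rule subset_Zorn_nonempty)
    show "HH \<noteq> {}" unfolding HH_def by (auto intro!: exI[of _ "{0}"])
  next
    fix C assume C: "C \<noteq> {}" "subset.chain HH C"
    have sub: "C \<subseteq> HH" and tot: "\<And>Z Y. Z \<in> C \<Longrightarrow> Y \<in> C \<Longrightarrow> Z \<subseteq> Y \<or> Y \<subseteq> Z"
      using C(2) unfolding subset_chain_def by auto
    have "x + y \<in> \<Union> C" if xy: "x \<in> \<Union> C" "y \<in> \<Union> C" for x y
    proof -
      obtain Z Y where "Z \<in> C" "x \<in> Z" "Y \<in> C" "y \<in> Y" using xy by blast
      then have "\<exists>Z\<in>C. x \<in> Z \<and> y \<in> Z" using tot[of Z Y] by blast
      then show ?thesis using sub unfolding HH_def by blast
    qed
    then show "\<Union> C \<in> HH" using sub C(1) unfolding HH_def by blast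
  qed
  then obtain H where H: "H \<in> HH" and max: "\<And>Y. Y \<in> HH \<Longrightarrow> H \<subseteq> Y \<Longrightarrow> Y = H" by blast
  have H0: "0 \<in> H" and Hadd: "\<And>x y. x \<in> H \<Longrightarrow> y \<in> H \<Longrightarrow> x + y \<in> H"
    and Hsc: "\<And>c x. c \<in> F \<Longrightarrow> x \<in> H \<Longrightarrow> c * x \<in> H" and H1: "1 \<notin> H"
    using H unfolding HH_def by auto
  have Hneg: "- x \<in> H" if "x \<in> H" for x using Hsc[OF Fs(4)[OF Fs(2)] that] by simp
  have ex: "\<exists>f\<in>F. z - f \<in> H" for z
  proof (cases "z \<in> H")
    case True
    then show ?thesis using Fs(1) by (intro bexI[of _ 0]) auto
  next
    case False
    \<comment> \<open>Adjoining \<open>z\<close> to \<open>H\<close> violates maximality, so 1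
      becomes expressible as \<open>h + c * z\<close>. As 1 is not in \<open>H\<close>,
      \<open>c\<close> is invertible, and \<open>z\<close> is congruent to its inverse modulo
      \<open>H\<close>.\<close>
    let ?X = "{h + c * z | h c. h \<in> H \<and> c \<in> F}"
    have "H \<subseteq> ?X" using Fs(1) by force
    moreover have "z \<in> ?X" using H0 Fs(2) by force
    ultimately have "?X \<notin> HH" using max[of ?X] False by blast
    moreover have "0 \<in> ?X" using H0 Fs(1) by force
    moreover have "x + y \<in> ?X" if "x \<in> ?X" "y \<in> ?X" for x y
    proof -
      from that obtain h c h' c' where "x = h + c * z" "y = h' + c' * z" "h \<in> H" "h' \<in> H" "c \<in> F" "c' \<in> F"
        by blast
      then have "x + y = (h + h') + (c + c') * z" "h + h' \<in> H" "c + c' \<in> F"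
        using Hadd Fs(3) by (auto simp: algebra_simps)
      then show ?thesis by blast
    qed
    moreover have "b * x \<in> ?X" if "x \<in> ?X" "b \<in> F" for x b
    proof -
      from that obtain h c where "x = h + c * z" "h \<in> H" "c \<in> F" by blast
      then have "b * x = b * h + (b * c) * z" "b * h \<in> H" "b * c \<in> F"
        using Hsc Fs(6) that by (auto simp: algebra_simps)
      then show ?thesis by blast
    qed
    ultimately have "1 \<in> ?X" unfolding HH_def by blast
    then obtain h c where hc: "h \<in> H" "c \<in> F" "1 = h + c * z" by blast
    have "c \<noteq> 0" using hc(1,3) H1 by auto
    have "c * z = 1 - h" unfolding hc(3) by simp
    then have "inverse c * (c * z) = inverse c * (1 - h)" by simp
    then have "z - inverse c = - (inverse c * h)"
      using \<open>c \<noteq> 0\<close> by (simp add: mult.assoc[symmetric] right_diff_distrib)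
    moreover have "- (inverse c * h) \<in> H" using Hneg Hsc hc(1,2) Fs(7) by blast
    ultimately show ?thesis using Fs(7)[OF hc(2)] by metis
  qed
  have uniq: "f = f'" if "f \<in> F" "f' \<in> F" "z - f \<in> H" "z - f' \<in> H" for z f f'
  proof (rule ccontr)
    assume ne: "f \<noteq> f'"
    have "f - f' = (z - f') + - (z - f)" by simp
    then have "f - f' \<in> H" using Hadd[OF that(4) Hneg[OF that(3)]] by metis
    then have "inverse (f - f') * (f - f') \<in> H" using Hsc Fs(5,7) that(1,2) by blast
    moreover have "inverse (f - f') * (f - f') = 1" using ne by simp
    ultimately show False using H1 by metis
  qed
  define \<theta> where "\<theta> z = (THE f. f \<in> F \<and> z - f \<in> H)" for z
  have \<theta>: "\<theta> z \<in> F" "z - \<theta> z \<in> H" for z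
    using theI'[of "\<lambda>f. f \<in> F \<and> z - f \<in> H"] ex[of z] uniq unfolding \<theta>_def by blast+
  have \<theta>I: "\<theta> z = f" if "f \<in> F" "z - f \<in> H" for z f using \<theta> uniq that by blast
  have "linear_retraction F \<theta>" unfolding linear_retraction_def
  proof (intro conjI allI ballI)
    show "range \<theta> \<subseteq> F" using \<theta> by blast
    show "\<theta> (x + y) = \<theta> x + \<theta> y" for x y
    proof (rule \<theta>I)
      have "x + y - (\<theta> x + \<theta> y) = (x - \<theta> x) + (y - \<theta> y)" by simp
      then show "x + y - (\<theta> x + \<theta> y) \<in> H" using Hadd[OF \<theta>(2)[of x] \<theta>(2)[of y]] by metis
    qed (use \<theta>(1) Fs(3) in blast)
    show "\<theta> (c * x) = c * \<theta> x" if "c \<in> F" for c x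
    proof (rule \<theta>I)
      have "c * x - c * \<theta> x = c * (x - \<theta> x)" by (simp add: right_diff_distrib)
      then show "c * x - c * \<theta> x \<in> H" using Hsc[OF that \<theta>(2)[of x]] by metis
    qed (use \<theta>(1) Fs(6) that in blast)
    show "\<theta> 1 = 1"
      by (rule \<theta>I) (simp_all add: H0 Fs(2))
  qed
  then show ?thesis using that by blast
qed

section \<open>Linear algebra of complex-valued functions\<close>

definition cscale :: "complex \<Rightarrow> ('i \<Rightarrow> complex) \<Rightarrow> 'i \<Rightarrow> complex" where
  "cscale c f = (\<lambda>x. c * f x)"

lemma cscale_apply [simp]: "cscale c f x = c * f x"
  by (simp add: cscale_def)

interpretation fs: Vector_Spaces.vector_space "cscale :: complex \<Rightarrow> ('i \<Rightarrow> complex) \<Rightarrow> 'i \<Rightarrow> complex"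
  by unfold_locales (auto simp: fun_eq_iff algebra_simps)

lemma sum_fun_apply [simp]: "(\<Sum>i\<in>I. f i) x = (\<Sum>i\<in>I. f i x :: complex)"
  by (induction I rule: infinite_finite_induct) auto

definition lspan :: "('j \<Rightarrow> 'i \<Rightarrow> complex) \<Rightarrow> 'j set \<Rightarrow> ('i \<Rightarrow> complex) set" where
  "lspan v J = {\<Sum>j\<in>J. cscale (c j) (v j) | c. True}"

text \<open>Families rather than sets: equal vectors at different indices count as dependent.
  Conjugates can therefore be counted through their indices, without first showing them distinct.
  Only finite \<open>J\<close> is meant, since sums over infinite sets are 0.\<close>

definition lin_indep :: "('j \<Rightarrow> 'i \<Rightarrow> complex) \<Rightarrow> 'j set \<Rightarrow> bool" where
  "lin_indep v J \<longleftrightarrow> (\<forall>c. (\<Sum>j\<in>J. cscale (c j) (v j)) = 0 \<longrightarrow> (\<forall>j\<in>J. c j = 0))"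

lemma lspanI: "(\<Sum>j\<in>J. cscale (c j) (v j)) \<in> lspan v J"
  unfolding lspan_def by blast

lemma lspan_eq_span:
  assumes "finite J"
  shows "lspan v J = fs.span (v ` J)"
proof
  show "lspan v J \<subseteq> fs.span (v ` J)"
    unfolding lspan_def by (auto intro!: fs.span_sum intro: fs.span_scale fs.span_base)
  show "fs.span (v ` J) \<subseteq> lspan v J"
  proof (rule fs.span_minimal)
    show "v ` J \<subseteq> lspan v J"
    proof (intro subsetI)
      fix f assume "f \<in> v ` J"
      then obtain j where j: "j \<in> J" "f = v j" by auto
      have "f = (\<Sum>i\<in>J. cscale (if i = j then 1 else 0) (v i))"
      proof
        fix x
        have "(\<Sum>i\<in>J. (if i = j then 1 else 0) * v i x) = (\<Sum>i\<in>J. if i = j then v j x else 0)"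
          by (rule sum.cong) auto
        then show "f x = (\<Sum>i\<in>J. cscale (if i = j then 1 else 0) (v i)) x"
          using j assms by simp
      qed
      then show "f \<in> lspan v J" using lspanI by metis
    qed
    show "fs.subspace (lspan v J)"
    proof (rule fs.subspaceI)
      show "0 \<in> lspan v J" unfolding lspan_def by (auto intro!: exI[of _ "\<lambda>_. 0"])
      fix x y assume "x \<in> lspan v J" "y \<in> lspan v J"
      then obtain c d where "x = (\<Sum>j\<in>J. cscale (c j) (v j))" "y = (\<Sum>j\<in>J. cscale (d j) (v j))"
        unfolding lspan_def by blast
      then have "x + y = (\<Sum>j\<in>J. cscale (c j + d j) (v j))"
        by (simp add: fun_eq_iff algebra_simps sum.distrib)
      then show "x + y \<in> lspan v J" using lspanI by metis
    next
      fix a x assume "x \<in> lspan v J"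
      then obtain c where "x = (\<Sum>j\<in>J. cscale (c j) (v j))" unfolding lspan_def by blast
      then have "cscale a x = (\<Sum>j\<in>J. cscale (a * c j) (v j))"
        by (simp add: fun_eq_iff sum_distrib_left mult.assoc)
      then show "cscale a x \<in> lspan v J" using lspanI by metis
    qed
  qed
qed

lemma lin_indep_iff:
  assumes "finite J"
  shows "lin_indep v J \<longleftrightarrow> inj_on v J \<and> fs.independent (v ` J)"
proof
  assume li: "lin_indep v J"
  have inj: "inj_on v J"
  proof (rule inj_onI, rule ccontr)
    fix i j assume ij: "i \<in> J" "j \<in> J" "v i = v j" "i \<noteq> j"
    let ?c = "\<lambda>k. (if k = i then 1 else 0) - (if k = j then 1 else 0) :: complex"
    have "(\<Sum>k\<in>J. cscale (?c k) (v k)) = 0"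
    proof
      fix x
      have "(\<Sum>k\<in>J. ?c k * v k x) =
          (\<Sum>k\<in>J. (if k = i then v i x else 0)) - (\<Sum>k\<in>J. if k = j then v j x else 0)"
        unfolding sum_subtractf[symmetric] by (rule sum.cong) auto
      also have "\<dots> = v i x - v j x"
        unfolding sum.delta[OF assms] using ij(1,2) by simp
      also have "\<dots> = 0" unfolding ij(3) by simp
      finally show "(\<Sum>k\<in>J. cscale (?c k) (v k)) x = 0 x"
        unfolding sum_fun_apply cscale_apply zero_fun_apply .
    qed
    then have "?c i = 0" using spec[OF li[unfolded lin_indep_def], of ?c] ij(1) by blast
    then show False using ij(4) by simp
  qed
  moreover have "fs.independent (v ` J)"
  proof (rule fs.independent_if_scalars_zero)
    fix f x assume "(\<Sum>x\<in>v ` J. cscale (f x) x) = 0" and x: "x \<in> v ` J"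
    then have "(\<Sum>j\<in>J. cscale (f (v j)) (v j)) = 0" by (simp add: sum.reindex[OF inj])
    then show "f x = 0" using li x unfolding lin_indep_def by auto
  qed (use assms in simp)
  ultimately show "inj_on v J \<and> fs.independent (v ` J)" ..
next
  assume *: "inj_on v J \<and> fs.independent (v ` J)"
  show "lin_indep v J" unfolding lin_indep_def
  proof (intro allI impI ballI)
    fix c j assume c: "(\<Sum>j\<in>J. cscale (c j) (v j)) = 0" and j: "j \<in> J"
    have "(\<Sum>x\<in>v ` J. cscale (c (inv_into J v x)) x) = (\<Sum>j\<in>J. cscale (c j) (v j))"
      using * by (simp add: sum.reindex)
    then show "c j = 0"
      using fs.independentD[of "v ` J" "v ` J" "\<lambda>x. c (inv_into J v x)" "v j"] * c j assms by simp
  qed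
qed

lemma lin_indep_card_le:
  assumes "lin_indep v J" "finite J" "v ` J \<subseteq> fs.span S" "finite S"
  shows "card J \<le> card S"
proof -
  have "inj_on v J" "fs.independent (v ` J)" using assms lin_indep_iff by auto
  then show ?thesis using fs.independent_span_bound[of S "v ` J"] assms card_image by metis
qed

lemma lin_indep_spans:
  assumes "lin_indep v J" "finite J" "v ` J \<subseteq> fs.span S" "finite S" "card S \<le> card J"
  shows "S \<subseteq> lspan v J"
proof -
  have i: "inj_on v J" "fs.independent (v ` J)" using assms(1) lin_indep_iff[OF assms(2)] by auto
  show ?thesis
  proof (rule subsetI, rule ccontr)
    fix s assume s: "s \<in> S" "s \<notin> lspan v J"
    then have ns: "s \<notin> fs.span (v ` J)" using lspan_eq_span[OF assms(2)] by blast
    then have "s \<notin> v ` J" using fs.span_base by blast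
    then have "card (insert s (v ` J)) = Suc (card J)"
      using card_image[OF i(1)] assms(2) by simp
    moreover have "insert s (v ` J) \<subseteq> fs.span S" using assms(3) s(1) fs.span_base by blast
    then have "card (insert s (v ` J)) \<le> card S"
      using fs.independent_span_bound[OF assms(4) fs.independent_insertI[OF ns i(2)]] by blast
    ultimately show False using assms(5) by simp
  qed
qed

lemma lin_indep_subfamily:
  assumes "finite I"
  obtains J where "J \<subseteq> I" "lin_indep w J" "lspan w J = lspan w I"
proof -
  obtain B where B: "B \<subseteq> w ` I" "fs.independent B" "w ` I \<subseteq> fs.span B"
    using fs.maximal_independent_subset by blast
  obtain J where J: "J \<subseteq> I" "inj_on w J" "B = w ` J"
    using B(1) by (meson subset_image_inj)
  have fin: "finite J" using J assms finite_subset by blast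
  have "lin_indep w J" using J B lin_indep_iff[OF fin] by blast
  moreover have "lspan w J = lspan w I"
    unfolding lspan_eq_span[OF fin] lspan_eq_span[OF assms]
    using B J fs.span_mono[of "w ` J" "w ` I"] fs.span_minimal[OF _ fs.subspace_span] by blast
  ultimately show ?thesis using that J by blast
qed

text \<open>The coefficients of a relation between \<open>F\<close>-rational functions can be pushed into \<open>F\<close>
  entrywise by an \<open>F\<close>-linear retraction.\<close>

lemma lin_indep_rationalI:
  assumes F: "csubfield F"
    and v: "\<And>j x. j \<in> J \<Longrightarrow> v j x \<in> F"
    and indep: "\<And>c. (\<And>j. j \<in> J \<Longrightarrow> c j \<in> F) \<Longrightarrow> (\<Sum>j\<in>J. cscale (c j) (v j)) = 0 \<Longrightarrow> \<forall>j\<in>J. c j = 0"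
  shows "lin_indep v J"
  unfolding lin_indep_def
proof (intro allI impI ballI, rule ccontr)
  fix c i assume rel: "(\<Sum>j\<in>J. cscale (c j) (v j)) = 0" and i: "i \<in> J" "c i \<noteq> 0"
  obtain \<theta> where \<theta>: "linear_retraction F \<theta>" using linear_retraction_exists[OF F] .
  note \<theta>s = linear_retractionD[OF \<theta>]
  \<comment> \<open>Dividing by \<open>c i\<close> first makes the i-th coefficient 1, which
    \<open>\<theta>\<close> fixes, so the relation pushed into \<open>F\<close> is still
    nontrivial.\<close>
  have "(\<Sum>j\<in>J. cscale (\<theta> (c j / c i)) (v j)) = 0"
  proof
    fix x
    have "(\<Sum>j\<in>J. (c j / c i) * v j x) = (1 / c i) * (\<Sum>j\<in>J. cscale (c j) (v j)) x"
      by (simp add: sum_distrib_left)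
    then have "\<theta> (\<Sum>j\<in>J. (c j / c i) * v j x) = 0" using rel \<theta>s by simp
    moreover have "\<theta> ((c j / c i) * v j x) = \<theta> (c j / c i) * v j x" if "j \<in> J" for j
      using \<theta>s(4) v[OF that] by blast
    ultimately show "(\<Sum>j\<in>J. cscale (\<theta> (c j / c i)) (v j)) x = 0 x"
      by (simp add: linear_retraction_sum[OF \<theta>] del: times_divide_eq_left cong: sum.cong)
  qed
  then have "\<theta> (c i / c i) = 0" using indep[of "\<lambda>j. \<theta> (c j / c i)"] \<theta>s i by blast
  then show False using i \<theta>s by simp
qed

text \<open>A retraction onto \<open>F\<close> fixes the values of \<open>f\<close> and can be
  pulled past the \<open>F\<close>-rational values of \<open>v j\<close>, so it may be applied to
  the complex coefficients alone.\<close>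

lemma rational_in_lspan:
  assumes F: "csubfield F"
    and v: "\<And>j x. j \<in> J \<Longrightarrow> v j x \<in> F" and f: "\<And>x. f x \<in> F" "f \<in> lspan v J"
  obtains c where "\<And>j. c j \<in> F" "f = (\<Sum>j\<in>J. cscale (c j) (v j))"
proof -
  obtain c where c: "f = (\<Sum>j\<in>J. cscale (c j) (v j))" using f(2) unfolding lspan_def by blast
  obtain \<theta> where \<theta>: "linear_retraction F \<theta>" using linear_retraction_exists[OF F] .
  note \<theta>s = linear_retractionD[OF \<theta>]
  have "f = (\<Sum>j\<in>J. cscale (\<theta> (c j)) (v j))"
  proof
    fix x
    have "f x = \<theta> (f x)" using f(1) \<theta>s by simp
    also have "\<dots> = \<theta> (\<Sum>j\<in>J. c j * v j x)" unfolding c by simp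
    also have "\<dots> = (\<Sum>j\<in>J. cscale (\<theta> (c j)) (v j)) x"
      using v by (simp add: linear_retraction_sum[OF \<theta>] \<theta>s cong: sum.cong)
    finally show "f x = (\<Sum>j\<in>J. cscale (\<theta> (c j)) (v j)) x" .
  qed
  then show ?thesis using that[of "\<lambda>j. \<theta> (c j)"] \<theta>s(1) by blast
qed


lemmas fun_apply = cscale_apply sum_fun_apply plus_fun_apply zero_fun_apply minus_apply

declare fun_apply [simp del]

hide_const (open) Polynomials.degree Polynomials.lead_coeff


text \<open>Has two uses: on natural numbers a standard basis vector, on the group a group element
  regarded as an element of the group algebra.\<close>

definition unit_fun :: "'i \<Rightarrow> 'i \<Rightarrow> complex" where
  "unit_fun i = (\<lambda>x. if x = i then 1 else 0)"

abbreviation uvecs :: "nat \<Rightarrow> (nat \<Rightarrow> complex) set" where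
  "uvecs n \<equiv> unit_fun ` {..<n}"

lemma sum_unit_fun:
  assumes "finite I"
  shows "(\<Sum>i\<in>I. f i * unit_fun i x) = (if x \<in> I then f x else 0)"
    "(\<Sum>i\<in>I. unit_fun x i * f i) = (if x \<in> I then f x else 0)"
proof -
  have "(\<Sum>i\<in>I. f i * unit_fun i x) = (\<Sum>i\<in>I. if x = i then f i else 0)"
    "(\<Sum>i\<in>I. unit_fun x i * f i) = (\<Sum>i\<in>I. if x = i then f i else 0)"
    by (auto simp: unit_fun_def intro!: sum.cong)
  then show "(\<Sum>i\<in>I. f i * unit_fun i x) = (if x \<in> I then f x else 0)"
    "(\<Sum>i\<in>I. unit_fun x i * f i) = (if x \<in> I then f x else 0)"
    using assms by simp_all
qed

lemma in_span_unit_fun: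
  assumes "finite I" "\<And>x. x \<notin> I \<Longrightarrow> f x = 0"
  shows "f \<in> fs.span (unit_fun ` I)"
proof -
  have "f = (\<Sum>i\<in>I. cscale (f i) (unit_fun i))"
    using assms by (intro ext) (simp add: fun_apply sum_unit_fun)
  then show ?thesis by (metis lspan_eq_span[OF assms(1)] lspanI)
qed

lemma card_unit_fun: "card (unit_fun ` I) = card I"
proof (rule card_image, rule inj_onI)
  fix i j assume "unit_fun i = (unit_fun j :: 'a \<Rightarrow> complex)"
  then have "unit_fun i i = (unit_fun j i :: complex)" by simp
  then show "i = j" by (simp add: unit_fun_def split: if_splits)
qed

lemma independent_unit_fun: "fs.independent (uvecs n)"
proof -
  have "lin_indep (unit_fun :: nat \<Rightarrow> nat \<Rightarrow> complex) {..<n}" unfolding lin_indep_def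
  proof (intro allI impI ballI)
    fix c :: "nat \<Rightarrow> complex" and j assume c: "(\<Sum>i<n. cscale (c i) (unit_fun i)) = 0" and j: "j \<in> {..<n}"
    have "(\<Sum>i<n. cscale (c i) (unit_fun i)) j = c j" using j by (simp add: fun_apply sum_unit_fun)
    then show "c j = 0" using c by (simp add: zero_fun_apply)
  qed
  then show ?thesis using lin_indep_iff[of "{..<n}" unit_fun] by simp
qed

text \<open>The relation of least degree between the iterates \<open>(T ^^ k) x\<close> gives the eigenvalue; an
  \<open>F\<close>-linear retraction applied to its coefficients makes it rational over \<open>F\<close>.\<close>

lemma eigenvector_exists:
  fixes T :: "('i \<Rightarrow> complex) \<Rightarrow> 'i \<Rightarrow> complex"
  assumes add: "\<And>f g. T (f + g) = T f + T g" and scale: "\<And>c f. T (cscale c f) = cscale c (T f)"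
    and x: "x \<noteq> 0" and S: "finite S" "\<And>k. (T ^^ k) x \<in> fs.span S"
    and F: "csubfield F" and rat: "\<And>k y. (T ^^ k) x y \<in> F"
  obtains p a \<mu> where "p \<noteq> 0" "\<And>i. coeff p i \<in> F" "poly p \<mu> = 0"
    "a \<in> fs.span (range (\<lambda>k. (T ^^ k) x))" "a \<noteq> 0" "T a = cscale \<mu> a"
proof -
  define ev where "ev q = (\<Sum>i\<le>degree q. cscale (coeff q i) ((T ^^ i) x))" for q
  have ev: "ev q = (\<Sum>i\<le>N. cscale (coeff q i) ((T ^^ i) x))" if "degree q \<le> N" for q N
    unfolding ev_def using that
    by (intro sum.mono_neutral_left) (auto simp: coeff_eq_0)
  have T0: "T 0 = 0" using scale[of 0 0] by simp
  have Tsum: "T (sum f I) = (\<Sum>i\<in>I. T (f i))" if "finite I" for f and I :: "nat set"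
    using that by (induction I) (simp_all add: add T0)
  \<comment> \<open>\<open>ev\<close> evaluates a polynomial at \<open>T\<close> and applies the
    result to \<open>x\<close>; multiplying the polynomial by X - \<mu> becomes applying T -
    \<mu>.\<close>
  have ev_lin: "ev (pCons 0 q - smult \<mu> q) = T (ev q) - cscale \<mu> (ev q)" for q \<mu>
  proof -
    let ?N = "Suc (degree q)"
    have "degree (pCons 0 q - smult \<mu> q) \<le> ?N"
      by (rule degree_diff_le) (auto intro: degree_pCons_le le_trans[OF degree_smult_le])
    then have "ev (pCons 0 q - smult \<mu> q) =
        (\<Sum>i\<le>?N. cscale (coeff (pCons 0 q) i) ((T ^^ i) x)) - (\<Sum>i\<le>?N. cscale (\<mu> * coeff q i) ((T ^^ i) x))"
      by (simp only: ev coeff_diff coeff_smult fs.scale_left_diff_distrib sum_subtractf)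
    also have "(\<Sum>i\<le>?N. cscale (coeff (pCons 0 q) i) ((T ^^ i) x)) =
        (\<Sum>i\<le>degree q. cscale (coeff q i) (T ((T ^^ i) x)))"
      by (simp add: sum.atMost_Suc_shift del: sum.atMost_Suc)
    also have "\<dots> = T (ev q)" unfolding ev_def by (simp add: Tsum scale)
    also have "(\<Sum>i\<le>?N. cscale (\<mu> * coeff q i) ((T ^^ i) x)) = cscale \<mu> (ev q)"
      unfolding ev_def by (simp add: coeff_eq_0 fs.scale_sum_right)
    finally show ?thesis .
  qed
  obtain p0 where "p0 \<noteq> 0 \<and> ev p0 = 0"
  proof -
    have "\<not> lin_indep (\<lambda>i. (T ^^ i) x) {..card S}"
    proof
      assume "lin_indep (\<lambda>i. (T ^^ i) x) {..card S}"
      then have "card {..card S} \<le> card S" using S by (intro lin_indep_card_le) auto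
      then show False by simp
    qed
    then obtain c i where c: "(\<Sum>i\<le>card S. cscale (c i) ((T ^^ i) x)) = 0" and i: "i \<le> card S" "c i \<noteq> 0"
      unfolding lin_indep_def by blast
    define p where "p = (\<Sum>i\<le>card S. monom (c i) i)"
    have cp: "coeff p i = (if i \<le> card S then c i else 0)" for i
      unfolding p_def by (simp add: coeff_sum)
    have "degree p \<le> card S" by (rule degree_le) (simp add: cp)
    then have "ev p = 0" using c by (simp add: ev cp)
    moreover have "p \<noteq> 0" using cp[of i] i by auto
    ultimately show ?thesis using that by blast
  qed
  then obtain p where p: "p \<noteq> 0" "ev p = 0" and min: "\<And>q. q \<noteq> 0 \<Longrightarrow> ev q = 0 \<Longrightarrow> degree p \<le> degree q"
    using ex_has_least_nat[of "\<lambda>p. p \<noteq> 0 \<and> ev p = 0" p0 degree] by blast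
  obtain \<theta> where \<theta>: "linear_retraction F \<theta>" using linear_retraction_exists[OF F] .
  note \<theta>s = linear_retractionD[OF \<theta>]
  \<comment> \<open>The least relation is made monic before it is retracted, so that the leading
    coefficient survives and the degree stays minimal.\<close>
  define r where "r = (\<Sum>i\<le>degree p. monom (\<theta> (coeff p i / lead_coeff p)) i)"
  have cr: "coeff r i = \<theta> (coeff p i / lead_coeff p)" for i
    unfolding r_def by (simp add: coeff_sum coeff_eq_0 \<theta>s(7))
  have r1: "coeff r (degree p) = 1" using p(1) by (simp add: cr \<theta>s(6))
  have dr: "degree r = degree p"
  proof (rule order.antisym)
    show "degree r \<le> degree p" by (rule degree_le) (simp add: cr coeff_eq_0 \<theta>s(7))
    show "degree p \<le> degree r" by (rule le_degree) (simp add: r1)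
  qed
  have r0: "r \<noteq> 0" using r1 by auto
  have evr: "ev r = 0"
  proof
    fix y
    have "(\<Sum>i\<le>degree p. (coeff p i / lead_coeff p) * (T ^^ i) x y) = ev p y / lead_coeff p"
      unfolding ev_def by (simp add: sum_divide_distrib fun_apply)
    then have "\<theta> (\<Sum>i\<le>degree p. (coeff p i / lead_coeff p) * (T ^^ i) x y) = 0"
      using p(2) \<theta>s(7) by (simp add: fun_apply)
    moreover have "\<theta> ((coeff p i / lead_coeff p) * (T ^^ i) x y) = coeff r i * (T ^^ i) x y" for i
      unfolding cr using \<theta>s(4)[OF rat] by blast
    ultimately show "ev r y = 0 y"
      unfolding ev_def dr by (simp add: linear_retraction_sum[OF \<theta>] fun_apply del: times_divide_eq_left)
  qed
  have "degree r \<noteq> 0"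
  proof
    assume d: "degree r = 0"
    then have "ev r = cscale (coeff r 0) x" unfolding ev_def by simp
    moreover have "coeff r 0 \<noteq> 0" using d r0 leading_coeff_neq_0 by metis
    ultimately show False using evr x by simp
  qed
  then obtain \<mu> where \<mu>: "poly r \<mu> = 0"
    using fundamental_theorem_of_algebra[of r] constant_degree[of r] by auto
  then obtain q where q: "r = [:- \<mu>, 1:] * q" unfolding poly_eq_0_iff_dvd dvd_def by blast
  have q0: "q \<noteq> 0" using q r0 by auto
  have "degree r = Suc (degree q)" unfolding q using q0 by (subst degree_mult_eq) auto
  \<comment> \<open>As \<open>q\<close> has smaller degree than the least relation, its value is a
    nonzero vector, and (X - \<mu>) q = r makes it an eigenvector.\<close>
  then have "ev q \<noteq> 0" using min[OF q0] dr by auto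
  moreover have "r = pCons 0 q - smult \<mu> q" unfolding q by simp
  then have "T (ev q) = cscale \<mu> (ev q)" using ev_lin[where q = q and \<mu> = \<mu>] evr by simp
  moreover have "ev q \<in> fs.span (range (\<lambda>k. (T ^^ k) x))"
    unfolding ev_def by (intro fs.span_sum fs.span_scale fs.span_base) auto
  ultimately show ?thesis using that[OF r0 _ \<mu>] \<theta>s(1) cr by metis
qed

section \<open>Finite extensions inside the complex numbers\<close>

text \<open>\<open>ring.eval\<close> reads a list with the leading coefficient first,
  \<open>Poly\<close> with the constant coefficient first; hence the \<open>rev\<close>.\<close>

lemma eval_complex: "ring.eval (class_ring :: complex ring) (rev xs) x = poly (Poly xs) x"
proof (induction xs rule: rev_induct)
  case Nil
  then show ?case by (simp add: ring.eval.simps[OF ring_class_ring] class_ring_simps)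
next
  case (snoc a xs)
  then show ?case
    by (simp add: ring.eval.simps[OF ring_class_ring] class_ring_simps Poly_append poly_monom)
qed

lemma simple_extension_complex:
  assumes F: "csubfield F"
    and p: "p \<noteq> 0" "\<And>i. coeff p i \<in> F" "poly p \<mu> = 0"
  defines "E \<equiv> ring.simple_extension class_ring F \<mu>"
  shows "subfield E class_ring" "F \<subseteq> E" "\<exists>d. ring.dimension class_ring d F E"
proof -
  have "((\<lambda>K x. \<not> ring.transcendental class_ring K x) over F) \<mu>"
  proof (rule ring.algebraicI[OF ring_class_ring])
    show "rev (coeffs p) \<in> carrier (univ_poly class_ring F)"
      using p unfolding univ_poly_def polynomial_def
      by (auto simp: hd_rev last_coeffs_eq_coeff_degree class_ring_simps coeffs_def[of p])
    show "rev (coeffs p) \<noteq> []" using p(1) by simp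
    show "ring.eval class_ring (rev (coeffs p)) \<mu> = \<zero>\<^bsub>class_ring\<^esub>" using p(3) by (simp add: eval_complex class_ring_simps)
  qed
  moreover have c: "\<mu> \<in> carrier class_ring" by (simp add: class_ring_simps)
  ultimately show "subfield E class_ring" "\<exists>d. ring.dimension class_ring d F E" "F \<subseteq> E"
    unfolding E_def using domain.simple_extension_is_subfield[OF domain_class_ring F c] domain.dimension_simple_extension[OF domain_class_ring F c]
      ring.simple_extension_incl[OF ring_class_ring subfieldE(3)[OF F] c] by blast+
qed

lemma combine_complex:
  assumes "length Ks = length Us"
  shows "ring.combine (class_ring :: complex ring) Ks Us = (\<Sum>i<length Us. Ks ! i * Us ! i)"
  using assms
proof (induction Ks Us rule: list_induct2)
  case Nil
  then show ?case by (simp add: ring.combine.simps[OF ring_class_ring] class_ring_simps)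
next
  case (Cons k Ks u Us)
  then show ?case
    by (simp add: ring.combine.simps[OF ring_class_ring] class_ring_simps sum.lessThan_Suc_shift
        del: sum.lessThan_Suc)
qed

lemma dimension_complex_basis:
  assumes F: "csubfield F" and dim: "ring.dimension class_ring d F E"
  obtains y where "\<And>i. i < d \<Longrightarrow> y i \<in> E"
    "\<And>z. z \<in> E \<Longrightarrow> \<exists>k. (\<forall>i<d. k i \<in> F) \<and> z = (\<Sum>i<d. k i * y i)"
    "\<And>k. (\<And>i. i < d \<Longrightarrow> k i \<in> F) \<Longrightarrow> (\<Sum>i<d. k i * y i) = 0 \<Longrightarrow> \<forall>i<d. k i = 0"
proof -
  obtain Vs where Vs: "set Vs \<subseteq> carrier class_ring" "ring.independent class_ring F Vs" "length Vs = d" "ring.Span class_ring F Vs = E"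
    using ring.exists_base[OF ring_class_ring F dim] by blast
  show ?thesis
  proof (rule that[of "(!) Vs"])
    show "Vs ! i \<in> E" if "i < d" for i
      using ring.Span_base_incl[OF ring_class_ring F Vs(1)] Vs(3,4) that by auto
    show "\<exists>k. (\<forall>i<d. k i \<in> F) \<and> z = (\<Sum>i<d. k i * Vs ! i)" if "z \<in> E" for z
    proof -
      have "z \<in> ring.Span class_ring F Vs" using that Vs(4) by simp
      from iffD1[OF ring.Span_mem_iff_length_version[OF ring_class_ring F Vs(1)] this]
      obtain Ks where "set Ks \<subseteq> F" "length Ks = length Vs" "z = ring.combine class_ring Ks Vs" by blast
      then show ?thesis using Vs(3) by (intro exI[of _ "(!) Ks"]) (auto simp: combine_complex)
    qed
    show "\<forall>i<d. k i = 0" if k: "\<And>i. i < d \<Longrightarrow> k i \<in> F" "(\<Sum>i<d. k i * Vs ! i) = 0" for k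
    proof -
      have "ring.combine class_ring (map k [0..<d]) Vs = 0"
        using k(2) Vs(3) by (subst combine_complex) auto
      moreover have "set (map k [0..<d]) \<subseteq> F" using k(1) by auto
      ultimately have "set (take (length Vs) (map k [0..<d])) \<subseteq> {0}"
        using ring.independent_imp_trivial_combine[OF ring_class_ring F Vs(2), of "map k [0..<d]"]
        unfolding class_ring_simps by blast
      then show ?thesis using Vs(3) by (auto simp: image_subset_iff)
    qed
  qed
qed

text \<open>Induction on the number of maps: the relation at \<open>x * y\<close> minus
  \<open>s y\<close> times the relation at \<open>x\<close> no longer contains \<open>s\<close>, and
  \<open>y\<close> can be chosen to separate a given \<sigma> from \<open>s\<close>. Extensionality
  turns inequality of maps into a separating point inside \<open>L\<close>.\<close>

lemma Dedekind_independence: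
  fixes c :: "('a :: field \<Rightarrow> 'b :: field) \<Rightarrow> 'b"
  assumes "finite S" and L: "1 \<in> L" "\<And>x y. x \<in> L \<Longrightarrow> y \<in> L \<Longrightarrow> x * y \<in> L"
    and one: "\<And>\<sigma>. \<sigma> \<in> S \<Longrightarrow> \<sigma> 1 = 1"
    and mult: "\<And>\<sigma> x y. \<sigma> \<in> S \<Longrightarrow> x \<in> L \<Longrightarrow> y \<in> L \<Longrightarrow> \<sigma> (x * y) = \<sigma> x * \<sigma> y"
    and ext: "S \<subseteq> extensional L"
    and rel: "\<And>x. x \<in> L \<Longrightarrow> (\<Sum>\<sigma>\<in>S. c \<sigma> * \<sigma> x) = 0"
  shows "\<forall>\<sigma>\<in>S. c \<sigma> = 0"
  using assms(1) one mult ext rel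
proof (induction S arbitrary: c rule: finite_induct)
  case (insert s S)
  have c0: "c \<sigma> = 0" if \<sigma>: "\<sigma> \<in> S" for \<sigma>
  proof -
    have "\<sigma> \<noteq> s" "\<sigma> \<in> extensional L" "s \<in> extensional L" using \<sigma> insert by auto
    then obtain y where y: "y \<in> L" "\<sigma> y \<noteq> s y" using extensionalityI by blast
    have "\<forall>\<sigma>\<in>S. c \<sigma> * (\<sigma> y - s y) = 0"
    proof (rule insert.IH)
      fix x assume x: "x \<in> L"
      have "(\<Sum>\<sigma>\<in>S. c \<sigma> * (\<sigma> y - s y) * \<sigma> x) = (\<Sum>\<sigma>\<in>S. c \<sigma> * \<sigma> (x * y)) - s y * (\<Sum>\<sigma>\<in>S. c \<sigma> * \<sigma> x)"
        unfolding sum_distrib_left sum_subtractf[symmetric]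
        using x y(1) insert.prems(2) by (intro sum.cong) (auto simp: algebra_simps)
      also have "(\<Sum>\<sigma>\<in>S. c \<sigma> * \<sigma> (x * y)) = - (c s * s (x * y))"
        using insert.prems(4)[OF L(2)[OF x y(1)]] insert.hyps by (simp add: eq_neg_iff_add_eq_0 add.commute)
      also have "(\<Sum>\<sigma>\<in>S. c \<sigma> * \<sigma> x) = - (c s * s x)"
        using insert.prems(4)[OF x] insert.hyps by (simp add: eq_neg_iff_add_eq_0 add.commute)
      also have "- (c s * s (x * y)) - s y * - (c s * s x) = 0"
        using insert.prems(2)[of s x y] x y(1) by simp
      finally show "(\<Sum>\<sigma>\<in>S. c \<sigma> * (\<sigma> y - s y) * \<sigma> x) = 0" .
    qed (use insert.prems in auto)
    then show ?thesis using y \<sigma> by auto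
  qed
  have "c s * s 1 = 0" using insert.prems(4)[OF L(1)] insert.hyps c0 by simp
  moreover have "s 1 = 1" using insert.prems(1) by blast
  ultimately show ?case using c0 by auto
qed simp

section \<open>Galois groups\<close>

lemma Gal_iff:
  "\<sigma> \<in> Gal L F \<longleftrightarrow> \<sigma> \<in> extensional L \<and> bij_betw \<sigma> L L \<and> \<sigma> 1 = 1 \<and> (\<forall>x\<in>F. \<sigma> x = x) \<and>
     (\<forall>x\<in>L. \<forall>y\<in>L. \<sigma> (x + y) = \<sigma> x + \<sigma> y) \<and> (\<forall>x\<in>L. \<forall>y\<in>L. \<sigma> (x * y) = \<sigma> x * \<sigma> y)"
  unfolding Gal_def ring_iso_def Ring.ring_hom_def by (auto simp: class_ring_simps bij_betw_apply)

lemma GalD: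
  assumes "\<sigma> \<in> Gal L F" and L: "csubfield L"
  shows "\<sigma> \<in> extensional L" "bij_betw \<sigma> L L" "\<sigma> 1 = 1" "\<sigma> 0 = 0" "x \<in> F \<Longrightarrow> \<sigma> x = x"
    "x \<in> L \<Longrightarrow> \<sigma> x \<in> L" "x \<in> L \<Longrightarrow> y \<in> L \<Longrightarrow> \<sigma> (x + y) = \<sigma> x + \<sigma> y"
    "x \<in> L \<Longrightarrow> y \<in> L \<Longrightarrow> \<sigma> (x * y) = \<sigma> x * \<sigma> y"
proof -
  show *: "\<sigma> \<in> extensional L" "bij_betw \<sigma> L L" "\<sigma> 1 = 1" "x \<in> F \<Longrightarrow> \<sigma> x = x"
    "x \<in> L \<Longrightarrow> \<sigma> x \<in> L" "x \<in> L \<Longrightarrow> y \<in> L \<Longrightarrow> \<sigma> (x + y) = \<sigma> x + \<sigma> y"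
    "x \<in> L \<Longrightarrow> y \<in> L \<Longrightarrow> \<sigma> (x * y) = \<sigma> x * \<sigma> y" for x y
    using assms(1) unfolding Gal_iff by (auto dest: bij_betw_apply)
  show "\<sigma> 0 = 0" using *(6)[of 0 0] subfield_complexD(1)[OF L] by simp
qed

lemma Gal_sum:
  assumes "\<sigma> \<in> Gal L F" and L: "csubfield L" and "\<And>i. i \<in> I \<Longrightarrow> f i \<in> L"
  shows "\<sigma> (\<Sum>i\<in>I. f i) = (\<Sum>i\<in>I. \<sigma> (f i))"
  using assms(3)
  by (induction I rule: infinite_finite_induct)
    (simp_all add: GalD[OF assms(1) L] subfield_complex_sum[OF L])

lemma Gal_compose:
  assumes "\<sigma> \<in> Gal L F" "\<tau> \<in> Gal L F" and L: "csubfield L" and "F \<subseteq> L"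
  shows "compose L \<sigma> \<tau> \<in> Gal L F"
proof -
  note s = GalD[OF assms(1) L] and t = GalD[OF assms(2) L] and Ls = subfield_complexD[OF L]
  have "bij_betw (compose L \<sigma> \<tau>) L L" using bij_betw_compose[OF t(2) s(2)] .
  then show ?thesis
    unfolding Gal_iff using assms(4) s t Ls by (auto simp: compose_def subset_iff)
qed

lemma Gal_compose_inj:
  assumes "\<sigma> \<in> Gal L F" and L: "csubfield L"
  shows "inj_on (compose L \<sigma>) (Gal L F)"
proof (rule inj_onI, rule extensionalityI)
  fix \<tau> \<tau>' assume t: "\<tau> \<in> Gal L F" "\<tau>' \<in> Gal L F" and eq: "compose L \<sigma> \<tau> = compose L \<sigma> \<tau>'"
  show "\<tau> \<in> extensional L" "\<tau>' \<in> extensional L" using GalD(1)[OF _ L] t by auto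
  fix x assume x: "x \<in> L"
  have "\<sigma> (\<tau> x) = \<sigma> (\<tau>' x)" using fun_cong[OF eq, of x] x by (simp add: compose_def)
  then show "\<tau> x = \<tau>' x"
    using GalD(2)[OF assms] GalD(6)[OF t(1) L x] GalD(6)[OF t(2) L x] unfolding bij_betw_def inj_on_def by blast
qed

text \<open>A fixed \<open>x\<close> outside \<open>K\<close> would give a nontrivial relation
  between the automorphisms. Let \<open>y 0\<close>, ..., \<open>y (m - 1)\<close> span
  \<open>L\<close> over \<open>K\<close>. The m automorphisms, evaluated only at the
  \<open>y i\<close> with \<open>0 < i\<close>, are m vectors in a space of dimension m - 1, hence
  dependent. The element \<open>x\<close> serves to extend the relation to \<open>y 0\<close>, and
  \<open>K\<close>-linearity extends it to all of \<open>L\<close>, against Dedekind.\<close>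

lemma Gal_fixed_field:
  assumes K: "csubfield K" and L: "csubfield L"
    and KL: "K \<subseteq> L" and dim: "ring.dimension class_ring m K L"
    and fin: "finite (Gal L K)" and card: "card (Gal L K) = m"
    and x: "x \<in> L" "\<And>\<sigma>. \<sigma> \<in> Gal L K \<Longrightarrow> \<sigma> x = x"
  shows "x \<in> K"
proof (rule ccontr)
  assume nx: "x \<notin> K"
  note Ls = subfield_complexD[OF L]
  obtain y where yL: "\<And>i. i < m \<Longrightarrow> y i \<in> L"
    and sp: "\<And>z. z \<in> L \<Longrightarrow> \<exists>k. (\<forall>i<m. k i \<in> K) \<and> z = (\<Sum>i<m. k i * y i)"
    using dimension_complex_basis[OF K dim] by metis
  have m0: "0 < m"
  proof (rule ccontr)
    assume "\<not> 0 < m"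
    then show False using sp[OF Ls(2)] by simp
  qed
  define v where "v \<sigma> i = (if 0 < i \<and> i < m then \<sigma> (y i) else 0)" for \<sigma> :: "complex \<Rightarrow> complex" and i
  have "\<not> lin_indep v (Gal L K)"
  proof
    assume "lin_indep v (Gal L K)"
    moreover have "v ` Gal L K \<subseteq> fs.span (unit_fun ` {0<..<m})"
      by (auto intro!: in_span_unit_fun simp: v_def)
    ultimately have "card (Gal L K) \<le> card (unit_fun ` {0<..<m})"
      using fin by (intro lin_indep_card_le) auto
    then show False using m0 card by (simp add: card_unit_fun)
  qed
  then obtain c \<sigma>0 where c: "(\<Sum>\<sigma>\<in>Gal L K. cscale (c \<sigma>) (v \<sigma>)) = 0" and c0: "\<sigma>0 \<in> Gal L K" "c \<sigma>0 \<noteq> 0"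
    unfolding lin_indep_def by blast
  have rel: "(\<Sum>\<sigma>\<in>Gal L K. c \<sigma> * \<sigma> (y i)) = 0" if "0 < i" "i < m" for i
    using fun_cong[OF c, of i] that by (simp add: v_def fun_apply)
  have \<sigma>_lin: "\<sigma> (\<Sum>i\<in>I. k i * y i) = (\<Sum>i\<in>I. k i * \<sigma> (y i))"
    if s: "\<sigma> \<in> Gal L K" and I: "I \<subseteq> {..<m}" and k: "\<forall>i\<in>I. k i \<in> K" for \<sigma> k I
  proof -
    have "\<sigma> (\<Sum>i\<in>I. k i * y i) = (\<Sum>i\<in>I. \<sigma> (k i * y i))"
      using I k KL yL by (intro Gal_sum[OF s L] Ls(6)) auto
    also have "\<dots> = (\<Sum>i\<in>I. k i * \<sigma> (y i))"
    proof (rule sum.cong[OF refl])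
      fix i assume "i \<in> I"
      then have "k i \<in> K" "k i \<in> L" "y i \<in> L" using I k KL yL by auto
      then show "\<sigma> (k i * y i) = k i * \<sigma> (y i)" using GalD(5,8)[OF s L] by simp
    qed
    finally show ?thesis .
  qed
  \<comment> \<open>In (x - k 0) y 0 the contribution of \<open>y 0\<close> cancels, so this element
    is a \<open>K\<close>-combination of the other \<open>y i\<close>. The factor x - k 0 is fixed
    by all \<sigma>, and it is nonzero because \<open>x\<close> is not in \<open>K\<close>.\<close>
  have rel0: "(\<Sum>\<sigma>\<in>Gal L K. c \<sigma> * \<sigma> (y 0)) = 0"
  proof -
    obtain k where k: "\<forall>i<m. k i \<in> K" "x * y 0 = (\<Sum>i<m. k i * y i)"
      using sp[OF Ls(6)[OF x(1) yL[OF m0]]] by blast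
    have k0: "k 0 \<in> K" "k 0 \<in> L" using k m0 KL by auto
    have split: "{..<m} = insert 0 {0<..<m}" using m0 by auto
    have "x * y 0 - k 0 * y 0 = (\<Sum>i\<in>{0<..<m}. k i * y i)"
      unfolding k(2) split by simp
    then have e: "(x - k 0) * y 0 = (\<Sum>i\<in>{0<..<m}. k i * y i)" by (simp add: left_diff_distrib)
    have xk: "(x - k 0) * \<sigma> (y 0) = (\<Sum>i\<in>{0<..<m}. k i * \<sigma> (y i))" if s: "\<sigma> \<in> Gal L K" for \<sigma>
    proof -
      have "\<sigma> ((x - k 0) * y 0) = \<sigma> (x - k 0) * \<sigma> (y 0)"
        using GalD(8)[OF s L] Ls(5)[OF x(1) k0(2)] yL[OF m0] by blast
      moreover have "\<sigma> (x - k 0) + \<sigma> (k 0) = \<sigma> x"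
        using GalD(7)[OF s L Ls(5)[OF x(1) k0(2)] k0(2)] by simp
      then have "\<sigma> (x - k 0) = x - k 0"
        using GalD(5)[OF s L k0(1)] x(2)[OF s] by (simp add: eq_diff_eq)
      moreover have "{0<..<m} \<subseteq> {..<m}" by auto
      ultimately show ?thesis using \<sigma>_lin[OF s, of "{0<..<m}" k] k(1) unfolding e by auto
    qed
    have "(x - k 0) * (\<Sum>\<sigma>\<in>Gal L K. c \<sigma> * \<sigma> (y 0)) = (\<Sum>\<sigma>\<in>Gal L K. c \<sigma> * ((x - k 0) * \<sigma> (y 0)))"
      by (simp add: sum_distrib_left mult.left_commute)
    also have "\<dots> = (\<Sum>\<sigma>\<in>Gal L K. \<Sum>i\<in>{0<..<m}. k i * (c \<sigma> * \<sigma> (y i)))"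
      by (simp add: xk sum_distrib_left mult.left_commute cong: sum.cong)
    also have "\<dots> = (\<Sum>i\<in>{0<..<m}. k i * (\<Sum>\<sigma>\<in>Gal L K. c \<sigma> * \<sigma> (y i)))"
      by (subst sum.swap) (simp add: sum_distrib_left)
    also have "\<dots> = 0" by (simp add: rel)
    finally show ?thesis using nx k0(1) by auto
  qed
  have "\<forall>\<sigma>\<in>Gal L K. c \<sigma> = 0"
  proof (rule Dedekind_independence[OF fin Ls(2) Ls(6)])
    fix z assume "z \<in> L"
    then obtain k where k: "\<forall>i<m. k i \<in> K" "z = (\<Sum>i<m. k i * y i)" using sp by blast
    have "(\<Sum>\<sigma>\<in>Gal L K. c \<sigma> * \<sigma> z) = (\<Sum>\<sigma>\<in>Gal L K. \<Sum>i<m. k i * (c \<sigma> * \<sigma> (y i)))"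
    proof (rule sum.cong[OF refl])
      fix \<sigma> assume "\<sigma> \<in> Gal L K"
      then have "\<sigma> z = (\<Sum>i<m. k i * \<sigma> (y i))" using \<sigma>_lin[OF _ subset_refl, of \<sigma> k] k by simp
      then show "c \<sigma> * \<sigma> z = (\<Sum>i<m. k i * (c \<sigma> * \<sigma> (y i)))"
        by (simp add: sum_distrib_left mult.left_commute)
    qed
    also have "\<dots> = (\<Sum>i<m. k i * (\<Sum>\<sigma>\<in>Gal L K. c \<sigma> * \<sigma> (y i)))"
      by (subst sum.swap) (simp add: sum_distrib_left)
    also have "\<dots> = 0"
    proof (rule sum.neutral, rule ballI)
      fix i assume "i \<in> {..<m}"
      then show "k i * (\<Sum>\<sigma>\<in>Gal L K. c \<sigma> * \<sigma> (y i)) = 0" using rel0 rel[of i] by (cases "i = 0") auto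
    qed
    finally show "(\<Sum>\<sigma>\<in>Gal L K. c \<sigma> * \<sigma> z) = 0" .
  qed (use GalD[OF _ L] in auto)
  then show False using c0 by blast
qed

section \<open>Matrices as functions\<close>

type_synonym cmat = "nat \<Rightarrow> nat \<Rightarrow> complex"

definition mm :: "nat \<Rightarrow> cmat \<Rightarrow> cmat \<Rightarrow> cmat" where
  "mm n A B = (\<lambda>a b. \<Sum>c<n. A a c * B c b)"

definition mv :: "nat \<Rightarrow> cmat \<Rightarrow> (nat \<Rightarrow> complex) \<Rightarrow> nat \<Rightarrow> complex" where
  "mv n A f = (\<lambda>a. \<Sum>b<n. A a b * f b)"

definition vm :: "nat \<Rightarrow> (nat \<Rightarrow> complex) \<Rightarrow> cmat \<Rightarrow> nat \<Rightarrow> complex" where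
  "vm n f A = (\<lambda>b. \<Sum>a<n. f a * A a b)"

definition idm :: "nat \<Rightarrow> cmat" where
  "idm n = (\<lambda>a b. if a = b \<and> a < n then 1 else 0)"

definition trm :: "nat \<Rightarrow> cmat \<Rightarrow> complex" where
  "trm n A = (\<Sum>a<n. A a a)"

definition msupp :: "nat \<Rightarrow> cmat \<Rightarrow> bool" where
  "msupp n A \<longleftrightarrow> (\<forall>a b. \<not> (a < n \<and> b < n) \<longrightarrow> A a b = 0)"

definition vsupp :: "nat \<Rightarrow> (nat \<Rightarrow> complex) set" where
  "vsupp n = {f. \<forall>a\<ge>n. f a = 0}"

lemma mm_assoc: "mm n (mm n A B) C = mm n A (mm n B C)"
proof (intro ext)
  fix a b
  show "mm n (mm n A B) C a b = mm n A (mm n B C) a b"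
    unfolding mm_def sum_distrib_left sum_distrib_right
    by (subst sum.swap) (simp add: mult.assoc)
qed

lemma mv_mm: "mv n (mm n A B) f = mv n A (mv n B f)"
proof
  fix a
  show "mv n (mm n A B) f a = mv n A (mv n B f) a"
    unfolding mm_def mv_def sum_distrib_left sum_distrib_right
    by (subst sum.swap) (simp add: mult.assoc)
qed

lemma mm_row: "mm n A B a = vm n (A a) B"
  by (simp add: mm_def vm_def fun_eq_iff)

lemma mm_idm:
  assumes "msupp n A"
  shows "mm n (idm n) A = A" "mm n A (idm n) = A"
proof -
  have A: "A a b = 0" if "\<not> (a < n \<and> b < n)" for a b using assms that unfolding msupp_def by blast
  have "(\<Sum>c<n. idm n a c * A c b) = (\<Sum>c<n. if c = a then A a b else 0)" for a b
    by (rule sum.cong) (auto simp: idm_def)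
  then show "mm n (idm n) A = A" using A by (auto simp: mm_def fun_eq_iff)
  have "(\<Sum>c<n. A a c * idm n c b) = (\<Sum>c<n. if c = b then A a b else 0)" for a b
    by (rule sum.cong) (auto simp: idm_def)
  then show "mm n A (idm n) = A" using A by (auto simp: mm_def fun_eq_iff)
qed

lemma mm_msupp: "msupp n A \<Longrightarrow> msupp n B \<Longrightarrow> msupp n (mm n A B)"
  by (auto simp: mm_def msupp_def)

lemma msupp_idm: "msupp n (idm n)"
  by (auto simp: msupp_def idm_def)

lemma msupp_row: "msupp n A \<Longrightarrow> A a \<in> vsupp n"
  by (auto simp: msupp_def vsupp_def)

lemma mv_lin: "mv n A (f + g) = mv n A f + mv n A g" "mv n A (cscale c f) = cscale c (mv n A f)"
  by (auto simp: mv_def fun_eq_iff fun_apply algebra_simps sum.distrib sum_distrib_left)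

lemma vm_lin: "vm n (f + g) A = vm n f A + vm n g A" "vm n (cscale c f) A = cscale c (vm n f A)"
  by (auto simp: vm_def fun_eq_iff fun_apply algebra_simps sum.distrib sum_distrib_left)

lemma vm_sum: "vm n (sum f I) A = (\<Sum>i\<in>I. vm n (f i) A)"
  by (auto simp: vm_def fun_eq_iff fun_apply sum_distrib_right intro: sum.swap)

lemma trm_mm_commute: "trm n (mm n A B) = trm n (mm n B A)"
  unfolding trm_def mm_def by (subst sum.swap) (simp add: mult.commute)

lemma vsupp_subspace: "fs.subspace (vsupp n)"
  by (rule fs.subspaceI) (auto simp: vsupp_def fun_apply)

lemma vsupp_span: "vsupp n = fs.span (uvecs n)"
proof
  show "vsupp n \<subseteq> fs.span (uvecs n)"
  proof
    fix f :: "nat \<Rightarrow> complex" assume "f \<in> vsupp n"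
    then show "f \<in> fs.span (uvecs n)"
      by (intro in_span_unit_fun) (auto simp: vsupp_def)
  qed
  show "fs.span (uvecs n) \<subseteq> vsupp n"
    by (rule fs.span_minimal[OF _ vsupp_subspace]) (auto simp: vsupp_def unit_fun_def)
qed

lemma mv_unit_fun: "b < n \<Longrightarrow> mv n A (unit_fun b) = (\<lambda>a. A a b)"
  by (auto simp: mv_def unit_fun_def fun_eq_iff if_distrib[of "\<lambda>x. _ * x"] sum.delta' sum.delta cong: if_cong)

lemma subspace_vecI:
  assumes "W \<subseteq> carrier_vec n" "0\<^sub>v n \<in> W"
    and "\<And>v w. v \<in> W \<Longrightarrow> w \<in> W \<Longrightarrow> v + w \<in> W" "\<And>c v. v \<in> W \<Longrightarrow> c \<cdot>\<^sub>v v \<in> W"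
  shows "VectorSpace.subspace class_ring W (module_vec TYPE(complex) n)"
  using assms by (intro VectorSpace.subspace.intro vec_vs submodule.intro vec_module)
    (auto simp: module_vec_simps)

section \<open>The block of the group algebra belonging to an irreducible representation\<close>

text \<open>The product of every \<open>group_algebra L G\<close>, without reference to
  \<open>L\<close>, so that complex and \<open>L\<close>-rational elements are multiplied by one
  operation.\<close>

definition conv :: "('g, 'b) monoid_scheme \<Rightarrow> ('g \<Rightarrow> complex) \<Rightarrow> ('g \<Rightarrow> complex) \<Rightarrow> 'g \<Rightarrow> complex" where
  "conv G x y = (\<lambda>g. if g \<in> carrier G then \<Sum>h\<in>carrier G. x h * y (inv\<^bsub>G\<^esub> h \<otimes>\<^bsub>G\<^esub> g) else 0)"

locale finite_irrep = group G for G (structure) +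
  fixes n :: nat and \<phi> :: "'a \<Rightarrow> complex mat"
  assumes finite_carrier: "finite (carrier G)"
    and irr: "irreducible_rep G n \<phi>"
begin

text \<open>The entries outside the \<open>n \<times> n\<close> square are set to \<open>0\<close>, so that rows, columns and products
  stay supported below \<open>n\<close>.\<close>

definition M :: "'a \<Rightarrow> cmat" where
  "M g = (\<lambda>a b. if a < n \<and> b < n then \<phi> g $$ (a, b) else 0)"

lemma n_pos: "0 < n"
  using irr by (simp add: irreducible_rep_def)

lemma card_pos: "0 < card (carrier G)"
  using finite_carrier one_closed card_gt_0_iff by blast

lemma M_msupp: "msupp n (M g)"
  by (auto simp: M_def msupp_def)

lemma \<phi>_hom: "\<phi> \<in> hom G (units_of (ring_mat TYPE(complex) n ()))"
  using irr by (simp add: irreducible_rep_def matrix_rep_def)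

lemma \<phi>_carrier: "g \<in> carrier G \<Longrightarrow> \<phi> g \<in> carrier_mat n n"
  using \<phi>_hom unfolding hom_def by (auto simp: units_of_carrier Units_def ring_mat_simps)

lemma \<phi>_mult: "g \<in> carrier G \<Longrightarrow> h \<in> carrier G \<Longrightarrow> \<phi> (g \<otimes> h) = \<phi> g * \<phi> h"
  using \<phi>_hom unfolding hom_def by (auto simp: units_of_mult ring_mat_simps)

lemma \<phi>_one: "\<phi> \<one> = 1\<^sub>m n"
proof -
  interpret R: ring "ring_mat TYPE(complex) n ()" by (rule ring_mat)
  interpret group_hom G "units_of (ring_mat TYPE(complex) n ())" \<phi>
    using R.units_group \<phi>_hom by (intro group_hom.intro group_hom_axioms.intro group_axioms) auto
  show ?thesis using hom_one by (simp add: units_of_one ring_mat_simps)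
qed

lemma M_mult: "g \<in> carrier G \<Longrightarrow> h \<in> carrier G \<Longrightarrow> M (g \<otimes> h) = mm n (M g) (M h)"
  using \<phi>_carrier[of g] \<phi>_carrier[of h]
  by (auto simp: M_def mm_def fun_eq_iff \<phi>_mult scalar_prod_def lessThan_atLeast0 intro!: sum.cong)

lemma M_one: "M \<one> = idm n"
  by (auto simp: M_def idm_def \<phi>_one fun_eq_iff)

lemma M_inv: "g \<in> carrier G \<Longrightarrow> mm n (M g) (M (inv g)) = idm n"
  "g \<in> carrier G \<Longrightarrow> mm n (M (inv g)) (M g) = idm n"
  using M_mult[of g "inv g"] M_mult[of "inv g" g] M_one by auto

text \<open>\<open>vec n\<close> identifies functions vanishing from \<open>n\<close> on with
  vectors of dimension \<open>n\<close>; irreducibility is transferred along it.\<close>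

lemma irreducible:
  assumes W: "fs.subspace W" "W \<subseteq> vsupp n"
    and inv: "\<And>g f. g \<in> carrier G \<Longrightarrow> f \<in> W \<Longrightarrow> mv n (M g) f \<in> W"
  shows "W = {0} \<or> W = vsupp n"
proof -
  let ?W = "vec n ` W"
  have sub: "VectorSpace.subspace class_ring ?W (module_vec TYPE(complex) n)"
  proof (rule subspace_vecI)
    show "v + w \<in> ?W" if vw: "v \<in> ?W" "w \<in> ?W" for v w
    proof -
      obtain f g where "v = vec n f" "w = vec n g" "f \<in> W" "g \<in> W" using vw by blast
      moreover have "vec n f + vec n g = vec n (f + g)" by (auto simp: fun_apply)
      ultimately show ?thesis using fs.subspace_add[OF W(1)] by auto
    qed
    have "0\<^sub>v n = vec n (0 :: nat \<Rightarrow> complex)" by (auto simp: fun_apply)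
    then show "0\<^sub>v n \<in> ?W" using fs.subspace_0[OF W(1)] by auto
    show "c \<cdot>\<^sub>v v \<in> ?W" if v: "v \<in> ?W" for c v
    proof -
      obtain f where "v = vec n f" "f \<in> W" using v by blast
      moreover have "c \<cdot>\<^sub>v vec n f = vec n (cscale c f)" by (auto simp: fun_apply)
      ultimately show ?thesis using fs.subspace_scale[OF W(1)] by auto
    qed
  qed auto
  have "\<phi> g *\<^sub>v w \<in> ?W" if g: "g \<in> carrier G" and w: "w \<in> ?W" for g w
  proof -
    obtain f where f: "w = vec n f" "f \<in> W" using w by blast
    have "\<phi> g *\<^sub>v vec n f = vec n (mv n (M g) f)"
      using \<phi>_carrier[OF g]
      by (intro eq_vecI) (auto simp: mv_def M_def scalar_prod_def lessThan_atLeast0 intro!: sum.cong)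
    then show ?thesis using inv[OF g f(2)] f(1) by auto
  qed
  then have alt: "?W = {0\<^sub>v n} \<or> ?W = carrier_vec n"
    using irr sub unfolding irreducible_rep_def by blast
  have inj: "f = g" if "f \<in> vsupp n" "g \<in> vsupp n" "vec n f = vec n g" for f g :: "nat \<Rightarrow> complex"
  proof
    fix a
    show "f a = g a"
    proof (cases "a < n")
      case True
      then have "f a = vec n f $ a" "g a = vec n g $ a" by auto
      then show ?thesis using that(3) by simp
    qed (use that in \<open>auto simp: vsupp_def\<close>)
  qed
  show ?thesis using alt
  proof
    assume z: "?W = {0\<^sub>v n}"
    have "f = 0" if f: "f \<in> W" for f
    proof (rule inj)
      have "vec n f = 0\<^sub>v n" using z f by blast
      then show "vec n f = vec n 0" by (auto simp: fun_apply)
    qed (use f W in \<open>auto simp: fs.subspace_0 vsupp_subspace\<close>)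
    then show ?thesis using fs.subspace_0[OF W(1)] by blast
  next
    assume full: "?W = carrier_vec n"
    have "f \<in> W" if f: "f \<in> vsupp n" for f
    proof -
      have "vec n f \<in> ?W" using full by simp
      then obtain g where "g \<in> W" "vec n f = vec n g" by blast
      then show ?thesis using inj[OF f, of g] W(2) by blast
    qed
    then show ?thesis using W(2) by blast
  qed
qed

text \<open>An eigenspace of \<open>A\<close> is invariant and nonzero, hence everything. The
  eigenvector comes from \<open>eigenvector_exists\<close> with all complex numbers as
  \<open>F\<close>, so that rationality is no condition.\<close>

lemma Schur_scalar:
  assumes A: "msupp n A" and comm: "\<And>g. g \<in> carrier G \<Longrightarrow> mm n (M g) A = mm n A (M g)"
  obtains c where "\<And>a b. a < n \<Longrightarrow> b < n \<Longrightarrow> A a b = (if a = b then c else 0)"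
proof -
  have U: "csubfield UNIV"
    using field.carrier_is_subfield[OF class_field] by (simp add: class_ring_simps)
  have x0: "(unit_fun 0 :: nat \<Rightarrow> complex) \<noteq> 0" by (auto simp: unit_fun_def fun_eq_iff zero_fun_apply intro!: exI[of _ 0])
  have pow: "(mv n A ^^ k) (unit_fun 0) \<in> vsupp n" for k
    using n_pos A by (cases k) (auto simp: vsupp_def unit_fun_def mv_def msupp_def)
  obtain p f \<mu> where f: "f \<in> fs.span (range (\<lambda>k. (mv n A ^^ k) (unit_fun 0)))" "f \<noteq> 0" "mv n A f = cscale \<mu> f"
    by (rule eigenvector_exists[OF mv_lin x0 _ pow[unfolded vsupp_span] U]) auto
  define W where "W = {f \<in> vsupp n. mv n A f = cscale \<mu> f}"
  have "W = {0} \<or> W = vsupp n"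
  proof (rule irreducible)
    show "fs.subspace W" unfolding W_def
      by (rule fs.subspaceI)
        (auto simp: mv_lin fs.subspace_0[OF vsupp_subspace] fs.subspace_add[OF vsupp_subspace]
          fs.subspace_scale[OF vsupp_subspace] fs.scale_right_distrib mult.commute
          mv_lin(2)[of n A 0 0, simplified])
    fix g f assume g: "g \<in> carrier G" and f: "f \<in> W"
    have "mv n A (mv n (M g) f) = cscale \<mu> (mv n (M g) f)"
      using f unfolding W_def mv_mm[symmetric] comm[OF g, symmetric] by (simp add: mv_mm mv_lin)
    moreover have "mv n (M g) f \<in> vsupp n"
      using M_msupp[of g] by (auto simp: vsupp_def mv_def msupp_def)
    ultimately show "mv n (M g) f \<in> W" unfolding W_def by blast
  qed (auto simp: W_def)
  moreover have "fs.span (range (\<lambda>k. (mv n A ^^ k) (unit_fun 0))) \<subseteq> vsupp n"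
    by (rule fs.span_minimal[OF _ vsupp_subspace]) (use pow in auto)
  then have "f \<in> vsupp n" using f(1) by (rule subsetD)
  then have "f \<in> W" using f(3) by (simp add: W_def)
  ultimately have W: "W = vsupp n" using f(2) by blast
  have "A a b = (if a = b then \<mu> else 0)" if ab: "a < n" "b < n" for a b
  proof -
    have "unit_fun b \<in> W" unfolding W using ab by (auto simp: vsupp_def unit_fun_def)
    then have "mv n A (unit_fun b) a = cscale \<mu> (unit_fun b) a" by (simp add: W_def)
    then have "A a b = \<mu> * unit_fun b a" using ab by (simp add: mv_unit_fun cscale_apply)
    then show ?thesis by (auto simp: unit_fun_def)
  qed
  then show ?thesis using that by blast
qed

text \<open>For fixed \<open>i\<close> and \<open>j\<close> the sums form a matrix \<open>A\<close>.
  Substituting in the sum over the group shows that \<open>A\<close> commutes with the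
  representation, so it is scalar. Its trace is |G| times the entry (j, i) of the identity, which
  determines the scalar.\<close>

lemma Schur_orthogonality:
  assumes "i < n" "j < n" "a < n" "b < n"
  shows "(\<Sum>g\<in>carrier G. M g a i * M (inv g) j b) =
    (if a = b \<and> i = j then of_nat (card (carrier G)) / of_nat n else 0)"
proof -
  define A where "A a b = (\<Sum>g\<in>carrier G. M g a i * M (inv g) j b)" for a b
  have "msupp n A" unfolding A_def msupp_def
    using M_msupp unfolding msupp_def by (auto intro!: sum.neutral)
  moreover have "mm n (M h) A = mm n A (M h)" if h: "h \<in> carrier G" for h
  proof (intro ext)
    fix a b
    have "mm n (M h) A a b = (\<Sum>g\<in>carrier G. mm n (M h) (M g) a i * M (inv g) j b)"
      unfolding mm_def A_def sum_distrib_left sum_distrib_right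
      by (subst sum.swap) (simp add: mult.assoc)
    also have "\<dots> = (\<Sum>g\<in>carrier G. M (h \<otimes> g) a i * M (inv g) j b)"
      using h by (simp add: M_mult)
    also have "\<dots> = (\<Sum>g\<in>carrier G. M g a i * M (inv (inv h \<otimes> g)) j b)"
      by (rule sum.reindex_bij_witness[of _ "\<lambda>g. inv h \<otimes> g" "\<lambda>g. h \<otimes> g"])
        (use h in \<open>auto simp: m_assoc[symmetric]\<close>)
    also have "\<dots> = (\<Sum>g\<in>carrier G. M g a i * mm n (M (inv g)) (M h) j b)"
      using h by (simp add: M_mult inv_mult_group)
    also have "\<dots> = mm n A (M h) a b"
      unfolding mm_def A_def sum_distrib_left sum_distrib_right
      by (subst sum.swap) (simp add: mult.assoc)
    finally show "mm n (M h) A a b = mm n A (M h) a b" .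
  qed
  ultimately obtain c where c: "\<And>a b. a < n \<Longrightarrow> b < n \<Longrightarrow> A a b = (if a = b then c else 0)"
    using Schur_scalar by metis
  have "of_nat n * c = (\<Sum>a<n. A a a)" using c by simp
  also have "\<dots> = (\<Sum>g\<in>carrier G. mm n (M (inv g)) (M g) j i)"
    unfolding A_def mm_def by (subst sum.swap) (simp add: mult.commute)
  also have "\<dots> = of_nat (card (carrier G)) * (if i = j then 1 else 0)"
    using assms by (simp add: M_inv idm_def cong: sum.cong)
  finally have "c = (if i = j then of_nat (card (carrier G)) / of_nat n else 0)"
    using n_pos by (auto simp: field_simps)
  then show ?thesis using c[OF assms(3,4)] unfolding A_def by auto
qed

section \<open>The block as a full matrix algebra\<close>

definition \<Phi> :: "('a \<Rightarrow> complex) \<Rightarrow> cmat" where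
  "\<Phi> x = (\<lambda>a b. \<Sum>g\<in>carrier G. x g * M g a b)"

text \<open>Fourier inversion for a single irreducible representation; the constant is the inverse
  of the one in Schur orthogonality.\<close>

definition \<Psi> :: "cmat \<Rightarrow> 'a \<Rightarrow> complex" where
  "\<Psi> A = (\<lambda>g. if g \<in> carrier G then of_nat n / of_nat (card (carrier G)) * trm n (mm n (M (inv g)) A) else 0)"

text \<open>By orthogonality, \<open>\<Psi>\<close> is a section of \<open>\<Phi>\<close>; its image is the two-sided ideal \<open>\<complex>[G] e\<close>, where
  \<open>e = \<Psi> (idm n)\<close> is the central idempotent.\<close>

definition block :: "('a \<Rightarrow> complex) set" where
  "block = {x. \<Psi> (\<Phi> x) = x}"

lemma \<Phi>_msupp: "msupp n (\<Phi> x)"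
  unfolding \<Phi>_def msupp_def using M_msupp unfolding msupp_def by (auto intro!: sum.neutral)

lemma \<Phi>_\<Psi>: 
  assumes "msupp n A"
  shows "\<Phi> (\<Psi> A) = A"
proof (intro ext)
  fix a b
  let ?q = "of_nat n / of_nat (card (carrier G)) :: complex"
  have q: "?q * (of_nat (card (carrier G)) / of_nat n) = 1"
    using n_pos card_pos by simp
  show "\<Phi> (\<Psi> A) a b = A a b"
  proof (cases "a < n \<and> b < n")
    case False
    then show ?thesis using assms \<Phi>_msupp unfolding msupp_def by metis
  next
    case True
    have "\<Phi> (\<Psi> A) a b = (\<Sum>g\<in>carrier G. \<Sum>c<n. \<Sum>d<n. ?q * A d c * (M g a b * M (inv g) c d))"
      unfolding \<Phi>_def \<Psi>_def trm_def mm_def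
      by (intro sum.cong refl) (simp add: sum_distrib_left sum_distrib_right mult_ac)
    also have "\<dots> = (\<Sum>c<n. \<Sum>d<n. ?q * A d c * (\<Sum>g\<in>carrier G. M g a b * M (inv g) c d))"
      by (subst sum.swap, rule sum.cong[OF refl], subst sum.swap) (simp add: sum_distrib_left)
    also have "\<dots> = (\<Sum>c<n. if c = b then A a b else 0)"
    proof (rule sum.cong[OF refl])
      fix c assume c: "c \<in> {..<n}"
      have "(\<Sum>d<n. ?q * A d c * (\<Sum>g\<in>carrier G. M g a b * M (inv g) c d)) =
          (\<Sum>d<n. if d = a then if c = b then A a b else 0 else 0)"
        using True c q by (intro sum.cong refl) (auto simp: Schur_orthogonality)
      then show "(\<Sum>d<n. ?q * A d c * (\<Sum>g\<in>carrier G. M g a b * M (inv g) c d)) =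
          (if c = b then A a b else 0)" using True by simp
    qed
    also have "\<dots> = A a b" using True by simp
    finally show ?thesis .
  qed
qed

lemma \<Phi>_lin: "\<Phi> (x + y) = \<Phi> x + \<Phi> y" "\<Phi> (cscale c x) a = cscale c (\<Phi> x a)"
  by (auto simp: \<Phi>_def fun_eq_iff fun_apply algebra_simps sum.distrib sum_distrib_left)

lemma \<Phi>_sum: "\<Phi> (sum f I) a = (\<Sum>i\<in>I. \<Phi> (f i) a)"
  by (auto simp: \<Phi>_def fun_eq_iff fun_apply sum_distrib_right intro: sum.swap)

lemma trm_lin: "trm n (mm n A (B + C)) = trm n (mm n A B) + trm n (mm n A C)"
  "trm n (mm n A (\<lambda>a. cscale c (B a))) = c * trm n (mm n A B)"
  by (simp_all add: trm_def mm_def fun_apply algebra_simps sum.distrib sum_distrib_left)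

lemma \<Psi>_lin: "\<Psi> (A + B) = \<Psi> A + \<Psi> B" "\<Psi> (\<lambda>a. cscale c (A a)) = cscale c (\<Psi> A)"
  by (rule ext; simp only: \<Psi>_def trm_lin plus_fun_apply cscale_apply; simp add: distrib_left)+

lemma \<Psi>_0: "\<Psi> 0 = 0"
  by (rule ext) (simp add: \<Psi>_def trm_def mm_def zero_fun_apply)

lemma \<Psi>_sum: "\<Psi> (sum A I) = (\<Sum>i\<in>I. \<Psi> (A i))"
  by (induction I rule: infinite_finite_induct) (simp_all add: \<Psi>_0 \<Psi>_lin)

lemma \<Psi>_block: "msupp n A \<Longrightarrow> \<Psi> A \<in> block"
  by (simp add: block_def \<Phi>_\<Psi>)

lemma blockD: "x \<in> block \<Longrightarrow> \<Psi> (\<Phi> x) = x"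
  by (simp add: block_def)

lemma block_eqI:
  assumes "x \<in> block" "y \<in> block" "\<Phi> x = \<Phi> y"
  shows "x = y"
proof -
  have "x = \<Psi> (\<Phi> x)" using blockD[OF assms(1)] by (rule sym)
  also have "\<dots> = y" unfolding assms(3) by (rule blockD[OF assms(2)])
  finally show ?thesis .
qed

lemma block_nonzero:
  assumes "x \<in> block" "x \<noteq> 0"
  shows "\<exists>a. \<Phi> x a \<noteq> 0"
proof (rule ccontr)
  assume "\<not> (\<exists>a. \<Phi> x a \<noteq> 0)"
  then have "\<Phi> x = 0" by (intro ext) (simp add: zero_fun_def)
  then show False using blockD[OF assms(1)] \<Psi>_0 assms(2) by simp
qed

lemma block_subspace: "fs.subspace block"
proof (rule fs.subspaceI)
  show "0 \<in> block" using \<Psi>_block[of 0] \<Psi>_0 by (simp add: msupp_def fun_apply)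
  show "x + y \<in> block" if "x \<in> block" "y \<in> block" for x y
    using that by (simp add: block_def \<Phi>_lin \<Psi>_lin)
  show "cscale c x \<in> block" if "x \<in> block" for c x
  proof -
    have "\<Phi> (cscale c x) = (\<lambda>a. cscale c (\<Phi> x a))" by (rule ext) (rule \<Phi>_lin)
    then show ?thesis using that by (simp add: block_def \<Psi>_lin)
  qed
qed

lemma trm_\<Phi>: "trm n (mm n (\<Phi> x) A) = (\<Sum>g\<in>carrier G. x g * trm n (mm n (M g) A))"
proof -
  have "trm n (mm n (\<Phi> x) A) = (\<Sum>a<n. \<Sum>c<n. \<Sum>g\<in>carrier G. x g * (M g a c * A c a))"
    by (simp add: trm_def mm_def \<Phi>_def sum_distrib_right mult.assoc)
  also have "\<dots> = (\<Sum>a<n. \<Sum>g\<in>carrier G. \<Sum>c<n. x g * (M g a c * A c a))"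
    by (intro sum.cong refl sum.swap)
  also have "\<dots> = (\<Sum>g\<in>carrier G. \<Sum>a<n. \<Sum>c<n. x g * (M g a c * A c a))"
    by (rule sum.swap)
  also have "\<dots> = (\<Sum>g\<in>carrier G. x g * trm n (mm n (M g) A))"
    by (simp add: trm_def mm_def sum_distrib_left)
  finally show ?thesis .
qed

text \<open>By cyclicity of the trace, the sum over the group assembles \<open>\<Phi> x\<close> in
  front of \<open>B\<close>. No condition is put on \<open>x\<close>: an arbitrary element of the
  group algebra acts on the block through its matrix.\<close>

lemma conv_\<Psi>: "conv G x (\<Psi> B) = \<Psi> (mm n (\<Phi> x) B)"
proof
  fix g
  show "conv G x (\<Psi> B) g = \<Psi> (mm n (\<Phi> x) B) g"
  proof (cases "g \<in> carrier G")
    case True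
    let ?q = "of_nat n / of_nat (card (carrier G)) :: complex"
    have "conv G x (\<Psi> B) g = (\<Sum>h\<in>carrier G. x h * (?q * trm n (mm n (mm n (M (inv g)) (M h)) B)))"
      using True by (auto simp: conv_def \<Psi>_def inv_mult_group M_mult intro!: sum.cong)
    also have "\<dots> = ?q * (\<Sum>h\<in>carrier G. x h * trm n (mm n (mm n (M (inv g)) (M h)) B))"
      by (simp add: sum_distrib_left mult.left_commute)
    also have "(\<Sum>h\<in>carrier G. x h * trm n (mm n (mm n (M (inv g)) (M h)) B)) =
        (\<Sum>h\<in>carrier G. x h * trm n (mm n (M h) (mm n B (M (inv g)))))"
      by (subst trm_mm_commute[of n "mm n (M (inv g)) _"]) 
        (simp only: mm_assoc[symmetric] trm_mm_commute[of n B "mm n _ _"] trm_mm_commute[of n "mm n B _"])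
    also have "\<dots> = trm n (mm n (M (inv g)) (mm n (\<Phi> x) B))"
      unfolding trm_\<Phi>[symmetric] by (subst trm_mm_commute[of n "M (inv g)"]) (simp only: mm_assoc)
    finally show ?thesis using True by (simp add: \<Psi>_def)
  qed (simp add: conv_def \<Psi>_def)
qed

end

section \<open>Left ideals and fields of realization\<close>

lemma conv_lin: "conv G (x + y) z = conv G x z + conv G y z" "conv G (cscale c x) z = cscale c (conv G x z)"
  "conv G x (cscale c z) = cscale c (conv G x z)"
  by (rule ext; simp add: conv_def fun_apply distrib_right sum.distrib sum_distrib_left mult.assoc mult.left_commute)+

lemma conv_0: "conv G 0 z = 0"
  by (rule ext) (simp add: conv_def zero_fun_apply)

lemma matrix_rep_conjugate:
  assumes "Group.group G" and \<phi>: "matrix_rep G n \<phi>" and P: "P \<in> carrier_mat n n" "Q \<in> carrier_mat n n"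
    "P * Q = 1\<^sub>m n" "Q * P = 1\<^sub>m n"
  shows "matrix_rep G n (\<lambda>g. Q * \<phi> g * P)"
proof -
  interpret Group.group G by fact
  let ?R = "ring_mat TYPE(complex) n ()"
  interpret R: ring ?R by (rule ring_mat)
  have hom: "\<phi> \<in> hom G (units_of ?R)" using \<phi> by (simp add: matrix_rep_def)
  then have U: "\<phi> g \<in> Units ?R" if "g \<in> carrier G" for g
    using that unfolding hom_def by (auto simp: units_of_carrier)
  have PQ: "P \<in> Units ?R" "Q \<in> Units ?R"
    using P by (auto simp: Units_def ring_mat_simps)
  have "Q * \<phi> g * P \<in> Units ?R" if "g \<in> carrier G" for g
    using R.Units_m_closed[OF R.Units_m_closed[OF PQ(2) U[OF that]] PQ(1)] by (simp add: ring_mat_simps)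
  moreover have "Q * \<phi> (g \<otimes>\<^bsub>G\<^esub> h) * P = (Q * \<phi> g * P) * (Q * \<phi> h * P)"
    if g: "g \<in> carrier G" and h: "h \<in> carrier G" for g h
  proof -
    have c: "\<phi> g \<in> carrier_mat n n" "\<phi> h \<in> carrier_mat n n"
      using U[OF g] U[OF h] by (auto simp: Units_def ring_mat_simps)
    have "(Q * \<phi> g * P) * (Q * \<phi> h * P) = (Q * \<phi> g) * ((P * Q) * (\<phi> h * P))"
      using c P(1,2) by (simp add: assoc_mult_mat[of _ n n _ n _ n])
    also have "\<dots> = Q * (\<phi> g * \<phi> h) * P"
      unfolding P(3) using c P(1,2) by (simp add: assoc_mult_mat[of _ n n _ n _ n])
    also have "\<phi> g * \<phi> h = \<phi> (g \<otimes>\<^bsub>G\<^esub> h)"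
      using hom g h unfolding hom_def by (simp add: units_of_mult ring_mat_simps)
    finally show ?thesis by simp
  qed
  ultimately show ?thesis unfolding matrix_rep_def hom_def
    by (auto simp: units_of_carrier units_of_mult ring_mat_simps)
qed

context finite_irrep
begin

definition shift :: "'a \<Rightarrow> ('a \<Rightarrow> complex) \<Rightarrow> 'a \<Rightarrow> complex" where
  "shift g f = conv G (unit_fun g) f"

abbreviation "orb f \<equiv> \<lambda>g. shift g f"

text \<open>The complex left ideal C[G] f. Arbitrary functions \<open>x\<close> are allowed, since
  \<open>conv\<close> reads its first argument on the carrier only. The left ideals L[G] f of the
  theorem are a different object, \<open>PIdl\<close>.\<close>

definition lideal :: "('a \<Rightarrow> complex) \<Rightarrow> ('a \<Rightarrow> complex) set" where
  "lideal f = range (\<lambda>x. conv G x f)"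

lemma shift_apply: "g \<in> carrier G \<Longrightarrow> shift g f x = (if x \<in> carrier G then f (inv g \<otimes> x) else 0)"
  by (simp add: shift_def conv_def sum_unit_fun finite_carrier)

lemma conv_eq_sum: "conv G x f = (\<Sum>g\<in>carrier G. cscale (x g) (shift g f))"
  by (rule ext) (simp add: conv_def fun_apply shift_apply cong: sum.cong)

lemma lideal_lspan: "lideal f = lspan (orb f) (carrier G)"
  unfolding lideal_def lspan_def conv_eq_sum by auto

lemma lideal_subspace: "fs.subspace (lideal f)"
  unfolding lideal_lspan lspan_eq_span[OF finite_carrier] by (rule fs.subspace_span)

lemma \<Phi>_unit_fun: "g \<in> carrier G \<Longrightarrow> \<Phi> (unit_fun g) = M g"
  by (intro ext) (simp add: \<Phi>_def sum_unit_fun finite_carrier)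

lemma conv_block: "f \<in> block \<Longrightarrow> conv G x f = \<Psi> (mm n (\<Phi> x) (\<Phi> f))"
  using conv_\<Psi>[of x "\<Phi> f"] by (simp add: blockD)

lemma conv_in_block: "f \<in> block \<Longrightarrow> conv G x f \<in> block"
  by (simp add: conv_block \<Psi>_block mm_msupp \<Phi>_msupp)

lemma \<Phi>_conv: "f \<in> block \<Longrightarrow> \<Phi> (conv G x f) = mm n (\<Phi> x) (\<Phi> f)"
  by (simp add: conv_block \<Phi>_\<Psi> mm_msupp \<Phi>_msupp)

lemma shift_in_block: "f \<in> block \<Longrightarrow> shift g f \<in> block"
  by (simp add: shift_def conv_in_block)

lemma \<Phi>_shift: "f \<in> block \<Longrightarrow> g \<in> carrier G \<Longrightarrow> \<Phi> (shift g f) = mm n (M g) (\<Phi> f)"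
  by (simp add: shift_def \<Phi>_conv \<Phi>_unit_fun)

lemma conv_assoc_block:
  "y \<in> block \<Longrightarrow> z \<in> block \<Longrightarrow> conv G (conv G x y) z = conv G x (conv G y z)"
  by (rule block_eqI) (simp_all add: conv_in_block \<Phi>_conv mm_assoc)

lemma lideal_block: "f \<in> block \<Longrightarrow> lideal f \<subseteq> block"
  by (auto simp: lideal_def conv_in_block)

lemma \<Psi>_in_lideal:
  assumes "f \<in> block" "msupp n A"
  shows "\<Psi> (mm n A (\<Phi> f)) \<in> lideal f"
proof -
  have "\<Psi> (mm n A (\<Phi> f)) = conv G (\<Psi> A) f" using assms by (simp add: conv_block \<Phi>_\<Psi>)
  then show ?thesis unfolding lideal_def by blast
qed

lemma conv_lideal:
  assumes "f \<in> block" "a \<in> lideal f"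
  shows "conv G x a \<in> lideal f"
proof -
  obtain y where y: "a = conv G y f" using assms(2) unfolding lideal_def by blast
  have "conv G x a = \<Psi> (mm n (mm n (\<Phi> x) (\<Phi> y)) (\<Phi> f))"
    unfolding y by (simp only: conv_block[OF conv_in_block[OF assms(1)]] \<Phi>_conv[OF assms(1)] mm_assoc)
  then show ?thesis using \<Psi>_in_lideal[OF assms(1) mm_msupp[OF \<Phi>_msupp \<Phi>_msupp]] by simp
qed

lemma conv_shift_lideal:
  assumes f: "f \<in> block" and g: "g \<in> carrier G"
  shows "conv G x (shift g f) \<in> lideal f"
proof -
  have "conv G x (shift g f) = \<Psi> (mm n (mm n (\<Phi> x) (M g)) (\<Phi> f))"
    by (simp add: conv_block shift_in_block f \<Phi>_shift g mm_assoc)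
  then show ?thesis using \<Psi>_in_lideal[OF f mm_msupp[OF \<Phi>_msupp M_msupp]] by simp
qed

lemma self_in_lideal: "f \<in> block \<Longrightarrow> f \<in> lideal f"
  using \<Psi>_in_lideal[of f "idm n"] by (simp add: msupp_idm mm_idm \<Phi>_msupp blockD)

text \<open>As \<open>f\<close> is rational, each term of the convolution has a factor in
  \<open>F\<close>. In effect the retraction maps C[G] f into itself and produces
  \<open>F\<close>-rational elements there.\<close>

lemma conv_retraction:
  assumes \<theta>: "linear_retraction F \<theta>" and f: "\<And>g. f g \<in> F"
  shows "(\<lambda>g. \<theta> (conv G x f g)) = conv G (\<lambda>g. \<theta> (x g)) f"
proof
  fix g
  show "\<theta> (conv G x f g) = conv G (\<lambda>g. \<theta> (x g)) f g"
    unfolding conv_def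
    by (simp add: linear_retraction_sum[OF \<theta>] linear_retractionD(4)[OF \<theta> f] linear_retractionD(7)[OF \<theta>])
qed

lemma conv_rational:
  assumes F: "csubfield F" and "\<And>g. x g \<in> F" "\<And>g. f g \<in> F"
  shows "conv G x f g \<in> F"
  unfolding conv_def using subfield_complexD[OF F] assms(2,3) by (auto intro!: subfield_complex_sum[OF F])

lemma shift_rational:
  assumes F: "csubfield F" and "\<And>g. f g \<in> F"
  shows "shift h f g \<in> F"
  unfolding shift_def using subfield_complexD[OF F] by (intro conv_rational[OF F] assms(2)) (auto simp: unit_fun_def)

lemma lideal_basis:
  obtains B where "B \<subseteq> carrier G" "finite B" "lin_indep (orb f) B"
    "lspan (orb f) B = lideal f" "card B = fs.dim (lideal f)"
proof -
  obtain B where B: "B \<subseteq> carrier G" "lin_indep (orb f) B" "lspan (orb f) B = lideal f"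
    using lin_indep_subfamily[OF finite_carrier, of "\<lambda>g. shift g f"] unfolding lideal_lspan by metis
  have fin: "finite B" using B(1) finite_carrier finite_subset by blast
  have "fs.independent ((orb f) ` B)" "inj_on (orb f) B"
    using B(2) lin_indep_iff[OF fin] by auto
  moreover have "fs.span ((orb f) ` B) = lideal f"
    unfolding lspan_eq_span[OF fin, symmetric] by (rule B(3))
  ultimately have "fs.dim (lideal f) = card B"
    using fs.dim_span_eq_card_independent[of "(orb f) ` B"] card_image by metis
  then show ?thesis using that B fin by metis
qed

lemma mv_\<Phi>_lin: "mv n (\<Phi> (x + y)) v = mv n (\<Phi> x) v + mv n (\<Phi> y) v"
  "mv n (\<Phi> (cscale c x)) v = cscale c (mv n (\<Phi> x) v)"
  by (rule ext; simp add: mv_def \<Phi>_lin fun_apply distrib_right sum.distrib sum_distrib_left mult.assoc)+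

lemma mv_\<Phi>_sum: "mv n (\<Phi> (\<Sum>i\<in>I. f i)) v = (\<Sum>i\<in>I. mv n (\<Phi> (f i)) v)"
proof (induction I rule: infinite_finite_induct)
  have "mv n (\<Phi> 0) v = 0" using mv_\<Phi>_lin(2)[of 0 0 v] by simp
  then show "mv n (\<Phi> (sum f {})) v = (\<Sum>i\<in>{}. mv n (\<Phi> (f i)) v)"
    and "infinite I \<Longrightarrow> mv n (\<Phi> (sum f I)) v = (\<Sum>i\<in>I. mv n (\<Phi> (f i)) v)" for I by simp_all
qed (simp add: mv_\<Phi>_lin)

lemma mv_vsupp: "msupp n A \<Longrightarrow> mv n A v \<in> vsupp n"
  by (auto simp: vsupp_def mv_def msupp_def)

text \<open>The span of the orbit is invariant and contains \<open>w\<close>, so irreducibility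
  leaves only the whole space.\<close>

lemma orbit_span:
  assumes w: "w \<in> vsupp n" "w \<noteq> 0"
  shows "fs.span ((\<lambda>g. mv n (M g) w) ` carrier G) = vsupp n"
proof -
  let ?S = "(\<lambda>g. mv n (M g) w) ` carrier G"
  have sub: "?S \<subseteq> vsupp n" using mv_vsupp[OF M_msupp] by auto
  have "fs.span ?S = {0} \<or> fs.span ?S = vsupp n"
  proof (rule irreducible[OF fs.subspace_span])
    show "fs.span ?S \<subseteq> vsupp n" by (rule fs.span_minimal[OF sub vsupp_subspace])
    fix g f assume g: "g \<in> carrier G" and f: "f \<in> fs.span ?S"
    have "fs.span ?S \<subseteq> {f. mv n (M g) f \<in> fs.span ?S}"
    proof (rule fs.span_minimal)
      have "mv n (M g) (mv n (M h) w) \<in> ?S" if "h \<in> carrier G" for h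
        using M_mult[OF g that] mv_mm[of n "M g" "M h" w] g that
        by (intro image_eqI[of _ _ "g \<otimes> h"]) auto
      then show "?S \<subseteq> {f. mv n (M g) f \<in> fs.span ?S}" using fs.span_base by blast
      show "fs.subspace {f. mv n (M g) f \<in> fs.span ?S}"
        by (rule fs.subspaceI)
          (simp_all add: mv_lin mv_lin(2)[of n _ 0 0, simplified] fs.span_zero fs.span_add fs.span_scale)
    qed
    then show "mv n (M g) f \<in> fs.span ?S" using f by blast
  qed
  moreover have "w \<in> ?S"
  proof (rule image_eqI[of _ _ \<one>])
    show "w = mv n (M \<one>) w"
    proof
      fix a
      have "(\<Sum>b<n. idm n a b * w b) = (\<Sum>b<n. if b = a then w a else 0)"
        by (rule sum.cong) (auto simp: idm_def)
      then show "w a = mv n (M \<one>) w a" using w(1) by (auto simp: M_one mv_def vsupp_def)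
    qed
  qed simp
  then have "w \<in> fs.span ?S" by (rule fs.span_base)
  ultimately show ?thesis using w(2) by auto
qed

text \<open>If right multiplications act by scalars, then \<open>a \<mapsto> \<Phi> a v\<close> is an isomorphism from the left ideal of
  \<open>f\<close> onto the representation space, and an \<open>F\<close>-rational basis of the ideal realizes \<open>\<phi>\<close> over \<open>F\<close>.\<close>

lemma realizable_of_scalar_right_mult:
  assumes F: "csubfield F"
    and f: "f \<in> block" "f \<noteq> 0" "\<And>g. f g \<in> F"
    and scal: "\<And>g. g \<in> carrier G \<Longrightarrow> \<exists>c. \<forall>a\<in>lideal f. conv G a (shift g f) = cscale c a"
  shows "realizable_over G n \<phi> F" "fs.dim (lideal f) = n"
proof -
  obtain a0 b0 where "\<Phi> f a0 b0 \<noteq> 0" using block_nonzero[OF f(1,2)] by (auto simp: fun_eq_iff zero_fun_apply)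
  then have b0: "b0 < n" using \<Phi>_msupp[of f] unfolding msupp_def by blast
  \<comment> \<open>Column \<open>b0\<close> of the matrix, chosen so that \<open>f\<close> has a
    nonzero image \<open>w\<close>.\<close>
  define ev where "ev a = mv n (\<Phi> a) (unit_fun b0)" for a
  have ev_sum: "ev (\<Sum>i\<in>I. cscale (c i) (u i)) = (\<Sum>i\<in>I. cscale (c i) (ev (u i)))" for I :: "nat set" and c u
    unfolding ev_def mv_\<Phi>_sum mv_\<Phi>_lin ..
  have ev_vsupp: "ev a \<in> vsupp n" for a unfolding ev_def by (rule mv_vsupp[OF \<Phi>_msupp])
  have ev_shift: "ev (shift g a) = mv n (M g) (ev a)" if "a \<in> block" "g \<in> carrier G" for a g
    using that by (simp add: ev_def \<Phi>_shift mv_mm)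
  define w where "w = ev f"
  have "w a0 \<noteq> 0" using \<open>\<Phi> f a0 b0 \<noteq> 0\<close> b0 by (simp add: w_def ev_def mv_unit_fun)
  then have w0: "w \<noteq> 0" by (auto simp: zero_fun_apply)
  \<comment> \<open>If \<open>\<Phi> a\<close> kills \<open>w\<close>, then it kills every
    \<open>mv n (M g) w\<close>, because multiplying \<open>a\<close> on the right by
    \<open>shift g f\<close> only rescales it. These vectors span the representation space.\<close>
  have inj: "a = 0" if a: "a \<in> lideal f" "ev a = 0" for a
  proof -
    have ab: "a \<in> block" using a(1) lideal_block[OF f(1)] by blast
    have "(\<lambda>g. mv n (M g) w) ` carrier G \<subseteq> {u. mv n (\<Phi> a) u = 0}"
    proof safe
      fix g assume g: "g \<in> carrier G"
      obtain c where c: "conv G a (shift g f) = cscale c a" using scal[OF g] a(1) by blast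
      have "mv n (\<Phi> a) (mv n (M g) w) = ev (conv G a (shift g f))"
        by (simp add: w_def ev_def \<Phi>_conv shift_in_block f(1) \<Phi>_shift g mv_mm)
      also have "\<dots> = cscale c (ev a)" unfolding c ev_def mv_\<Phi>_lin ..
      finally show "mv n (\<Phi> a) (mv n (M g) w) = 0" using a(2) by simp
    qed
    moreover have "fs.subspace {u. mv n (\<Phi> a) u = 0}"
      by (rule fs.subspaceI) (simp_all add: mv_lin mv_lin(2)[of n _ 0 0, simplified])
    ultimately have sub: "vsupp n \<subseteq> {u. mv n (\<Phi> a) u = 0}"
      unfolding orbit_span[OF ev_vsupp[of f, folded w_def] w0, symmetric] by (rule fs.span_minimal)
    have "\<Phi> a x = 0" for x
    proof
      fix b
      show "\<Phi> a x b = 0 b"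
      proof (cases "b < n")
        case True
        then have "unit_fun b \<in> vsupp n" by (auto simp: vsupp_def unit_fun_def)
        then have "mv n (\<Phi> a) (unit_fun b) = 0" using sub by blast
        then show ?thesis using True by (simp add: mv_unit_fun fun_eq_iff zero_fun_apply)
      next
        case False
        then show ?thesis using \<Phi>_msupp[of a] by (simp add: msupp_def zero_fun_apply)
      qed
    qed
    then show ?thesis using block_nonzero[OF ab] by blast
  qed
  obtain B where B: "B \<subseteq> carrier G" "finite B" "lin_indep (orb f) B"
    "lspan (orb f) B = lideal f" "card B = fs.dim (lideal f)" using lideal_basis .
  define k where "k = card B"
  obtain h where h: "bij_betw h {..<k} B"
    using ex_bij_betw_nat_finite[OF B(2)] unfolding k_def lessThan_atLeast0 by blast
  define b where "b j = shift (h j) f" for j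
  have reind: "(\<Sum>g\<in>B. cscale (c g) (shift g f)) = (\<Sum>j<k. cscale (c (h j)) (b j))" for c
    using sum.reindex_bij_betw[OF h, of "\<lambda>g. cscale (c g) (shift g f)"] by (simp add: b_def)
  have hB: "h j \<in> B" "h j \<in> carrier G" if "j < k" for j
    using bij_betw_apply[OF h] that B(1) by auto
  have b_lideal: "b j \<in> lideal f" "b j \<in> block" if "j < k" for j
    using that B(1) by (auto simp: b_def shift_def lideal_def conv_in_block f(1))
  have b_rat: "b j x \<in> F" for j x unfolding b_def by (rule shift_rational[OF F f(3)])
  have b_span: "a \<in> lspan b {..<k}" if a: "a \<in> lideal f" for a
  proof -
    obtain c where "a = (\<Sum>g\<in>B. cscale (c g) (shift g f))"
      using a unfolding B(4)[symmetric] lspan_def by blast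
    then show ?thesis unfolding reind using lspanI[of "\<lambda>j. c (h j)" b "{..<k}"] by simp
  qed
  have ev_b: "\<forall>j<k. c j = 0" if c: "(\<Sum>j<k. cscale (c j) (ev (b j))) = 0" for c
  proof -
    have "(\<Sum>j<k. cscale (c j) (b j)) = 0"
    proof (rule inj)
      show "(\<Sum>j<k. cscale (c j) (b j)) \<in> lideal f"
        using b_lideal by (intro fs.subspace_sum[OF lideal_subspace] fs.subspace_scale[OF lideal_subspace]) auto
      show "ev (\<Sum>j<k. cscale (c j) (b j)) = 0" unfolding ev_sum by (rule c)
    qed
    then have "(\<Sum>g\<in>B. cscale (c (inv_into {..<k} h g)) (shift g f)) = 0"
      unfolding reind using h by (simp add: bij_betw_def)
    then have *: "\<forall>g\<in>B. c (inv_into {..<k} h g) = 0" 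
      using spec[OF B(3)[unfolded lin_indep_def], of "\<lambda>g. c (inv_into {..<k} h g)"] by blast
    show ?thesis
    proof (intro allI impI)
      fix j assume j: "j < k"
      then have "c (inv_into {..<k} h (h j)) = 0" using * hB by blast
      then show "c j = 0" using j h by (simp add: bij_betw_def)
    qed
  qed
  have li: "lin_indep (\<lambda>j. ev (b j)) {..<k}" unfolding lin_indep_def using ev_b by simp
  have "card {..<k} \<le> card (uvecs n)"
    using ev_vsupp by (intro lin_indep_card_le[OF li]) (auto simp: vsupp_span[symmetric])
  then have kn: "k \<le> n" by (simp add: card_unit_fun)
  \<comment> \<open>Surjectivity: the image contains the orbit of \<open>w\<close>. Together with
    injectivity this gives \<open>k = n\<close>.\<close>
  have span_ev: "vsupp n \<subseteq> fs.span ((\<lambda>j. ev (b j)) ` {..<k})"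
    unfolding orbit_span[OF ev_vsupp[of f, folded w_def] w0, symmetric]
  proof (rule fs.span_minimal[OF _ fs.subspace_span], safe)
    fix g assume g: "g \<in> carrier G"
    have "shift g f \<in> lspan b {..<k}" by (rule b_span) (auto simp: lideal_def shift_def)
    then obtain c where c: "shift g f = (\<Sum>j<k. cscale (c j) (b j))" unfolding lspan_def by blast
    have "mv n (M g) w = (\<Sum>j<k. cscale (c j) (ev (b j)))"
      unfolding w_def ev_shift[OF f(1) g, symmetric] c ev_sum ..
    then show "mv n (M g) w \<in> fs.span ((\<lambda>j. ev (b j)) ` {..<k})"
      by (auto intro!: fs.span_sum intro: fs.span_scale fs.span_base)
  qed
  have "card (uvecs n) \<le> card ((\<lambda>j. ev (b j)) ` {..<k})"
    using fs.independent_span_bound[OF _ independent_unit_fun subset_trans[OF fs.span_superset span_ev[unfolded vsupp_span]]]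
    by blast
  then have "card {..<n} \<le> card ((\<lambda>j. ev (b j)) ` {..<k})" by (simp add: card_unit_fun)
  also have "\<dots> \<le> k" using card_image_le[of "{..<k}" "\<lambda>j. ev (b j)"] by simp
  finally have k: "k = n" using kn by simp
  show "fs.dim (lideal f) = n" using B(5) k by (simp add: k_def)
  \<comment> \<open>The columns are the images of the rational basis \<open>b\<close>. In this basis
    the matrix entries of the representation are the coordinates of the translates
    \<open>shift g (b j)\<close> with respect to \<open>b\<close>, and these can be taken in
    \<open>F\<close>.\<close>
  define P where "P = mat n n (\<lambda>(i, j). ev (b j) i)"
  have P: "P \<in> carrier_mat n n" by (simp add: P_def)
  have "det P \<noteq> 0"
  proof
    assume "det P = 0"
    then obtain v where v: "v \<in> carrier_vec n" "v \<noteq> 0\<^sub>v n" "P *\<^sub>v v = 0\<^sub>v n"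
      using det_0_iff_vec_prod_zero[OF P] by blast
    have "(\<Sum>j<k. cscale (v $ j) (ev (b j))) = 0"
    proof
      fix i
      show "(\<Sum>j<k. cscale (v $ j) (ev (b j))) i = 0 i"
      proof (cases "i < n")
        case True
        then have "(P *\<^sub>v v) $ i = (\<Sum>j<n. ev (b j) i * v $ j)"
          using v(1) by (simp add: P_def scalar_prod_def lessThan_atLeast0)
        then show ?thesis using v(3) True k by (simp add: fun_apply mult.commute)
      next
        case False
        then show ?thesis using ev_vsupp by (simp add: fun_apply vsupp_def)
      qed
    qed
    from ev_b[OF this] have v0: "\<forall>j<n. v $ j = 0" unfolding k .
    have "v = 0\<^sub>v n" by (rule eq_vecI) (use v0 v(1) in simp_all)
    then show False using v(2) by simp
  qed
  then have "P \<in> Units (ring_mat TYPE(complex) n ())" by (rule det_non_zero_imp_unit[OF P])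
  then obtain Q where Q: "Q \<in> carrier_mat n n" "Q * P = 1\<^sub>m n" "P * Q = 1\<^sub>m n"
    by (auto simp: Units_def ring_mat_simps)
  let ?\<psi> = "\<lambda>g. Q * \<phi> g * P"
  have "matrix_rep G n ?\<psi>"
    using irr by (intro matrix_rep_conjugate[OF is_group _ P Q(1) Q(3,2)]) (simp add: irreducible_rep_def)
  moreover have "elements_mat (?\<psi> g) \<subseteq> F \<and> similar_mat_wit (\<phi> g) (?\<psi> g) P Q" if g: "g \<in> carrier G" for g
  proof
    note \<phi>g = \<phi>_carrier[OF g]
    have "\<forall>j. \<exists>c. j < n \<longrightarrow> (\<forall>i. c i \<in> F) \<and> shift g (b j) = (\<Sum>i<n. cscale (c i) (b i))"
    proof
      fix j
      show "\<exists>c. j < n \<longrightarrow> (\<forall>i. c i \<in> F) \<and> shift g (b j) = (\<Sum>i<n. cscale (c i) (b i))"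
      proof (cases "j < n")
        case True
        have sr: "shift g (b j) x \<in> F" for x by (rule shift_rational[OF F b_rat])
        have st: "shift g (b j) \<in> lspan b {..<n}"
          using b_span[of "shift g (b j)"] conv_lideal[OF f(1) b_lideal(1)] True unfolding shift_def k by blast
        obtain c where "(\<forall>i. c i \<in> F) \<and> shift g (b j) = (\<Sum>i<n. cscale (c i) (b i))"
          by (rule rational_in_lspan[OF F b_rat sr st]) blast
        then show ?thesis by blast
      qed simp
    qed
    then obtain C where C: "\<And>i j. j < n \<Longrightarrow> C j i \<in> F"
      "\<And>j. j < n \<Longrightarrow> shift g (b j) = (\<Sum>i<n. cscale (C j i) (b i))"
      by (metis (no_types))
    define Y where "Y = mat n n (\<lambda>(i, j). C j i)"
    have Y: "Y \<in> carrier_mat n n" by (simp add: Y_def)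
    have "P * Y = \<phi> g * P"
    proof (rule eq_matI)
      fix i j assume "i < dim_row (\<phi> g * P)" "j < dim_col (\<phi> g * P)"
      then have ij: "i < n" "j < n" using \<phi>g P by auto
      have "(P * Y) $$ (i, j) = (\<Sum>c<n. C j c * ev (b c) i)"
        using ij by (simp add: P_def Y_def scalar_prod_def lessThan_atLeast0 mult.commute)
      also have "\<dots> = ev (shift g (b j)) i"
        unfolding C(2)[OF ij(2)] ev_sum by (simp add: fun_apply)
      also have "\<dots> = mv n (M g) (ev (b j)) i"
        using ev_shift[OF b_lideal(2) g] ij(2) k by simp
      also have "\<dots> = (\<phi> g * P) $$ (i, j)"
        using ij \<phi>g by (simp add: P_def mv_def M_def scalar_prod_def lessThan_atLeast0)
      finally show "(P * Y) $$ (i, j) = (\<phi> g * P) $$ (i, j)" .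
    qed (use P \<phi>g Y in auto)
    then have "?\<psi> g = Q * (P * Y)" using P Q \<phi>g by (simp add: assoc_mult_mat[of _ n n _ n _ n])
    also have "\<dots> = Y" using P Q Y by (simp add: assoc_mult_mat[of _ n n _ n _ n, symmetric])
    finally show "elements_mat (?\<psi> g) \<subseteq> F" using C(1) by (auto simp: Y_def elements_mat_def)
    have "P * (Q * \<phi> g * P) * Q = (P * Q) * \<phi> g * (P * Q)"
      using P Q(1) \<phi>g by (simp add: assoc_mult_mat[of _ n n _ n _ n])
    then show "similar_mat_wit (\<phi> g) (?\<psi> g) P Q"
      using P Q \<phi>g by (simp add: similar_mat_wit_def Let_def)
  qed
  ultimately show "realizable_over G n \<phi> F" unfolding realizable_over_def by blast
qed

lemma conv_scale_left: "conv G (\<lambda>g. c * x g) f = (\<lambda>g. c * conv G x f g)"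
  using conv_lin(2)[of G c x f] unfolding cscale_def .

text \<open>If \<open>conv G f' z = \<mu> f'\<close> with \<open>z\<close> rational over \<open>F\<close>, then an \<open>F\<close>-linear retraction \<open>\<theta>\<close> is
  injective on the \<open>F(\<mu>)\<close>-rational elements of the left ideal of \<open>f'\<close>: the kernel is stable under
  multiplication by \<open>\<mu>\<close>, which becomes right multiplication by \<open>z\<close>. This bounds the dimension.\<close>

lemma eigen_lideal_dim:
  assumes F: "csubfield F" 
    and E: "csubfield E" "E = ring.simple_extension class_ring F \<mu>"
    and dim: "ring.dimension class_ring d F E"
    and f: "f \<in> block" "\<And>g. f g \<in> F" and z: "\<And>g. z g \<in> F" "z \<in> block"
    and f': "f' \<in> lideal f" "\<And>g. f' g \<in> E" "conv G f' z = cscale \<mu> f'"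
  shows "d * fs.dim (lideal f') \<le> fs.dim (lideal f)"
proof -
  note Es = subfield_complexD[OF E(1)]
  obtain \<theta> where \<theta>: "linear_retraction F \<theta>" using linear_retraction_exists[OF F] .
  note \<theta>s = linear_retractionD[OF \<theta>]
  have fb: "f' \<in> block" using f'(1) lideal_block[OF f(1)] by blast
  obtain y where y: "\<forall>i<d. y i \<in> E"
    "\<forall>k. (\<forall>i<d. k i \<in> F) \<longrightarrow> (\<Sum>i<d. k i * y i) = 0 \<longrightarrow> (\<forall>i<d. k i = 0)"
  proof (rule dimension_complex_basis[OF F dim])
    fix y :: "nat \<Rightarrow> complex"
    assume "\<And>i. i < d \<Longrightarrow> y i \<in> E"
      "\<And>k. (\<And>i. i < d \<Longrightarrow> k i \<in> F) \<Longrightarrow> (\<Sum>i<d. k i * y i) = 0 \<Longrightarrow> \<forall>i<d. k i = 0"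
    then show thesis by (intro that[of y]) simp_all
  qed
  obtain B where B: "B \<subseteq> carrier G" "finite B" "lin_indep (orb f') B"
    "lspan (orb f') B = lideal f'" "card B = fs.dim (lideal f')" using lideal_basis .
  obtain C where C: "C \<subseteq> carrier G" "finite C" "lin_indep (orb f) C"
    "lspan (orb f) C = lideal f" "card C = fs.dim (lideal f)" using lideal_basis .
  have FE: "F \<subseteq> E" using ring.simple_extension_incl[OF ring_class_ring subfieldE(3)[OF F]]
    unfolding E(2) by (simp add: class_ring_simps)
  have kernel: "v = 0" if v: "\<And>g. v g \<in> E" "conv G v z = cscale \<mu> v" "\<And>g. \<theta> (v g) = 0" for v
  proof -
    \<comment> \<open>The kernel condition is stable under multiplication by all of F(\<mu>), shown
      along the Horner form \<open>k1 * \<mu> + k2\<close> by which the extension is generated. A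
      nonzero value of \<open>v\<close> could then be multiplied by its inverse, which would put 1
      into the kernel of \<open>\<theta>\<close>.\<close>
    have ker: "\<forall>g. \<theta> (c * v g) = 0" if "c \<in> ring.simple_extension class_ring F \<mu>" for c
    proof (rule ring.simple_extension.induct[OF ring_class_ring that])
      show "\<forall>g. \<theta> (\<zero>\<^bsub>class_ring\<^esub> * v g) = 0" by (simp add: class_ring_simps \<theta>s(7))
      fix k1 k2
      assume k: "k2 \<in> F" "\<forall>g. \<theta> (k1 * v g) = 0"
      show "\<forall>g. \<theta> ((k1 \<otimes>\<^bsub>class_ring\<^esub> \<mu> \<oplus>\<^bsub>class_ring\<^esub> k2) * v g) = 0"
      proof
        fix g
        have "k1 * (\<mu> * v g) = conv G (\<lambda>g. k1 * v g) z g"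
          unfolding conv_scale_left using fun_cong[OF v(2), of g] by (simp add: cscale_apply)
        then have "\<theta> (k1 * (\<mu> * v g)) = conv G (\<lambda>g. \<theta> (k1 * v g)) z g"
          using fun_cong[OF conv_retraction[OF \<theta>, of z "\<lambda>g. k1 * v g", OF z(1)], of g] by simp
        also have "\<dots> = 0" using k(2) by (simp add: conv_def)
        finally show "\<theta> ((k1 \<otimes>\<^bsub>class_ring\<^esub> \<mu> \<oplus>\<^bsub>class_ring\<^esub> k2) * v g) = 0"
          using k(1) v(3) by (simp add: class_ring_simps \<theta>s distrib_right mult.assoc)
      qed
    qed
    show "v = 0"
    proof (rule ccontr)
      assume "v \<noteq> 0"
      then obtain g where g: "v g \<noteq> 0" by (auto simp: fun_eq_iff zero_fun_apply)
      have "\<theta> (inverse (v g) * v g) = 0" using ker[of "inverse (v g)"] Es(7)[OF v(1)] E(2) by blast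
      moreover have "inverse (v g) * v g = 1" using g by simp
      ultimately show False using \<theta>s(6) by simp
    qed
  qed
  \<comment> \<open>Products of a basis of \<open>E\<close> over \<open>F\<close> with a basis of
    C[G] f', retracted to \<open>F\<close>. They lie in C[G] f because \<open>f\<close> is rational,
    and they are independent by \<open>kernel\<close>, which gives the factor
    \<open>d\<close>.\<close>
  define w where "w p = (\<lambda>x. \<theta> (y (fst p) * shift (snd p) f' x))" for p
  have "lin_indep w ({..<d} \<times> B)"
  proof (rule lin_indep_rationalI[OF F])
    show "w p x \<in> F" for p x unfolding w_def by (rule \<theta>s(1))
    fix c assume c: "\<And>p. p \<in> {..<d} \<times> B \<Longrightarrow> c p \<in> F" "(\<Sum>p\<in>{..<d} \<times> B. cscale (c p) (w p)) = 0"
    define Y where "Y g = (\<Sum>i<d. c (i, g) * y i)" for g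
    have YE: "Y g \<in> E" if "g \<in> B" for g unfolding Y_def
      using c(1) FE y(1) that by (intro subfield_complex_sum[OF E(1)] Es(6)) auto
    define v where "v = (\<Sum>g\<in>B. cscale (Y g) (shift g f'))"
    have "v = 0"
    proof (rule kernel)
      show "v x \<in> E" for x unfolding v_def fun_apply
        using YE shift_rational[OF E(1) f'(2)] by (intro subfield_complex_sum[OF E(1)] Es(6)) auto
      have "v \<in> lideal f'" unfolding B(4)[symmetric] v_def by (rule lspanI)
      then obtain x where x: "v = conv G x f'" unfolding lideal_def by blast
      show "conv G v z = cscale \<mu> v" unfolding x conv_assoc_block[OF fb z(2)] f'(3) conv_lin ..
      fix x
      have "v x = (\<Sum>g\<in>B. \<Sum>i<d. c (i, g) * (y i * shift g f' x))"
        by (simp add: v_def Y_def fun_apply sum_distrib_right mult.assoc)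
      also have "\<dots> = (\<Sum>p\<in>{..<d} \<times> B. c p * (y (fst p) * shift (snd p) f' x))"
        by (subst sum.swap) (simp add: sum.cartesian_product split_def)
      finally have "\<theta> (v x) = (\<Sum>p\<in>{..<d} \<times> B. \<theta> (c p * (y (fst p) * shift (snd p) f' x)))"
        by (simp only: linear_retraction_sum[OF \<theta>])
      also have "\<dots> = (\<Sum>p\<in>{..<d} \<times> B. c p * w p x)"
        by (rule sum.cong[OF refl]) (simp only: w_def \<theta>s(3)[OF c(1)])
      also have "\<dots> = (\<Sum>p\<in>{..<d} \<times> B. cscale (c p) (w p)) x" by (simp add: fun_apply)
      finally show "\<theta> (v x) = 0" unfolding c(2) by (simp add: fun_apply)
    qed
    then have Y0: "\<forall>g\<in>B. Y g = 0" 
      using spec[OF B(3)[unfolded lin_indep_def], of Y] unfolding v_def by blast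
    show "\<forall>p\<in>{..<d} \<times> B. c p = 0"
    proof safe
      fix i g assume ig: "i < d" "g \<in> B"
      have "\<forall>i<d. c (i, g) = 0"
        using spec[OF y(2), of "\<lambda>i. c (i, g)"] c(1) ig(2) Y0 unfolding Y_def by auto
      then show "c (i, g) = 0" using ig by blast
    qed
  qed
  moreover have "w ` ({..<d} \<times> B) \<subseteq> fs.span ((orb f) ` C)"
  proof safe
    fix i g assume ig: "i < d" "g \<in> B"
    have "shift g f' \<in> lideal f" unfolding shift_def by (rule conv_lideal[OF f(1) f'(1)])
    then have "cscale (y i) (shift g f') \<in> lideal f" by (rule fs.subspace_scale[OF lideal_subspace])
    then obtain x where x: "cscale (y i) (shift g f') = conv G x f" unfolding lideal_def by blast
    have "w (i, g) = (\<lambda>h. \<theta> (conv G x f h))" unfolding w_def x[symmetric] by (simp add: cscale_apply)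
    also have "\<dots> = conv G (\<lambda>h. \<theta> (x h)) f" by (rule conv_retraction[OF \<theta> f(2)])
    finally have "w (i, g) \<in> lideal f" unfolding lideal_def by simp
    then show "w (i, g) \<in> fs.span ((orb f) ` C)"
      unfolding lspan_eq_span[OF C(2), symmetric] C(4) .
  qed
  ultimately have "card ({..<d} \<times> B) \<le> card ((orb f) ` C)"
    using B(2) C(2) by (intro lin_indep_card_le) auto
  also have "\<dots> \<le> card C" by (rule card_image_le[OF C(2)])
  finally show ?thesis using B(5) C(5) by (simp add: card_cartesian_product)
qed

lemma lideal_dim_less:
  assumes f: "f' \<in> lideal f" "f \<in> block" and s: "s \<in> lideal f" "s \<notin> lideal f'"
  shows "fs.dim (lideal f') < fs.dim (lideal f)"
proof -
  obtain B where B: "B \<subseteq> carrier G" "finite B" "lin_indep (orb f') B"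
    "lspan (orb f') B = lideal f'" "card B = fs.dim (lideal f')" using lideal_basis .
  obtain C where C: "C \<subseteq> carrier G" "finite C" "lin_indep (orb f) C"
    "lspan (orb f) C = lideal f" "card C = fs.dim (lideal f)" using lideal_basis .
  let ?B = "(orb f') ` B" and ?C = "(orb f) ` C"
  have spB: "fs.span ?B = lideal f'" unfolding lspan_eq_span[OF B(2), symmetric] by (rule B(4))
  have spC: "fs.span ?C = lideal f" unfolding lspan_eq_span[OF C(2), symmetric] by (rule C(4))
  have iB: "fs.independent ?B" "inj_on (orb f') B" using B(3) lin_indep_iff[OF B(2)] by auto
  have ns: "s \<notin> fs.span ?B" using s(2) spB by simp
  have "?B \<subseteq> fs.span ?C"
    unfolding spC using conv_lideal[OF f(2,1)] by (auto simp: shift_def)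
  then have "insert s ?B \<subseteq> fs.span ?C" using s(1) spC by simp
  then have "card (insert s ?B) \<le> card ?C"
    using fs.independent_span_bound[OF _ fs.independent_insertI[OF ns iB(1)]] C(2) by blast
  moreover have "s \<notin> ?B" using ns fs.span_base by metis
  then have "card (insert s ?B) = Suc (card B)" using card_image[OF iB(2)] B(2) by simp
  moreover have "card ?C \<le> card C" by (rule card_image_le[OF C(2)])
  ultimately show ?thesis using B(5) C(5) by simp
qed

text \<open>Induction on the dimension of the left ideal generated by \<open>f\<close>: a nonscalar right
  multiplication by some \<open>z = g f\<close> is an endomorphism of this ideal, and passing to an eigenspace
  trades dimension for the degree of the eigenvalue.\<close>

theorem realizable_bound:
  assumes "csubfield F" "f \<in> block" "f \<noteq> 0" "\<And>g. f g \<in> F"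
  shows "\<exists>E d. subfield E class_ring \<and> F \<subseteq> E \<and> ring.dimension class_ring d F E \<and>
    realizable_over G n \<phi> E \<and> d * n \<le> fs.dim (lideal f)"
  using assms
proof (induction "fs.dim (lideal f)" arbitrary: F f rule: less_induct)
  case less
  note F = less.prems(1) and f = less.prems(2-4)
  show ?case
  proof (cases "\<forall>g\<in>carrier G. \<exists>c. \<forall>a\<in>lideal f. conv G a (shift g f) = cscale c a")
    case True
    then have "realizable_over G n \<phi> F" "fs.dim (lideal f) = n"
      using realizable_of_scalar_right_mult[OF F f] by blast+
    then show ?thesis
      using F ring.dimension_one[OF ring_class_ring F] by (intro exI[of _ F] exI[of _ 1]) simp
  next
    case False
    then obtain g where g: "g \<in> carrier G" and ns: "\<And>c. \<exists>a\<in>lideal f. conv G a (shift g f) \<noteq> cscale c a"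
      by blast
    define z where "z = shift g f"
    have z: "z \<in> block" "\<And>x. z x \<in> F" unfolding z_def
      by (rule shift_in_block[OF f(1)], rule shift_rational[OF F f(3)])
    let ?T = "\<lambda>a. conv G a z"
    have pow: "(?T ^^ k) f \<in> lideal f \<and> (\<forall>x. (?T ^^ k) f x \<in> F)" for k
    proof (induction k)
      case 0
      then show ?case using self_in_lideal[OF f(1)] f(3) by simp
    next
      case (Suc k)
      then show ?case
        using conv_shift_lideal[OF f(1) g] conv_rational[OF F _ z(2)] by (simp add: z_def)
    qed
    have fin: "finite ((orb f) ` carrier G)" using finite_carrier by simp
    have sp: "fs.span ((orb f) ` carrier G) = lideal f"
      unfolding lideal_lspan lspan_eq_span[OF finite_carrier] ..
    obtain p a \<mu> where p: "p \<noteq> 0" "\<And>i. coeff p i \<in> F" "poly p \<mu> = 0"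
      and a: "a \<in> fs.span (range (\<lambda>k. (?T ^^ k) f))" "a \<noteq> 0" "?T a = cscale \<mu> a"
      by (rule eigenvector_exists[of ?T f, OF conv_lin(1,2) f(2) fin _ F])
        (use pow sp in auto)
    have al: "a \<in> lideal f"
      by (rule subsetD[OF fs.span_minimal[OF _ lideal_subspace] a(1)]) (use pow in auto)
    define E where "E = ring.simple_extension class_ring F \<mu>"
    obtain d where E: "subfield E class_ring" "F \<subseteq> E" and d: "ring.dimension class_ring d F E"
      using simple_extension_complex[OF F p] unfolding E_def by blast
    have \<mu>E: "\<mu> \<in> E" unfolding E_def
      using ring.simple_extension_mem[OF ring_class_ring subfieldE(1)[OF F]] by (simp add: class_ring_simps)
    obtain \<theta> where \<theta>: "linear_retraction E \<theta>" using linear_retraction_exists[OF E(1)] .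
    note \<theta>s = linear_retractionD[OF \<theta>]
    obtain x0 where x0: "a x0 \<noteq> 0" using a(2) by (auto simp: fun_eq_iff zero_fun_apply)
    \<comment> \<open>Normalised to have the value 1 at \<open>x0\<close>, so that the retraction to
      \<open>E\<close> cannot annihilate it.\<close>
    define a1 where "a1 = cscale (inverse (a x0)) a"
    define f' where "f' = (\<lambda>x. \<theta> (a1 x))"
    have a1: "a1 \<in> lideal f" unfolding a1_def by (rule fs.subspace_scale[OF lideal_subspace al])
    then obtain x where x: "a1 = conv G x f" unfolding lideal_def by blast
    have "f' = conv G (\<lambda>g. \<theta> (x g)) f"
      unfolding f'_def x by (rule conv_retraction[OF \<theta>]) (use f(3) E(2) in blast)
    then have f'l: "f' \<in> lideal f" unfolding lideal_def by blast
    then have f'b: "f' \<in> block" using lideal_block[OF f(1)] by blast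
    have f'E: "f' x \<in> E" for x unfolding f'_def by (rule \<theta>s(1))
    have f'z: "conv G f' z = cscale \<mu> f'"
    proof -
      have "conv G f' z = (\<lambda>g. \<theta> (conv G a1 z g))"
        unfolding f'_def by (rule conv_retraction[OF \<theta>, symmetric]) (use z(2) E(2) in blast)
      also have "conv G a1 z = cscale \<mu> a1"
        unfolding a1_def conv_lin a(3) by (simp add: mult.commute)
      finally show ?thesis unfolding f'_def cscale_def using \<theta>s(3)[OF \<mu>E] by simp
    qed
    have "f' x0 = 1" unfolding f'_def a1_def cscale_apply using x0 \<theta>s(6) by simp
    then have f'0: "f' \<noteq> 0" by (auto simp: zero_fun_apply)
    \<comment> \<open>Right multiplication by \<open>z\<close> is the scalar \<mu> on the left ideal
      of \<open>f'\<close>, but not on that of \<open>f\<close>. Hence the dimension drops even if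
      \<mu> lies in \<open>F\<close>.\<close>
    obtain s where s: "s \<in> lideal f" "conv G s z \<noteq> cscale \<mu> s" using ns unfolding z_def by blast
    have "s \<notin> lideal f'"
    proof
      assume "s \<in> lideal f'"
      then obtain y where "s = conv G y f'" unfolding lideal_def by blast
      then show False using s(2) conv_assoc_block[OF f'b z(1), of y] f'z conv_lin(3) by metis
    qed
    then have "fs.dim (lideal f') < fs.dim (lideal f)" using lideal_dim_less[OF f'l f(1) s(1)] by blast
    from less.hyps[OF this E(1) f'b f'0 f'E]
    obtain E2 d2 where E2: "subfield E2 class_ring" "E \<subseteq> E2" "ring.dimension class_ring d2 E E2"
      "realizable_over G n \<phi> E2" "d2 * n \<le> fs.dim (lideal f')" by blast
    have "d * d2 * n \<le> d * fs.dim (lideal f')" using E2(5) by (simp add: mult.assoc)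
    also have "\<dots> \<le> fs.dim (lideal f)"
      by (rule eigen_lideal_dim[OF F E(1) E_def d f(1,3) z(2,1) f'l f'E f'z])
    finally show ?thesis
      using E2 E(2) ring.telescopic_base[OF ring_class_ring F E(1) d E2(3)] by (meson order_trans)
  qed
qed

end

section \<open>Galois conjugates of minimal left ideals\<close>

text \<open>A row of \<open>A i\<close> is fixed by \<open>A i\<close> and killed by the other
  idempotents. So n nonzero rows, one from each, form a basis, in which \<open>A i\<close> is the
  projection onto one coordinate; in particular each idempotent has rank one.\<close>

lemma orthogonal_idempotent_rows:
  assumes I: "finite I" "card I = n" and A: "\<And>i. i \<in> I \<Longrightarrow> msupp n (A i)"
    and orth: "\<And>i k. i \<in> I \<Longrightarrow> k \<in> I \<Longrightarrow> mm n (A i) (A k) = (if i = k then A i else 0)"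
    and b: "\<And>i. i \<in> I \<Longrightarrow> b i \<noteq> 0" "\<And>i. i \<in> I \<Longrightarrow> \<exists>a. b i = A i a"
  shows "lin_indep b I" "vsupp n \<subseteq> lspan b I"
    "\<And>i f. i \<in> I \<Longrightarrow> f \<in> vsupp n \<Longrightarrow> \<exists>c. vm n f (A i) = cscale c (b i)"
    "\<And>i. i \<in> I \<Longrightarrow> vm n (b i) (A i) = b i"
proof -
  have vmb: "vm n (b i) (A k) = (if i = k then b i else 0)" if ik: "i \<in> I" "k \<in> I" for i k
  proof -
    obtain a where a: "b i = A i a" using b(2)[OF ik(1)] by blast
    have "vm n (b i) (A k) = mm n (A i) (A k) a" unfolding a mm_row ..
    then show ?thesis unfolding orth[OF ik] a by (auto simp: zero_fun_def)
  qed
  have vm_comb: "vm n (\<Sum>i\<in>I. cscale (c i) (b i)) (A k) = cscale (c k) (b k)" if k: "k \<in> I" for c k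
  proof -
    have "vm n (\<Sum>i\<in>I. cscale (c i) (b i)) (A k) = (\<Sum>i\<in>I. if i = k then cscale (c k) (b k) else 0)"
      unfolding vm_sum vm_lin using vmb[OF _ k] by (intro sum.cong) auto
    then show ?thesis using I(1) k by simp
  qed
  show li: "lin_indep b I" unfolding lin_indep_def
  proof (intro allI impI ballI)
    fix c k assume c: "(\<Sum>i\<in>I. cscale (c i) (b i)) = 0" and k: "k \<in> I"
    have "vm n 0 (A k) = cscale 0 (vm n 0 (A k))" using vm_lin(2)[of n 0 0 "A k"] by simp
    then have "cscale (c k) (b k) = 0" using vm_comb[OF k, of c] c by simp
    then show "c k = 0" using b(1)[OF k] by simp
  qed
  have bs: "b i \<in> vsupp n" if "i \<in> I" for i
    using b(2)[OF that] msupp_row[OF A[OF that]] by auto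
  have "uvecs n \<subseteq> lspan b I"
  proof (rule lin_indep_spans[OF li I(1)])
    show "b ` I \<subseteq> fs.span (uvecs n)" using bs by (auto simp: vsupp_span[symmetric])
    show "card (uvecs n) \<le> card I" using I(2) by (simp add: card_unit_fun)
  qed simp
  then show sp: "vsupp n \<subseteq> lspan b I"
    unfolding vsupp_span lspan_eq_span[OF I(1)] by (rule fs.span_minimal[OF _ fs.subspace_span])
  show "\<exists>c. vm n f (A i) = cscale c (b i)" if i: "i \<in> I" and f: "f \<in> vsupp n" for i f
  proof -
    obtain c where "f = (\<Sum>i\<in>I. cscale (c i) (b i))" using sp f unfolding lspan_def by blast
    then show ?thesis using vm_comb[OF i, of c] by blast
  qed
  show "vm n (b i) (A i) = b i" if "i \<in> I" for i using vmb[OF that that] by simp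
qed

context finite_irrep
begin

definition rowmat :: "nat \<Rightarrow> (nat \<Rightarrow> complex) \<Rightarrow> cmat" where
  "rowmat a u = (\<lambda>a'. if a' = a then u else 0)"

lemma \<Psi>_rowmat_lin: "\<Psi> (rowmat a (u + v)) = \<Psi> (rowmat a u) + \<Psi> (rowmat a v)"
  "\<Psi> (rowmat a (cscale c u)) = cscale c (\<Psi> (rowmat a u))"
proof -
  have "rowmat a (u + v) = rowmat a u + rowmat a v"
    by (intro ext) (simp add: rowmat_def fun_apply)
  then show "\<Psi> (rowmat a (u + v)) = \<Psi> (rowmat a u) + \<Psi> (rowmat a v)" by (simp add: \<Psi>_lin)
  have "rowmat a (cscale c u) = (\<lambda>a'. cscale c (rowmat a u a'))"
    by (intro ext) (simp add: rowmat_def fun_apply)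
  then show "\<Psi> (rowmat a (cscale c u)) = cscale c (\<Psi> (rowmat a u))" by (simp add: \<Psi>_lin)
qed

lemma msupp_rowmat: "a < n \<Longrightarrow> u \<in> vsupp n \<Longrightarrow> msupp n (rowmat a u)"
  by (auto simp: msupp_def rowmat_def vsupp_def zero_fun_apply)

lemma msupp_eq_rowmat_sum:
  assumes "msupp n A"
  shows "A = (\<Sum>a<n. rowmat a (A a))"
proof (intro ext)
  fix a b
  have s: "(\<Sum>i\<in>I. f i) x = (\<Sum>i\<in>I. f i x)" for I :: "nat set" and f :: "nat \<Rightarrow> cmat" and x
    by (induction I rule: infinite_finite_induct) (simp_all add: plus_fun_apply zero_fun_apply)
  have "(\<Sum>a'<n. rowmat a' (A a')) a b = (\<Sum>a'<n. if a' = a then A a b else 0)"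
    unfolding s sum_fun_apply by (rule sum.cong) (auto simp: rowmat_def zero_fun_apply)
  also have "\<dots> = A a b" using assms by (simp add: msupp_def)
  finally show "A a b = (\<Sum>a'<n. rowmat a' (A a')) a b" by simp
qed

text \<open>Left multiplication only combines rows. The left ideal therefore lies in the span of the
  elements whose matrix has one vector of \<open>S\<close> in one of the \<open>n\<close> rows and
  zeros elsewhere.\<close>

lemma lideal_dim_le:
  assumes y: "y \<in> block" and S: "finite S" "\<And>a. \<Phi> y a \<in> fs.span S"
  shows "fs.dim (lideal y) \<le> n * card S"
proof -
  let ?W = "(\<lambda>(a, u). \<Psi> (rowmat a u)) ` ({..<n} \<times> S)"
  have row: "\<Psi> (rowmat a u) \<in> fs.span ?W" if "a < n" "u \<in> fs.span S" for a u
  proof -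
    have "fs.span S \<subseteq> {u. \<Psi> (rowmat a u) \<in> fs.span ?W}"
    proof (rule fs.span_minimal)
      have "\<Psi> (rowmat a u) \<in> ?W" if "u \<in> S" for u using that \<open>a < n\<close> by force
      then show "S \<subseteq> {u. \<Psi> (rowmat a u) \<in> fs.span ?W}" using fs.span_base by blast
      have "\<Psi> (rowmat a 0) = 0" using \<Psi>_rowmat_lin(2)[of a 0 0] by simp
      then show "fs.subspace {u. \<Psi> (rowmat a u) \<in> fs.span ?W}"
        by (intro fs.subspaceI) (simp_all add: \<Psi>_rowmat_lin fs.span_zero fs.span_add fs.span_scale)
    qed
    then show ?thesis using that(2) by blast
  qed
  have "lideal y \<subseteq> fs.span ?W"
  proof
    fix v assume "v \<in> lideal y"
    then obtain x where x: "v = conv G x y" unfolding lideal_def by blast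
    have ms: "msupp n (mm n (\<Phi> x) (\<Phi> y))" by (rule mm_msupp[OF \<Phi>_msupp \<Phi>_msupp])
    have "mm n (\<Phi> x) (\<Phi> y) a = (\<Sum>c<n. cscale (\<Phi> x a c) (\<Phi> y c))" for a
      by (rule ext) (simp add: mm_def fun_apply)
    then have r: "mm n (\<Phi> x) (\<Phi> y) a \<in> fs.span S" for a
      using S(2) by (auto intro!: fs.span_sum fs.span_scale)
    have "v = (\<Sum>a<n. \<Psi> (rowmat a (mm n (\<Phi> x) (\<Phi> y) a)))"
      unfolding x conv_block[OF y] by (subst msupp_eq_rowmat_sum[OF ms]) (simp only: \<Psi>_sum)
    also have "\<dots> \<in> fs.span ?W" using row[OF _ r] by (intro fs.span_sum) auto
    finally show "v \<in> fs.span ?W" .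
  qed
  then have "fs.dim (lideal y) \<le> card ?W" using S(1) by (intro fs.dim_le_card) auto
  also have "\<dots> \<le> card ({..<n} \<times> S)" using S(1) by (intro card_image_le) auto
  finally show ?thesis by (simp add: card_cartesian_product)
qed

lemma block_iff_conv: "x \<in> block \<longleftrightarrow> conv G x (\<Psi> (idm n)) = x"
  unfolding block_def conv_\<Psi> mm_idm(2)[OF \<Phi>_msupp] by simp

lemma one_block_left: "x \<in> block \<Longrightarrow> conv G (\<Psi> (idm n)) x = x"
  by (simp add: conv_block \<Phi>_\<Psi>[OF msupp_idm] mm_idm(1)[OF \<Phi>_msupp] blockD)

end

text \<open>The situation after passing to an equivalent representation \<open>\<phi>\<close> with
  entries in \<open>L\<close>. The assumption \<open>minimal\<close> expresses that m is the Schur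
  index, \<open>card_Gal\<close> together with \<open>dim\<close> that L/K is Galois, and
  \<open>eK\<close> makes the unit of the block invariant under the Galois group.\<close>

locale galois_block = finite_irrep G n \<phi> for G (structure) and n \<phi> +
  fixes K L :: "complex set" and m :: nat and l :: "nat \<Rightarrow> 'a \<Rightarrow> complex"
  assumes K: "csubfield K" and L: "csubfield L"
    and KL: "K \<subseteq> L" and dim: "ring.dimension class_ring m K L"
    and fin_Gal: "finite (Gal L K)" and card_Gal: "card (Gal L K) = m"
    and \<phi>L: "g \<in> carrier G \<Longrightarrow> a < n \<Longrightarrow> b < n \<Longrightarrow> \<phi> g $$ (a, b) \<in> L"
    and eK: "\<Psi> (idm n) g \<in> K"
    and minimal: "csubfield E \<Longrightarrow> K \<subseteq> E \<Longrightarrow> ring.dimension class_ring d K E \<Longrightarrow>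
      realizable_over G n \<phi> E \<Longrightarrow> m \<le> d"
    and l_block: "i \<in> {1..n} \<Longrightarrow> l i \<in> block" and lL: "i \<in> {1..n} \<Longrightarrow> l i g \<in> L"
    and l0: "i \<in> {1..n} \<Longrightarrow> l i \<noteq> 0"
    and l_orth: "i \<in> {1..n} \<Longrightarrow> k \<in> {1..n} \<Longrightarrow> conv G (l i) (l k) = (if i = k then l i else 0)"
begin

abbreviation "e \<equiv> \<Psi> (idm n)"

abbreviation "S \<equiv> Gal L K"

text \<open>The neutral element of the Galois group, whose elements are undefined off
  \<open>L\<close>.\<close>

definition idL :: "complex \<Rightarrow> complex" where "idL = (\<lambda>x\<in>L. x)"

text \<open>This is the algebra L[G] e.\<close>

definition LB :: "('a \<Rightarrow> complex) set" where
  "LB = {x \<in> block. \<forall>g. x g \<in> L}"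

lemmas Ls = subfield_complexD[OF L]

lemmas gal = GalD[OF _ L]

lemma idL_Gal: "idL \<in> S"
  using KL Ls unfolding Gal_iff idL_def
  by (auto simp: bij_betw_def inj_on_def image_def)

lemma idL_comp: "(\<And>g. x g \<in> L) \<Longrightarrow> idL \<circ> x = x"
  by (auto simp: idL_def fun_eq_iff)

lemma LB_block: "x \<in> LB \<Longrightarrow> x \<in> block" and LB_L: "x \<in> LB \<Longrightarrow> x g \<in> L"
  by (auto simp: LB_def)

lemma LB_subspace: "0 \<in> LB" "x \<in> LB \<Longrightarrow> y \<in> LB \<Longrightarrow> x + y \<in> LB" "c \<in> L \<Longrightarrow> x \<in> LB \<Longrightarrow> cscale c x \<in> LB"
  using Ls by (auto simp: LB_def fun_apply fs.subspace_0[OF block_subspace]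
    fs.subspace_add[OF block_subspace] fs.subspace_scale[OF block_subspace])

lemma LB_sum: "(\<And>i. i \<in> I \<Longrightarrow> f i \<in> LB) \<Longrightarrow> sum f I \<in> LB"
  by (induction I rule: infinite_finite_induct) (auto simp: LB_subspace)

lemma conv_LB: "(\<And>g. x g \<in> L) \<Longrightarrow> y \<in> LB \<Longrightarrow> conv G x y \<in> LB"
  by (auto simp: LB_def conv_in_block intro!: conv_rational[OF L])

lemma Gal_comp_conv:
  assumes s: "\<sigma> \<in> S" and x: "\<And>g. x g \<in> L" and y: "\<And>g. y g \<in> L"
  shows "\<sigma> \<circ> conv G x y = conv G (\<sigma> \<circ> x) (\<sigma> \<circ> y)"
proof
  fix g
  have "\<sigma> (\<Sum>h\<in>carrier G. x h * y (inv h \<otimes> g)) = (\<Sum>h\<in>carrier G. \<sigma> (x h * y (inv h \<otimes> g)))"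
    by (rule Gal_sum[OF s L]) (simp add: Ls(6) x y)
  then show "(\<sigma> \<circ> conv G x y) g = conv G (\<sigma> \<circ> x) (\<sigma> \<circ> y) g"
    by (simp add: conv_def gal[OF s] x y)
qed

lemma eL: "e g \<in> L"
  using eK KL by blast

lemma e_LB: "e \<in> LB"
  by (simp add: LB_def \<Psi>_block msupp_idm eL)

lemma Gal_e: "\<sigma> \<in> S \<Longrightarrow> \<sigma> \<circ> e = e"
  using gal(5) eK by (auto simp: fun_eq_iff)

text \<open>Membership in the block is tested by \<open>conv G x e = x\<close>, which conjugation
  preserves because e has coefficients in \<open>K\<close>. The description by matrices would not
  do, since \<sigma> does not commute with \<open>\<Phi>\<close>.\<close>

lemma Gal_LB: "\<sigma> \<in> S \<Longrightarrow> x \<in> LB \<Longrightarrow> \<sigma> \<circ> x \<in> LB"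
proof -
  assume s: "\<sigma> \<in> S" and x: "x \<in> LB"
  have "conv G (\<sigma> \<circ> x) e = \<sigma> \<circ> conv G x e"
    using Gal_comp_conv[OF s LB_L[OF x] eL] Gal_e[OF s] by simp
  also have "conv G x e = x" using LB_block[OF x] block_iff_conv by blast
  finally have "\<sigma> \<circ> x \<in> block" unfolding block_iff_conv .
  then show ?thesis using gal(6)[OF s LB_L[OF x]] by (simp add: LB_def)
qed

lemma Gal_comp_sum: "\<sigma> \<in> S \<Longrightarrow> (\<And>i. i \<in> I \<Longrightarrow> f i \<in> LB) \<Longrightarrow> \<sigma> \<circ> sum f I = (\<Sum>i\<in>I. \<sigma> \<circ> f i)"
  by (rule ext) (simp add: sum_fun_apply Gal_sum[OF _ L] LB_L)

lemma \<Phi>L: "(\<And>g. x g \<in> L) \<Longrightarrow> \<Phi> x a b \<in> L"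
  unfolding \<Phi>_def M_def using \<phi>L Ls by (auto intro!: subfield_complex_sum[OF L])

lemma \<Psi>L: "(\<And>a b. A a b \<in> L) \<Longrightarrow> \<Psi> A g \<in> L"
  unfolding \<Psi>_def trm_def mm_def M_def using \<phi>L Ls
  by (auto intro!: subfield_complex_sum[OF L] Ls(6,8) subfield_complex_of_nat[OF L])

lemma \<Psi>_LB: "msupp n A \<Longrightarrow> (\<And>a b. A a b \<in> L) \<Longrightarrow> \<Psi> A \<in> LB"
  by (simp add: LB_def \<Psi>_block \<Psi>L)

definition lg :: "nat \<times> (complex \<Rightarrow> complex) \<Rightarrow> 'a \<Rightarrow> complex" where
  "lg p = snd p \<circ> l (fst p)"

text \<open>\<open>\<Phi> (lg p)\<close> has rank one, so any nonzero row of it spans its row space; such a row exists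
  because \<open>lg p \<noteq> 0\<close>.\<close>

definition brow :: "nat \<times> (complex \<Rightarrow> complex) \<Rightarrow> nat \<Rightarrow> complex" where
  "brow p = \<Phi> (lg p) (SOME a. \<Phi> (lg p) a \<noteq> 0)"

lemma l_LB: "i \<in> {1..n} \<Longrightarrow> l i \<in> LB"
  by (simp add: LB_def l_block lL)

lemma lg_LB: "i \<in> {1..n} \<Longrightarrow> \<sigma> \<in> S \<Longrightarrow> lg (i, \<sigma>) \<in> LB"
  by (simp add: lg_def Gal_LB l_LB)

lemma lg_orth:
  assumes "i \<in> {1..n}" "k \<in> {1..n}" and s: "\<sigma> \<in> S"
  shows "conv G (lg (i, \<sigma>)) (lg (k, \<sigma>)) = (if i = k then lg (i, \<sigma>) else 0)"
proof -
  have "conv G (lg (i, \<sigma>)) (lg (k, \<sigma>)) = \<sigma> \<circ> conv G (l i) (l k)"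
    using Gal_comp_conv[OF s lL[OF assms(1)] lL[OF assms(2)]] by (simp add: lg_def)
  also have "\<dots> = (if i = k then lg (i, \<sigma>) else 0)"
    unfolding l_orth[OF assms(1,2)] using gal(4)[OF s] by (auto simp: lg_def fun_eq_iff zero_fun_apply)
  finally show ?thesis .
qed

lemma lg_nonzero: "i \<in> {1..n} \<Longrightarrow> \<sigma> \<in> S \<Longrightarrow> lg (i, \<sigma>) \<noteq> 0"
proof
  assume i: "i \<in> {1..n}" and s: "\<sigma> \<in> S" and z: "lg (i, \<sigma>) = 0"
  have "l i g = 0" for g
  proof -
    have "\<sigma> (l i g) = \<sigma> 0" using fun_cong[OF z, of g] gal(4)[OF s] by (simp add: lg_def zero_fun_apply)
    then show ?thesis using gal(2)[OF s] lL[OF i] Ls(1) unfolding bij_betw_def inj_on_def by blast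
  qed
  then have "l i = 0" by (auto simp: fun_eq_iff zero_fun_apply)
  then show False using l0[OF i] by simp
qed

lemma brow:
  assumes i: "i \<in> {1..n}" and s: "\<sigma> \<in> S"
  shows "brow (i, \<sigma>) \<noteq> 0" "\<exists>a. brow (i, \<sigma>) = \<Phi> (lg (i, \<sigma>)) a" "brow (i, \<sigma>) b \<in> L" "brow (i, \<sigma>) \<in> vsupp n"
proof -
  have "\<exists>a. \<Phi> (lg (i, \<sigma>)) a \<noteq> 0"
    by (rule block_nonzero[OF LB_block[OF lg_LB[OF i s]] lg_nonzero[OF i s]])
  then show "brow (i, \<sigma>) \<noteq> 0" unfolding brow_def by (rule someI_ex)
  show "\<exists>a. brow (i, \<sigma>) = \<Phi> (lg (i, \<sigma>)) a" unfolding brow_def by blast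
  show "brow (i, \<sigma>) b \<in> L" unfolding brow_def by (rule \<Phi>L[OF LB_L[OF lg_LB[OF i s]]])
  show "brow (i, \<sigma>) \<in> vsupp n" unfolding brow_def by (rule msupp_row[OF \<Phi>_msupp])
qed

text \<open>For fixed \<sigma> the n conjugates \<sigma>(l i) are again nonzero and orthogonal, so
  \<open>orthogonal_idempotent_rows\<close> applies to their matrices. Conjugates under different
  \<sigma> bear no such relation to each other.\<close>

lemma brow_rows:
  assumes s: "\<sigma> \<in> S"
  shows "vsupp n \<subseteq> lspan (\<lambda>i. brow (i, \<sigma>)) {1..n}"
    "i \<in> {1..n} \<Longrightarrow> f \<in> vsupp n \<Longrightarrow> \<exists>c. vm n f (\<Phi> (lg (i, \<sigma>))) = cscale c (brow (i, \<sigma>))"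
    "i \<in> {1..n} \<Longrightarrow> vm n (brow (i, \<sigma>)) (\<Phi> (lg (i, \<sigma>))) = brow (i, \<sigma>)"
proof -
  have orth: "mm n (\<Phi> (lg (i, \<sigma>))) (\<Phi> (lg (k, \<sigma>))) = (if i = k then \<Phi> (lg (i, \<sigma>)) else 0)"
    if ik: "i \<in> {1..n}" "k \<in> {1..n}" for i k
  proof -
    have "mm n (\<Phi> (lg (i, \<sigma>))) (\<Phi> (lg (k, \<sigma>))) = \<Phi> (conv G (lg (i, \<sigma>)) (lg (k, \<sigma>)))"
      by (rule \<Phi>_conv[OF LB_block[OF lg_LB[OF ik(2) s]], symmetric])
    also have "\<dots> = (if i = k then \<Phi> (lg (i, \<sigma>)) else 0)"
      unfolding lg_orth[OF ik s] by (auto simp: \<Phi>_def zero_fun_def)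
    finally show ?thesis .
  qed
  note * = orthogonal_idempotent_rows[of "{1..n}" n "\<lambda>i. \<Phi> (lg (i, \<sigma>))" "\<lambda>i. brow (i, \<sigma>)",
      OF _ _ \<Phi>_msupp orth brow(1)[OF _ s] brow(2)[OF _ s]]
  show "vsupp n \<subseteq> lspan (\<lambda>i. brow (i, \<sigma>)) {1..n}" by (rule *(2)) simp_all
  show "i \<in> {1..n} \<Longrightarrow> f \<in> vsupp n \<Longrightarrow> \<exists>c. vm n f (\<Phi> (lg (i, \<sigma>))) = cscale c (brow (i, \<sigma>))"
    by (rule *(3)) simp_all
  show "i \<in> {1..n} \<Longrightarrow> vm n (brow (i, \<sigma>)) (\<Phi> (lg (i, \<sigma>))) = brow (i, \<sigma>)"
    by (rule *(4)) simp_all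
qed

lemma conv_lg_row:
  assumes "i \<in> {1..n}" "\<sigma> \<in> S"
  shows "\<exists>c. \<Phi> (conv G x (lg (i, \<sigma>))) a = cscale c (brow (i, \<sigma>))"
  unfolding \<Phi>_conv[OF LB_block[OF lg_LB[OF assms]]] mm_row
  by (rule brow_rows(2)[OF assms(2,1) msupp_row[OF \<Phi>_msupp]])

text \<open>The only use of the minimality of the Schur index. The left ideal of \<open>y\<close>
  has dimension at most \<open>n * card W\<close>, and \<open>realizable_bound\<close> gives a field
  of degree \<open>d\<close> with \<open>d * n\<close> at most that dimension; then \<open>n\<close>
  cancels.\<close>

lemma rational_rank_bound:
  assumes y: "y \<in> block" "y \<noteq> 0" "\<And>g. y g \<in> K" and X: "finite W" "\<And>a. \<Phi> y a \<in> fs.span W"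
  shows "m \<le> card W"
proof -
  obtain E d where E: "subfield E class_ring" "K \<subseteq> E" "ring.dimension class_ring d K E"
    "realizable_over G n \<phi> E" and le: "d * n \<le> fs.dim (lideal y)"
    using realizable_bound[OF K y] by blast
  have "m * n \<le> d * n" using minimal[OF E] by simp
  also have "\<dots> \<le> n * card W" by (rule order_trans[OF le lideal_dim_le[OF y(1) X]])
  finally show ?thesis using n_pos by (simp add: mult.commute)
qed

text \<open>The row space belonging to the sum of all left ideals L[G] \<sigma>(l i) with
  \<open>i\<close> in \<open>T\<close> and \<sigma> in the Galois group.\<close>

definition V :: "nat set \<Rightarrow> (nat \<Rightarrow> complex) set" where
  "V T = lspan brow (T \<times> S)"

lemma V_span:
  assumes "T \<subseteq> {1..n}"
  shows "V T = fs.span (brow ` (T \<times> S))"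
  unfolding V_def by (rule lspan_eq_span) (use fin_Gal finite_subset[OF assms] in simp)

lemma V_subspace: "T \<subseteq> {1..n} \<Longrightarrow> fs.subspace (V T)"
  by (simp add: V_span fs.subspace_span)

lemma brow_V: "T \<subseteq> {1..n} \<Longrightarrow> i \<in> T \<Longrightarrow> \<sigma> \<in> S \<Longrightarrow> brow (i, \<sigma>) \<in> V T"
  unfolding V_span by (rule fs.span_base) blast

text \<open>Each row is split along the vectors \<open>brow p\<close> with coefficients in
  \<open>L\<close>. Collecting the p-th parts of all rows gives a matrix \<open>A p\<close> that
  right multiplication by the matrix of \<open>lg p\<close> fixes, so it comes from an element of
  the left ideal of \<open>lg p\<close>.\<close>

lemma rows_decompose:
  assumes T: "T \<subseteq> {1..n}" and v: "v \<in> LB" "\<And>a. \<Phi> v a \<in> V T"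
  obtains w where "\<And>p g. w p g \<in> L" "v = (\<Sum>p\<in>T \<times> S. conv G (w p) (lg p))"
proof -
  have bL: "brow p b \<in> L" if "p \<in> T \<times> S" for p b using brow(3) T that by auto
  have "\<forall>a. \<exists>\<alpha>. (\<forall>p. \<alpha> p \<in> L) \<and> \<Phi> v a = (\<Sum>p\<in>T \<times> S. cscale (\<alpha> p) (brow p))"
  proof
    fix a
    show "\<exists>\<alpha>. (\<forall>p. \<alpha> p \<in> L) \<and> \<Phi> v a = (\<Sum>p\<in>T \<times> S. cscale (\<alpha> p) (brow p))"
      by (rule rational_in_lspan[OF L bL \<Phi>L[OF LB_L[OF v(1)]] v(2)[unfolded V_def, of a]]) blast+
  qed
  from choice[OF this] obtain \<alpha> where
    "\<forall>a. (\<forall>p. \<alpha> a p \<in> L) \<and> \<Phi> v a = (\<Sum>p\<in>T \<times> S. cscale (\<alpha> a p) (brow p))" ..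
  then have \<alpha>: "\<alpha> a p \<in> L" "\<Phi> v a = (\<Sum>p\<in>T \<times> S. cscale (\<alpha> a p) (brow p))" for a p by blast+
  \<comment> \<open>Rows from \<open>n\<close> on are cut off: there the coefficients come from
    expanding a zero row and may be arbitrary.\<close>
  define A where "A p = (\<lambda>a. if a < n then cscale (\<alpha> a p) (brow p) else 0)" for p
  define w where "w p = (if p \<in> T \<times> S then \<Psi> (A p) else 0)" for p
  have As: "msupp n (A p)" if "p \<in> T \<times> S" for p
    using brow(4)[of "fst p" "snd p"] T that
    by (auto simp: A_def msupp_def fun_apply vsupp_def)
  have AL: "A p a b \<in> L" if "p \<in> T \<times> S" for p a b
    using bL[OF that] \<alpha>(1) Ls(1,6) by (auto simp: A_def fun_apply)
  have \<Phi>w: "\<Phi> (conv G (w p) (lg p)) = A p" if p: "p \<in> T \<times> S" for p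
  proof
    fix a
    obtain i \<sigma> where isg: "p = (i, \<sigma>)" "i \<in> {1..n}" "\<sigma> \<in> S" using p T by auto
    have "\<Phi> (conv G (w p) (lg p)) a = vm n (A p a) (\<Phi> (lg p))"
      using \<Phi>_conv[OF LB_block[OF lg_LB[OF isg(2,3)]], of "w p"] p
      by (simp add: isg(1) w_def \<Phi>_\<Psi> As mm_row)
    also have "\<dots> = A p a"
    proof (cases "a < n")
      case True
      then show ?thesis by (simp add: A_def vm_lin isg(1) brow_rows(3)[OF isg(3,2)])
    next
      case False
      then show ?thesis using vm_lin(2)[of n 0 0 "\<Phi> (lg p)"] by (simp add: A_def)
    qed
    finally show "\<Phi> (conv G (w p) (lg p)) a = A p a" .
  qed
  have LBs: "conv G (w p) (lg p) \<in> LB" if "p \<in> T \<times> S" for p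
  proof -
    have "w p g \<in> L" for g using that \<Psi>L[OF AL[OF that]] by (simp add: w_def)
    moreover have "lg p \<in> LB" using that T lg_LB by auto
    ultimately show ?thesis by (rule conv_LB)
  qed
  show ?thesis
  proof (rule that)
    show "w p g \<in> L" for p g using \<Psi>L[OF AL] Ls(1) by (simp add: w_def zero_fun_apply)
    show "v = (\<Sum>p\<in>T \<times> S. conv G (w p) (lg p))"
    proof (rule block_eqI[OF LB_block[OF v(1)] LB_block])
      show "(\<Sum>p\<in>T \<times> S. conv G (w p) (lg p)) \<in> LB" by (rule LB_sum[OF LBs])
      show "\<Phi> v = \<Phi> (\<Sum>p\<in>T \<times> S. conv G (w p) (lg p))"
      proof
        fix a
        have "\<Phi> (\<Sum>p\<in>T \<times> S. conv G (w p) (lg p)) a = (\<Sum>p\<in>T \<times> S. A p a)"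
          unfolding \<Phi>_sum by (rule sum.cong) (simp_all add: \<Phi>w)
        also have "\<dots> = \<Phi> v a"
        proof (cases "a < n")
          case True
          then show ?thesis by (simp add: A_def \<alpha>(2))
        next
          case False
          then have "\<Phi> v a = 0" using \<Phi>_msupp[of v] by (auto simp: msupp_def fun_eq_iff zero_fun_apply)
          then show ?thesis using False by (simp add: A_def)
        qed
        finally show "\<Phi> v a = \<Phi> (\<Sum>p\<in>T \<times> S. conv G (w p) (lg p)) a" by simp
      qed
    qed
  qed
qed

lemma Gal_lg:
  assumes "i \<in> {1..n}" and t: "\<tau> \<in> S"
  shows "\<tau> \<circ> lg (i, \<sigma>) = lg (i, compose L \<tau> \<sigma>)"
  using lL[OF assms(1)] by (auto simp: lg_def compose_def fun_eq_iff)

text \<open>The rows of \<open>\<tau> \<circ> v\<close> cannot be computed from those of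
  \<open>v\<close>. The element is therefore first split into summands from the left ideals of the
  \<open>lg p\<close>; for each \<open>i\<close> the Galois group permutes these ideals, and the
  rows are read off afterwards.\<close>

lemma rows_Gal_stable:
  assumes T: "T \<subseteq> {1..n}" and v: "v \<in> LB" "\<And>a. \<Phi> v a \<in> V T" and t: "\<tau> \<in> S"
  shows "\<Phi> (\<tau> \<circ> v) a \<in> V T"
proof -
  obtain w where w: "\<And>p g. w p g \<in> L" "v = (\<Sum>p\<in>T \<times> S. conv G (w p) (lg p))"
    using rows_decompose[OF T v] by blast
  have LBs: "conv G (w p) (lg p) \<in> LB" if "p \<in> T \<times> S" for p
    using that T lg_LB by (intro conv_LB w(1)) auto
  have "\<tau> \<circ> v = (\<Sum>p\<in>T \<times> S. \<tau> \<circ> conv G (w p) (lg p))"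
    unfolding w(2) by (rule Gal_comp_sum[OF t LBs])
  then have "\<Phi> (\<tau> \<circ> v) a = (\<Sum>p\<in>T \<times> S. \<Phi> (\<tau> \<circ> conv G (w p) (lg p)) a)"
    by (simp only: \<Phi>_sum)
  also have "\<dots> \<in> V T"
  proof (rule fs.subspace_sum[OF V_subspace[OF T]])
    fix p assume "p \<in> T \<times> S"
    then obtain i \<sigma> where isg: "p = (i, \<sigma>)" "i \<in> T" "\<sigma> \<in> S" by auto
    then have i: "i \<in> {1..n}" using T by blast
    have c: "compose L \<tau> \<sigma> \<in> S" by (rule Gal_compose[OF t isg(3) L KL])
    have "\<tau> \<circ> conv G (w p) (lg p) = conv G (\<tau> \<circ> w p) (lg (i, compose L \<tau> \<sigma>))"
      unfolding isg(1) using Gal_comp_conv[OF t w(1) LB_L[OF lg_LB[OF i isg(3)]]] Gal_lg[OF i t] by simp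
    then obtain r where "\<Phi> (\<tau> \<circ> conv G (w p) (lg p)) a = cscale r (brow (i, compose L \<tau> \<sigma>))"
      using conv_lg_row[OF i c] by metis
    then show "\<Phi> (\<tau> \<circ> conv G (w p) (lg p)) a \<in> V T"
      using fs.subspace_scale[OF V_subspace[OF T] brow_V[OF T isg(2) c]] by simp
  qed
  finally show ?thesis .
qed

lemma compose_bij: "\<tau> \<in> S \<Longrightarrow> bij_betw (compose L \<tau>) S S"
proof -
  assume t: "\<tau> \<in> S"
  have inj: "inj_on (compose L \<tau>) S" by (rule Gal_compose_inj[OF t L])
  have "compose L \<tau> ` S \<subseteq> S" using Gal_compose[OF t _ L KL] by auto
  then have "compose L \<tau> ` S = S" by (rule endo_inj_surj[OF fin_Gal _ inj])
  then show ?thesis using inj by (simp add: bij_betw_def)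
qed

text \<open>The element is the trace \<open>\<Sum>\<sigma>. \<sigma>(c v)\<close>, which is nonzero for some \<open>c\<close> by Dedekind's independence.\<close>

lemma trace_element:
  assumes v: "v \<in> LB" "v \<noteq> 0"
  shows "\<exists>y\<in>block. y \<noteq> 0 \<and> (\<forall>g. y g \<in> K) \<and>
    (\<forall>T\<subseteq>{1..n}. (\<forall>a. \<Phi> v a \<in> V T) \<longrightarrow> (\<forall>a. \<Phi> y a \<in> V T))"
proof -
  obtain g0 where g0: "v g0 \<noteq> 0" using v(2) by (auto simp: fun_eq_iff zero_fun_apply)
  have "\<exists>c\<in>L. (\<Sum>\<sigma>\<in>S. \<sigma> (v g0) * \<sigma> c) \<noteq> 0"
  proof (rule ccontr)
    assume "\<not> (\<exists>c\<in>L. (\<Sum>\<sigma>\<in>S. \<sigma> (v g0) * \<sigma> c) \<noteq> 0)"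
    then have z: "(\<Sum>\<sigma>\<in>S. \<sigma> (v g0) * \<sigma> c) = 0" if "c \<in> L" for c using that by blast
    have "\<forall>\<sigma>\<in>S. \<sigma> (v g0) = 0"
      by (rule Dedekind_independence[OF fin_Gal Ls(2) Ls(6) _ _ _ z]) (use gal in auto)
    then have "idL (v g0) = 0" using idL_Gal by blast
    then show False using g0 LB_L[OF v(1)] by (simp add: idL_def)
  qed
  then obtain c where c: "c \<in> L" "(\<Sum>\<sigma>\<in>S. \<sigma> (v g0) * \<sigma> c) \<noteq> 0" by blast
  define u where "u = cscale c v"
  have u: "u \<in> LB" unfolding u_def by (rule LB_subspace(3)[OF c(1) v(1)])
  define y where "y = (\<Sum>\<sigma>\<in>S. \<sigma> \<circ> u)"
  have yLB: "y \<in> LB" unfolding y_def by (rule LB_sum[OF Gal_LB[OF _ u]])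
  show ?thesis
  proof (intro bexI[of _ y] conjI allI impI)
    show "y \<in> block" by (rule LB_block[OF yLB])
    have "y g0 = (\<Sum>\<sigma>\<in>S. \<sigma> (v g0) * \<sigma> c)"
      unfolding y_def u_def using gal(8) c(1) LB_L[OF v(1)] by (simp add: fun_apply mult.commute)
    then show "y \<noteq> 0" using c(2) by (auto simp: zero_fun_apply)
    show "y g \<in> K" for g
    proof (rule Gal_fixed_field[OF K L KL dim fin_Gal card_Gal LB_L[OF yLB]])
      fix \<tau> assume t: "\<tau> \<in> S"
      have "\<tau> (y g) = (\<Sum>\<sigma>\<in>S. \<tau> (\<sigma> (u g)))"
        unfolding y_def by (simp add: fun_apply Gal_sum[OF t L] gal(6) LB_L[OF u])
      also have "\<dots> = (\<Sum>\<sigma>\<in>S. compose L \<tau> \<sigma> (u g))"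
        using LB_L[OF u] by (simp add: compose_def)
      also have "\<dots> = (\<Sum>\<sigma>\<in>S. \<sigma> (u g))" by (rule sum.reindex_bij_betw[OF compose_bij[OF t]])
      finally show "\<tau> (y g) = y g" by (simp add: y_def fun_apply)
    qed
    fix T a assume T: "T \<subseteq> {1..n}" and rows: "\<forall>a. \<Phi> v a \<in> V T"
    have "\<Phi> u a \<in> V T" for a
      unfolding u_def \<Phi>_lin by (rule fs.subspace_scale[OF V_subspace[OF T] spec[OF rows]])
    then show "\<Phi> y a \<in> V T"
      unfolding y_def \<Phi>_sum
      by (intro fs.subspace_sum[OF V_subspace[OF T]] rows_Gal_stable[OF T u])
  qed
qed

text \<open>The trace construction applied to \<open>l i\<close> gives a nonzero
  \<open>K\<close>-rational element with rows in \<open>V {i}\<close>. Its rank is at least m, while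
  \<open>V {i}\<close> is spanned by only m vectors, so none of them is redundant.\<close>

lemma brow_indep_single:
  assumes i: "i \<in> {1..n}"
  shows "lin_indep brow ({i} \<times> S)"
proof -
  have T: "{i} \<subseteq> {1..n}" using i by simp
  have "\<Phi> (l i) a \<in> V {i}" for a
  proof -
    have "conv G e (lg (i, idL)) = l i"
      using one_block_left[OF l_block[OF i]] by (simp add: lg_def idL_comp lL[OF i])
    then obtain c where "\<Phi> (l i) a = cscale c (brow (i, idL))"
      using conv_lg_row[OF i idL_Gal, of e a] by auto
    then show ?thesis using fs.subspace_scale[OF V_subspace[OF T] brow_V[OF T _ idL_Gal]] by simp
  qed
  then have rows: "\<forall>a. \<Phi> (l i) a \<in> V {i}" ..
  from trace_element[OF l_LB[OF i] l0[OF i]] obtain y where "y \<in> block"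
    and yy: "y \<noteq> 0 \<and> (\<forall>g. y g \<in> K) \<and>
      (\<forall>T\<subseteq>{1..n}. (\<forall>a. \<Phi> (l i) a \<in> V T) \<longrightarrow> (\<forall>a. \<Phi> y a \<in> V T))" ..
  then have y: "y \<in> block" "y \<noteq> 0" "y g \<in> K" for g by simp_all
  have yV: "\<Phi> y a \<in> V {i}" for a using yy T rows by simp
  have fin: "finite ({i} \<times> S)" using fin_Gal by simp
  obtain J where J: "J \<subseteq> {i} \<times> S" "lin_indep brow J" "lspan brow J = lspan brow ({i} \<times> S)"
    using lin_indep_subfamily[OF fin] .
  have finJ: "finite J" using finite_subset[OF J(1) fin] .
  have "m \<le> card (brow ` J)"
  proof (rule rational_rank_bound[OF y])
    show "\<Phi> y a \<in> fs.span (brow ` J)" for a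
      using yV[of a] unfolding V_def J(3)[symmetric] lspan_eq_span[OF finJ] .
  qed (use finJ in simp)
  also have "\<dots> \<le> card J" by (rule card_image_le[OF finJ])
  finally have "card ({i} \<times> S) \<le> card J" using card_Gal by (simp add: card_cartesian_product)
  then have "J = {i} \<times> S" using card_seteq[OF fin J(1)] by blast
  then show ?thesis using J(2) by simp
qed

text \<open>A relation produces an element of \<open>V {i} \<inter> V T\<close>, hence by traces a \<open>K\<close>-rational one. Its rank is at
  least \<open>m\<close>, so its rows span all of \<open>V {i}\<close>, which is then contained in \<open>V T\<close>.\<close>

lemma brow_indep_insert:
  assumes T: "T \<subseteq> {1..n}" "lin_indep brow (T \<times> S)" and i: "i \<in> {1..n}" "brow (i, idL) \<notin> V T"
  shows "lin_indep brow (insert i T \<times> S)"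
\<comment> \<open>Only relations with coefficients in \<open>L\<close> have to be refuted. This
  keeps \<open>u\<close> over \<open>L\<close>, so that it can be turned into an element of L[G]
  e.\<close>
proof (rule lin_indep_rationalI[OF L])
  have finT: "finite T" using T(1) finite_subset by blast
  show "brow p x \<in> L" if "p \<in> insert i T \<times> S" for p x
    using that T(1) i(1) brow(3) by auto
  fix c assume cL: "\<And>p. p \<in> insert i T \<times> S \<Longrightarrow> c p \<in> L"
    and rel: "(\<Sum>p\<in>insert i T \<times> S. cscale (c p) (brow p)) = 0"
  have iT: "i \<notin> T" using brow_V[OF T(1) _ idL_Gal] i(2) by blast
  have Ti: "{i} \<subseteq> {1..n}" using i(1) by simp
  have split: "insert i T \<times> S = ({i} \<times> S) \<union> (T \<times> S)" by auto
  define u where "u = (\<Sum>p\<in>{i} \<times> S. cscale (c p) (brow p))"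
  define u' where "u' = (\<Sum>p\<in>T \<times> S. cscale (c p) (brow p))"
  have "u + u' = 0"
    unfolding u_def u'_def rel[symmetric] split
    by (rule sum.union_disjoint[symmetric]) (use fin_Gal finT iT in auto)
  then have uu: "u = cscale (-1) u'" by (simp add: eq_neg_iff_add_eq_0)
  have uV: "u \<in> V {i}" unfolding u_def V_def by (rule lspanI)
  have "u' \<in> V T" unfolding u'_def V_def by (rule lspanI)
  then have uVT: "u \<in> V T" unfolding uu by (rule fs.subspace_scale[OF V_subspace[OF T(1)]])
  have "u = 0"
  proof (rule ccontr)
    assume u0: "u \<noteq> 0"
    have us: "u \<in> vsupp n"
      unfolding u_def using brow(4)[OF i(1)]
      by (intro fs.subspace_sum[OF vsupp_subspace] fs.subspace_scale[OF vsupp_subspace]) auto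
    have uL: "u b \<in> L" for b
      unfolding u_def fun_apply using brow(3)[OF i(1)] cL
      by (intro subfield_complex_sum[OF L] Ls(6)) auto
    \<comment> \<open>A vector becomes an element of the block by being placed in the first row of a
      zero matrix.\<close>
    define v where "v = \<Psi> (rowmat 0 u)"
    have ms: "msupp n (rowmat 0 u)" by (rule msupp_rowmat[OF n_pos us])
    have vLB: "v \<in> LB" unfolding v_def
      by (rule \<Psi>_LB[OF ms]) (use uL Ls(1) in \<open>simp add: rowmat_def zero_fun_apply\<close>)
    have \<Phi>v: "\<Phi> v = rowmat 0 u" unfolding v_def by (rule \<Phi>_\<Psi>[OF ms])
    have v0: "v \<noteq> 0"
    proof
      assume "v = 0"
      then have "rowmat 0 u 0 = \<Phi> 0 0" using \<Phi>v by simp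
      then show False using u0 by (simp add: rowmat_def \<Phi>_def zero_fun_def)
    qed
    have rows: "\<Phi> v a \<in> V T'" if "T' \<subseteq> {1..n}" "u \<in> V T'" for a T'
      unfolding \<Phi>v rowmat_def using that fs.subspace_0[OF V_subspace[OF that(1)]] by simp
    from trace_element[OF vLB v0] obtain y where "y \<in> block"
      and yy: "y \<noteq> 0 \<and> (\<forall>g. y g \<in> K) \<and>
        (\<forall>T\<subseteq>{1..n}. (\<forall>a. \<Phi> v a \<in> V T) \<longrightarrow> (\<forall>a. \<Phi> y a \<in> V T))" ..
    then have y: "y \<in> block" "y \<noteq> 0" "y g \<in> K" for g by simp_all
    \<comment> \<open>One and the same \<open>y\<close> has its rows in every \<open>V T'\<close>
      that contains \<open>u\<close>, in particular in both \<open>V {i}\<close> and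
      \<open>V T\<close>.\<close>
    have yV: "\<Phi> y a \<in> V T'" if "T' \<subseteq> {1..n}" "u \<in> V T'" for T' a
      using yy that(1) rows[OF that] by simp
    have yi: "\<Phi> y a \<in> V {i}" and yT: "\<Phi> y a \<in> V T" for a
      by (rule yV[OF Ti uV], rule yV[OF T(1) uVT])
    obtain J where J: "J \<subseteq> {..<n}" "lin_indep (\<Phi> y) J" "lspan (\<Phi> y) J = lspan (\<Phi> y) {..<n}"
      using lin_indep_subfamily[OF finite_lessThan] .
    have finJ: "finite J" using finite_subset[OF J(1)] by simp
    have "m \<le> card (\<Phi> y ` J)"
    proof (rule rational_rank_bound[OF y])
      fix a
      show "\<Phi> y a \<in> fs.span (\<Phi> y ` J)"
      proof (cases "a < n")
        case True
        then have "\<Phi> y a \<in> fs.span (\<Phi> y ` {..<n})" by (intro fs.span_base) simp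
        then show ?thesis using J(3) unfolding lspan_eq_span[OF finJ] lspan_eq_span[OF finite_lessThan] by simp
      next
        case False
        then have "\<Phi> y a = 0" using \<Phi>_msupp[of y] by (auto simp: msupp_def fun_eq_iff zero_fun_apply)
        then show ?thesis by (simp add: fs.span_zero)
      qed
    qed (use finJ in simp)
    also have "\<dots> \<le> card J" by (rule card_image_le[OF finJ])
    finally have mJ: "m \<le> card J" .
    have "brow ` ({i} \<times> S) \<subseteq> lspan (\<Phi> y) J"
    proof (rule lin_indep_spans[OF J(2) finJ])
      show "\<Phi> y ` J \<subseteq> fs.span (brow ` ({i} \<times> S))" using yi by (auto simp: V_span[OF Ti, symmetric])
      have "card (brow ` ({i} \<times> S)) \<le> card ({i} \<times> S)" by (rule card_image_le) (simp add: fin_Gal)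
      also have "\<dots> = m" by (simp add: card_cartesian_product card_Gal)
      finally show "card (brow ` ({i} \<times> S)) \<le> card J" using mJ by simp
    qed (simp add: fin_Gal)
    also have "lspan (\<Phi> y) J \<subseteq> V T"
      unfolding lspan_eq_span[OF finJ] by (rule fs.span_minimal[OF _ V_subspace[OF T(1)]]) (use yT in auto)
    finally show False using i(2) idL_Gal by blast
  qed
  then have "u' = 0" using \<open>u + u' = 0\<close> by simp
  have "\<forall>p\<in>T \<times> S. c p = 0"
    using spec[OF T(2)[unfolded lin_indep_def], of c] \<open>u' = 0\<close> unfolding u'_def by blast
  moreover have "\<forall>p\<in>{i} \<times> S. c p = 0"
    using spec[OF brow_indep_single[OF i(1), unfolded lin_indep_def], of c] \<open>u = 0\<close> unfolding u_def by blast
  ultimately show "\<forall>p\<in>insert i T \<times> S. c p = 0" unfolding split by blast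
qed

text \<open>Take \<open>T\<close> maximal with independent rows. If some
  \<open>brow (i, idL)\<close> were outside \<open>V T\<close>, then \<open>i\<close> could be
  added; and these vectors, for all \<open>i\<close>, already span the row space. Counting the
  resulting basis also shows that m divides n.\<close>

lemma galois_basis:
  obtains T where "T \<subseteq> {1..n}" "lin_indep brow (T \<times> S)" "vsupp n \<subseteq> V T" "card T * m = n"
proof -
  define TT where "TT = {T. T \<subseteq> {1..n} \<and> lin_indep brow (T \<times> S)}"
  have "{} \<in> TT" by (simp add: TT_def lin_indep_def)
  moreover have "finite TT" by (rule finite_subset[of _ "Pow {1..n}"]) (auto simp: TT_def)
  ultimately obtain T where "T \<in> TT" and max: "\<And>T'. T' \<in> TT \<Longrightarrow> T \<subseteq> T' \<Longrightarrow> T = T'"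
    using finite_has_maximal2[of TT "{}"] by metis
  then have T: "T \<subseteq> {1..n}" "lin_indep brow (T \<times> S)" by (auto simp: TT_def)
  have "brow (i, idL) \<in> V T" if i: "i \<in> {1..n}" for i
  proof (rule ccontr)
    assume ni: "brow (i, idL) \<notin> V T"
    have "insert i T \<in> TT" using brow_indep_insert[OF T i ni] T(1) i by (simp add: TT_def)
    then have "i \<in> T" using max[of "insert i T"] by blast
    then show False using ni brow_V[OF T(1) _ idL_Gal] by blast
  qed
  then have "fs.span ((\<lambda>i. brow (i, idL)) ` {1..n}) \<subseteq> V T"
    by (intro fs.span_minimal[OF _ V_subspace[OF T(1)]]) auto
  then have vV: "vsupp n \<subseteq> V T"
    using brow_rows(1)[OF idL_Gal] unfolding lspan_eq_span[OF finite_atLeastAtMost] by (rule subset_trans[rotated])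
  have fin: "finite (T \<times> S)" using T(1) fin_Gal finite_subset by blast
  have "card (T \<times> S) \<le> card (uvecs n)"
  proof (rule lin_indep_card_le[OF T(2) fin])
    show "brow ` (T \<times> S) \<subseteq> fs.span (uvecs n)"
      using brow(4) T(1) by (auto simp: vsupp_span[symmetric])
  qed simp
  then have le: "card (T \<times> S) \<le> n" by (simp add: card_unit_fun)
  have "fs.independent (uvecs n)" by (rule independent_unit_fun)
  then have "card (uvecs n) \<le> card (brow ` (T \<times> S))"
    using fs.independent_span_bound[of "brow ` (T \<times> S)" "uvecs n"] fin
      subset_trans[OF fs.span_superset vV[unfolded vsupp_span V_span[OF T(1)]]] by simp
  also have "\<dots> \<le> card (T \<times> S)" by (rule card_image_le[OF fin])
  finally have "card (T \<times> S) = n" using le by (simp add: card_unit_fun)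
  then have "card T * m = n" by (simp add: card_cartesian_product card_Gal)
  then show ?thesis using that T vV by blast
qed

end

section \<open>Galois-equivariant components of the unit element\<close>

context galois_block
begin

text \<open>The left ideal of \<open>lg p\<close> consists of the elements whose rows are multiples of \<open>brow p\<close>.\<close>

definition good :: "nat \<times> (complex \<Rightarrow> complex) \<Rightarrow> ('a \<Rightarrow> complex) \<Rightarrow> bool" where
  "good p v \<longleftrightarrow> v \<in> block \<and> (\<forall>a. \<exists>c. \<Phi> v a = cscale c (brow p))"

lemma good_0: "good p 0"
  unfolding good_def using fs.subspace_0[OF block_subspace]
  by (auto simp: \<Phi>_def zero_fun_def cscale_def intro!: exI[of _ 0])

lemma good_diff:
  assumes "good p v" "good p v'"
  shows "good p (v - v')"
  unfolding good_def
proof (intro conjI allI)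
  show "v - v' \<in> block" using assms fs.subspace_diff[OF block_subspace] by (simp add: good_def)
  fix a
  obtain c c' where c: "\<Phi> v a = cscale c (brow p)" "\<Phi> v' a = cscale c' (brow p)"
    using assms unfolding good_def by blast
  have "v - v' = v + cscale (-1) v'" by simp
  then have "\<Phi> (v - v') a = \<Phi> v a + cscale (-1) (\<Phi> v' a)" by (simp only: \<Phi>_lin plus_fun_apply)
  then have "\<Phi> (v - v') a = cscale (c - c') (brow p)" unfolding c by (simp add: fs.scale_left_diff_distrib)
  then show "\<exists>c. \<Phi> (v - v') a = cscale c (brow p)" ..
qed

lemma good_conv:
  assumes "good p v"
  shows "good p (conv G y v)"
  unfolding good_def
proof (intro conjI allI)
  have v: "v \<in> block" using assms by (simp add: good_def)
  then show "conv G y v \<in> block" by (rule conv_in_block)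
  fix a
  have "\<forall>c. \<exists>r. \<Phi> v c = cscale r (brow p)" using assms by (simp add: good_def)
  from choice[OF this] obtain r where r: "\<forall>c. \<Phi> v c = cscale (r c) (brow p)" ..
  have "\<Phi> (conv G y v) a = (\<Sum>c<n. cscale (\<Phi> y a c) (\<Phi> v c))"
    by (rule ext) (simp add: \<Phi>_conv[OF v] mm_def fun_apply)
  also have "\<dots> = cscale (\<Sum>c<n. \<Phi> y a c * r c) (brow p)"
    using r by (simp add: fs.scale_sum_left)
  finally show "\<exists>c. \<Phi> (conv G y v) a = cscale c (brow p)" ..
qed

lemma good_conv_lg: "i \<in> {1..n} \<Longrightarrow> \<sigma> \<in> S \<Longrightarrow> good (i, \<sigma>) (conv G y (lg (i, \<sigma>)))"
  unfolding good_def using conv_lg_row conv_in_block[OF LB_block[OF lg_LB]] by blast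

text \<open>Independence of the vectors \<open>brow p\<close>, applied to each row separately, makes
  the sum of the left ideals direct.\<close>

lemma good_unique:
  assumes T: "T \<subseteq> {1..n}" "lin_indep brow (T \<times> S)"
    and z: "\<And>p. p \<in> T \<times> S \<Longrightarrow> good p (z p)" "\<And>p. p \<in> T \<times> S \<Longrightarrow> good p (z' p)"
    and eq: "(\<Sum>p\<in>T \<times> S. z p) = (\<Sum>p\<in>T \<times> S. z' p)" and p: "p \<in> T \<times> S"
  shows "z p = z' p"
proof -
  define D where "D p = z p - z' p" for p
  have D: "good p (D p)" if "p \<in> T \<times> S" for p unfolding D_def using good_diff[OF z(1)[OF that] z(2)[OF that]] .
  have D0: "(\<Sum>p\<in>T \<times> S. D p) = 0" using eq by (simp add: D_def sum_subtractf)
  have "\<exists>c. p \<in> T \<times> S \<longrightarrow> \<Phi> (D p) a = cscale c (brow p)" for p a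
    using D[of p] unfolding good_def by blast
  then have "\<exists>c. \<forall>a. p \<in> T \<times> S \<longrightarrow> \<Phi> (D p) a = cscale (c a) (brow p)" for p
    by (intro choice allI)
  then have "\<forall>p. \<exists>c. \<forall>a. p \<in> T \<times> S \<longrightarrow> \<Phi> (D p) a = cscale (c a) (brow p)" by (rule allI)
  from choice[OF this] obtain c where c: "\<forall>p a. p \<in> T \<times> S \<longrightarrow> \<Phi> (D p) a = cscale (c p a) (brow p)" ..
  have "\<Phi> (D p) a = 0" for a
  proof -
    have "(\<Sum>p\<in>T \<times> S. cscale (c p a) (brow p)) = (\<Sum>p\<in>T \<times> S. \<Phi> (D p) a)"
      by (rule sum.cong) (use c in auto)
    also have "\<dots> = \<Phi> (\<Sum>p\<in>T \<times> S. D p) a" by (rule \<Phi>_sum[symmetric])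
    also have "\<dots> = 0" unfolding D0 by (simp add: \<Phi>_def zero_fun_def)
    finally have "c p a = 0"
      using spec[OF T(2)[unfolded lin_indep_def], of "\<lambda>p. c p a"] p by blast
    moreover have "\<Phi> (D p) a = cscale (c p a) (brow p)" using c p by blast
    ultimately show ?thesis by simp
  qed
  moreover have "D p \<in> block" using D[OF p] by (simp add: good_def)
  ultimately have "D p = 0" using block_nonzero by blast
  then show ?thesis by (simp add: D_def)
qed

lemma conv_sum_right: "conv G y (\<Sum>i\<in>I. x i) = (\<Sum>i\<in>I. conv G y (x i))"
proof
  fix g
  have "(\<Sum>h\<in>carrier G. y h * (\<Sum>i\<in>I. x i (inv h \<otimes> g))) = (\<Sum>i\<in>I. \<Sum>h\<in>carrier G. y h * x i (inv h \<otimes> g))"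
    unfolding sum_distrib_left by (rule sum.swap)
  then show "conv G y (\<Sum>i\<in>I. x i) g = (\<Sum>i\<in>I. conv G y (x i)) g"
    by (simp add: conv_def fun_apply)
qed

lemma galois_decomposition:
  obtains T x w where "T \<subseteq> {1..n}" "card T * m = n"
    "\<forall>p\<in>T \<times> S. x p \<in> LB \<and> x p \<noteq> 0 \<and> good p (x p)"
    "(\<Sum>p\<in>T \<times> S. x p) = e"
    "\<forall>i\<in>T. \<forall>\<tau>\<in>S. \<tau> \<circ> x (i, idL) = x (i, \<tau>)"
    "\<forall>q\<in>T \<times> S. \<forall>p\<in>T \<times> S. \<forall>y. good q y \<longrightarrow> conv G y (x p) = (if p = q then y else 0)"
    "\<forall>p\<in>T \<times> S. x p = conv G (w p) (lg p)" "\<forall>p g. w p g \<in> L"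
proof -
  obtain T where T: "T \<subseteq> {1..n}" "lin_indep brow (T \<times> S)" "vsupp n \<subseteq> V T" "card T * m = n"
    using galois_basis .
  have fin: "finite (T \<times> S)" using T(1) fin_Gal finite_subset by blast
  have "\<Phi> e a \<in> V T" for a using msupp_row[OF \<Phi>_msupp] T(3) by blast
  then obtain w where w: "\<And>p g. w p g \<in> L" "e = (\<Sum>p\<in>T \<times> S. conv G (w p) (lg p))"
    using rows_decompose[OF T(1) e_LB] by blast
  define x where "x p = conv G (w p) (lg p)" for p
  have sum_x: "(\<Sum>p\<in>T \<times> S. x p) = e" unfolding x_def by (rule w(2)[symmetric])
  have xLB: "x p \<in> LB" and xg: "good p (x p)" if "p \<in> T \<times> S" for p
    using that T(1) conv_LB[OF w(1) lg_LB] good_conv_lg unfolding x_def by auto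
  \<comment> \<open>Since y = y e is the sum of the products \<open>conv G y (x p)\<close>, which
    lie in the respective left ideals, uniqueness leaves \<open>y\<close> as its own only component.
    With \<open>y = x q\<close> this says that the components are orthogonal idempotents.\<close>
  have orth: "conv G y (x p) = (if p = q then y else 0)"
    if q: "q \<in> T \<times> S" and p: "p \<in> T \<times> S" and y: "good q y" for q p y
  proof (rule good_unique[OF T(1,2) _ _ _ p])
    show "good p (conv G y (x p))" if "p \<in> T \<times> S" for p by (rule good_conv[OF xg[OF that]])
    show "good p (if p = q then y else 0)" for p using y good_0 by simp
    have "(\<Sum>p\<in>T \<times> S. conv G y (x p)) = conv G y e" unfolding sum_x[symmetric] by (rule conv_sum_right[symmetric])
    also have "\<dots> = y" using y block_iff_conv by (simp add: good_def)
    also have "y = (\<Sum>p\<in>T \<times> S. if p = q then y else 0)" using q fin by simp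
    finally show "(\<Sum>p\<in>T \<times> S. conv G y (x p)) = (\<Sum>p\<in>T \<times> S. if p = q then y else 0)" .
  qed
  have gal_x: "\<tau> \<circ> x (i, idL) = x (i, \<tau>)" if i: "i \<in> T" and t: "\<tau> \<in> S" for i \<tau>
  proof -
    let ?c = "compose L \<tau>"
    define f where "f = inv_into S ?c"
    have bij: "bij_betw ?c S S" by (rule compose_bij[OF t])
    have f: "f \<sigma> \<in> S" "?c (f \<sigma>) = \<sigma>" if "\<sigma> \<in> S" for \<sigma>
      unfolding f_def using bij that inv_into_into[of \<sigma> ?c S] f_inv_into_f[of \<sigma> ?c S]
      by (simp_all only: bij_betw_def)
    \<comment> \<open>The conjugated components, reindexed by the inverse \<open>f\<close> of
      composition with \<open>\<tau>\<close> so that \<open>z p\<close> lies in the left ideal of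
      \<open>lg p\<close>. As \<tau> fixes e, they again sum to e.\<close>
    define z where "z p = \<tau> \<circ> x (fst p, f (snd p))" for p
    have "z (i, \<tau>) = x (i, \<tau>)"
    proof (rule good_unique[OF T(1,2)])
      fix p assume "p \<in> T \<times> S"
      then obtain k \<sigma> where p: "p = (k, \<sigma>)" "k \<in> T" "\<sigma> \<in> S" by blast
      then have k: "k \<in> {1..n}" using T(1) by blast
      have "z p = conv G (\<tau> \<circ> w (k, f \<sigma>)) (\<tau> \<circ> lg (k, f \<sigma>))"
        using Gal_comp_conv[OF t w(1) LB_L[OF lg_LB[OF k f(1)[OF p(3)]]]] by (simp add: z_def x_def p(1))
      also have "\<tau> \<circ> lg (k, f \<sigma>) = lg p"
        using Gal_lg[OF k t] f(2)[OF p(3)] p(1) by simp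
      finally show "good p (z p)" using good_conv_lg[OF k p(3)] p(1) by simp
      show "good p (x p)" by (rule xg) (use p in simp)
    next
      have "(\<Sum>p\<in>T \<times> S. z p) = (\<Sum>k\<in>T. \<Sum>\<sigma>\<in>S. \<tau> \<circ> x (k, f \<sigma>))"
        by (simp add: sum.cartesian_product z_def split_def)
      also have "\<dots> = (\<Sum>k\<in>T. \<Sum>\<sigma>\<in>S. \<tau> \<circ> x (k, \<sigma>))"
      proof (rule sum.cong[OF refl])
        fix k
        have "bij_betw f S S" unfolding f_def by (rule bij_betw_inv_into[OF bij])
        then show "(\<Sum>\<sigma>\<in>S. \<tau> \<circ> x (k, f \<sigma>)) = (\<Sum>\<sigma>\<in>S. \<tau> \<circ> x (k, \<sigma>))"
          by (rule sum.reindex_bij_betw)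
      qed
      also have "\<dots> = (\<Sum>p\<in>T \<times> S. \<tau> \<circ> x p)"
        by (simp add: sum.cartesian_product split_def)
      also have "\<dots> = \<tau> \<circ> (\<Sum>p\<in>T \<times> S. x p)" by (rule Gal_comp_sum[OF t xLB, symmetric])
      also have "\<dots> = (\<Sum>p\<in>T \<times> S. x p)" unfolding sum_x by (rule Gal_e[OF t])
      finally show "(\<Sum>p\<in>T \<times> S. z p) = (\<Sum>p\<in>T \<times> S. x p)" .
    qed (use i t in simp)
    moreover have "f \<tau> = idL"
    proof -
      have "?c idL = \<tau>"
        using gal(1)[OF t] by (auto simp: compose_def idL_def extensional_def fun_eq_iff)
      then have "?c (f \<tau>) = ?c idL" using f(2)[OF t] by simp
      then show ?thesis using bij f(1)[OF t] idL_Gal unfolding bij_betw_def inj_on_def by blast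
    qed
    ultimately show ?thesis by (simp add: z_def)
  qed
  \<comment> \<open>\<open>lg p\<close> lies in its own left ideal, so right multiplication by
    \<open>x p\<close> reproduces it; and it is not zero.\<close>
  have nz: "x p \<noteq> 0" if p: "p \<in> T \<times> S" for p
  proof
    assume z: "x p = 0"
    obtain i \<sigma> where isg: "p = (i, \<sigma>)" "i \<in> {1..n}" "\<sigma> \<in> S" using p T(1) by auto
    have "good p (conv G e (lg p))" unfolding isg(1) by (rule good_conv_lg[OF isg(2,3)])
    moreover have "conv G e (lg p) = lg p"
      unfolding isg(1) by (rule one_block_left[OF LB_block[OF lg_LB[OF isg(2,3)]]])
    ultimately have "lg p = conv G (lg p) (x p)" using orth[OF p p] by simp
    also have "\<dots> = 0" unfolding z by (rule ext) (simp add: conv_def zero_fun_apply)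
    finally show False using lg_nonzero[OF isg(2,3)] isg(1) by simp
  qed
  show ?thesis
    by (rule that[OF T(1,4) _ sum_x, of w]) (use xLB xg nz gal_x orth w(1) in \<open>auto simp: x_def\<close>)
qed

end

section \<open>Translation to the group algebra\<close>

lemma group_algebra_simps:
  "carrier (group_algebra L G) = {a. (\<forall>g\<in>carrier G. a g \<in> L) \<and> (\<forall>g. g \<notin> carrier G \<longrightarrow> a g = 0)}"
  "x \<otimes>\<^bsub>group_algebra L G\<^esub> y = conv G x y"
  "\<zero>\<^bsub>group_algebra L G\<^esub> = 0"
  "x \<oplus>\<^bsub>group_algebra L G\<^esub> y = x + y"
  by (simp_all add: group_algebra_def conv_def zero_fun_def plus_fun_def)

lemma block_algebra_simps:
  "carrier (block_algebra R e) = PIdl\<^bsub>R\<^esub> e"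
  "x \<otimes>\<^bsub>block_algebra R e\<^esub> y = x \<otimes>\<^bsub>R\<^esub> y"
  "\<zero>\<^bsub>block_algebra R e\<^esub> = \<zero>\<^bsub>R\<^esub>"
  "x \<oplus>\<^bsub>block_algebra R e\<^esub> y = x \<oplus>\<^bsub>R\<^esub> y"
  by (simp_all add: block_algebra_def)

text \<open>Values of \<open>x\<close> off the carrier do not enter \<open>conv\<close>, so the
  coefficient functions may be arbitrary \<open>L\<close>-valued ones.\<close>

lemma PIdl_group_algebra:
  assumes "0 \<in> L"
  shows "PIdl\<^bsub>group_algebra L G\<^esub> a = {conv G x a | x. \<forall>g. x g \<in> L}"
proof -
  have "conv G x a = conv G (\<lambda>g. if g \<in> carrier G then x g else 0) a" for x
    by (rule ext) (simp add: conv_def)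
  then show ?thesis
    unfolding cgenideal_def group_algebra_simps using assms by (fastforce cong: if_cong)
qed

lemma finsum_group_algebra:
  assumes L: "csubfield L" and "finite A"
    and "\<And>i. i \<in> A \<Longrightarrow> f i \<in> carrier (group_algebra L G)"
  shows "(\<Oplus>\<^bsub>group_algebra L G\<^esub>i\<in>A. f i) = sum f A"
proof -
  interpret abelian_monoid "group_algebra L G"
    by (rule abelian_monoidI)
      (use subfield_complexD[OF L] in \<open>auto simp: group_algebra_simps fun_apply add.assoc add.commute\<close>)
  show ?thesis using assms(2,3)
  proof (induction A rule: finite_induct)
    case (insert i A)
    then have "(\<Oplus>\<^bsub>group_algebra L G\<^esub>i\<in>insert i A. f i) = f i \<oplus>\<^bsub>group_algebra L G\<^esub> (\<Oplus>\<^bsub>group_algebra L G\<^esub>i\<in>A. f i)"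
      by (intro finsum_insert) auto
    then show ?case using insert by (simp add: group_algebra_simps(4))
  qed (simp add: group_algebra_simps(3))
qed

lemma (in finite_irrep) carrier_block_algebra:
  assumes L: "csubfield L" and e: "\<And>g. \<Psi> (idm n) g \<in> L"
  shows "carrier (block_algebra (group_algebra L G) (\<Psi> (idm n))) = {x \<in> block. \<forall>g. x g \<in> L}"
  unfolding block_algebra_simps PIdl_group_algebra[OF subfield_complexD(1)[OF L]]
proof safe
  fix x :: "'a \<Rightarrow> complex" assume x: "\<forall>g. x g \<in> L"
  show "conv G x (\<Psi> (idm n)) \<in> block" by (rule conv_in_block[OF \<Psi>_block[OF msupp_idm]])
  show "conv G x (\<Psi> (idm n)) g \<in> L" for g using x by (intro conv_rational[OF L] e) simp
next
  fix x assume "x \<in> block" "\<forall>g. x g \<in> L"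
  then show "\<exists>y. x = conv G y (\<Psi> (idm n)) \<and> (\<forall>g. y g \<in> L)"
    using block_iff_conv by (intro exI[of _ x]) simp
qed

context galois_block
begin

abbreviation "LG \<equiv> group_algebra L G"

abbreviation "Lid a \<equiv> PIdl\<^bsub>LG\<^esub> a"

lemma PIdl_LG: "Lid a = {conv G x a | x. \<forall>g. x g \<in> L}"
  by (rule PIdl_group_algebra[OF Ls(1)])

lemma PIdl_LG_subset:
  assumes b: "b \<in> block" and w: "\<And>g. w g \<in> L"
  shows "Lid (conv G w b) \<subseteq> Lid b"
  unfolding PIdl_LG
proof safe
  fix y :: "'a \<Rightarrow> complex" assume y: "\<forall>g. y g \<in> L"
  \<comment> \<open>Associativity of \<open>conv\<close> is at hand for factors in the block, but
    \<open>w\<close> is arbitrary. The block component \<open>v\<close> of the product of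
    \<open>y\<close> and \<open>w\<close> acts on \<open>b\<close> in the same way.\<close>
  define v where "v = \<Psi> (mm n (\<Phi> y) (\<Phi> w))"
  have "v g \<in> L" for g unfolding v_def mm_def
    using \<Phi>L[of y] \<Phi>L[of w] y w by (intro \<Psi>L subfield_complex_sum[OF L] Ls(6)) auto
  moreover have "conv G y (conv G w b) = conv G v b"
    unfolding conv_block[OF conv_in_block[OF b], of y] \<Phi>_conv[OF b]
    unfolding conv_block[OF b] v_def \<Phi>_\<Psi>[OF mm_msupp[OF \<Phi>_msupp \<Phi>_msupp]] mm_assoc ..
  ultimately show "\<exists>x. conv G y (conv G w b) = conv G x b \<and> (\<forall>g. x g \<in> L)" by blast
qed

lemma Gal_PIdl:
  assumes s: "\<sigma> \<in> S" and a: "\<And>g. a g \<in> L"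
  shows "(\<lambda>x. \<sigma> \<circ> x) ` (Lid a) = Lid (\<sigma> \<circ> a)"
proof
  show "(\<lambda>x. \<sigma> \<circ> x) ` (Lid a) \<subseteq> Lid (\<sigma> \<circ> a)"
    unfolding PIdl_LG
  proof safe
    fix y :: "'a \<Rightarrow> complex" assume y: "\<forall>g. y g \<in> L"
    have "\<sigma> \<circ> conv G y a = conv G (\<sigma> \<circ> y) (\<sigma> \<circ> a)" using y a by (intro Gal_comp_conv[OF s]) auto
    moreover have "\<forall>g. (\<sigma> \<circ> y) g \<in> L" using y gal(6)[OF s] by simp
    ultimately show "\<exists>x. \<sigma> \<circ> conv G y a = conv G x (\<sigma> \<circ> a) \<and> (\<forall>g. x g \<in> L)" by blast
  qed
  show "Lid (\<sigma> \<circ> a) \<subseteq> (\<lambda>x. \<sigma> \<circ> x) ` (Lid a)"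
    unfolding PIdl_LG
  proof safe
    fix y :: "'a \<Rightarrow> complex" assume y: "\<forall>g. y g \<in> L"
    define y' where "y' = (\<lambda>g. inv_into L \<sigma> (y g))"
    have im: "\<sigma> ` L = L" using gal(2)[OF s] by (simp add: bij_betw_def)
    have y': "y' g \<in> L" "\<sigma> (y' g) = y g" for g
      unfolding y'_def using y im inv_into_into[of "y g" \<sigma> L] f_inv_into_f[of "y g" \<sigma> L] by auto
    have "\<sigma> \<circ> conv G y' a = conv G (\<sigma> \<circ> y') (\<sigma> \<circ> a)" by (rule Gal_comp_conv[OF s y'(1) a])
    also have "\<sigma> \<circ> y' = y" using y'(2) by (auto simp: fun_eq_iff)
    finally have "conv G y (\<sigma> \<circ> a) = \<sigma> \<circ> conv G y' a" ..
    then show "conv G y (\<sigma> \<circ> a) \<in> (\<lambda>x. \<sigma> \<circ> x) ` {conv G x a | x. \<forall>g. x g \<in> L}" using y'(1) by blast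
  qed
qed

lemma carrier_B: "carrier (block_algebra LG e) = LB"
  unfolding LB_def by (rule carrier_block_algebra[OF L eL])

lemma conv_add_right: "conv G y (a + b) = conv G y a + conv G y b"
  by (rule ext) (simp add: conv_def fun_apply distrib_left sum.distrib)

text \<open>If x = a + b with orthogonal idempotents, then a = a x and b = b x, so all rows of both
  are multiples of \<open>brow p\<close>. If a is nonzero, a b = 0 forces the matrix of b to kill
  \<open>brow p\<close>, hence b = b b = 0.\<close>

lemma good_primitive:
  assumes x: "x \<in> LB" "good p x" "conv G x x = x" "x \<noteq> 0"
  shows "primitive_idem (block_algebra LG e) x"
proof -
  have "a = 0 \<or> b = 0" if ab: "a \<in> LB" "b \<in> LB" "conv G a a = a" "conv G b b = b"
    "conv G a b = 0" "conv G b a = 0" "x = a + b" for a b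
  proof (rule disjCI, rule ccontr)
    assume b0: "b \<noteq> 0" and a0: "a \<noteq> 0"
    have "conv G a x = a" "conv G b x = b" unfolding ab(7) conv_add_right ab(3-6) by simp_all
    then have good: "good p a" "good p b" using good_conv[OF x(2)] by metis+
    have row0: "vm n (\<Phi> u r) (\<Phi> v) = \<Phi> (conv G u v) r" if "v \<in> LB" for u v r
      unfolding \<Phi>_conv[OF LB_block[OF that]] mm_row ..
    obtain r where r: "\<Phi> a r \<noteq> 0" using block_nonzero[OF LB_block[OF ab(1)] a0] ..
    obtain c where c: "\<Phi> a r = cscale c (brow p)" using good(1) unfolding good_def by blast
    have "cscale c (vm n (brow p) (\<Phi> b)) = 0"
      using row0[OF ab(2), of a r] unfolding ab(5) c vm_lin by (simp add: \<Phi>_def zero_fun_def)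
    moreover have "c \<noteq> 0" using r c by auto
    ultimately have z: "vm n (brow p) (\<Phi> b) = 0" by simp
    obtain s where s: "\<Phi> b s \<noteq> 0" using block_nonzero[OF LB_block[OF ab(2)] b0] ..
    obtain d where d: "\<Phi> b s = cscale d (brow p)" using good(2) unfolding good_def by blast
    have "\<Phi> b s = vm n (\<Phi> b s) (\<Phi> b)" using row0[OF ab(2), of b s] unfolding ab(4) by simp
    also have "\<dots> = 0" by (subst d) (simp add: vm_lin z)
    finally show False using s by simp
  qed
  note prim = this
  show ?thesis
    unfolding primitive_idem_def carrier_B block_algebra_simps(2-4) group_algebra_simps
  proof (intro conjI ballI impI)
    fix a b
    assume "a \<in> LB" "b \<in> LB" "conv G a a = a \<and> conv G b b = b \<and> conv G a b = 0 \<and> conv G b a = 0 \<and> x = a + b"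
    then show "a = 0 \<or> b = 0" by (elim conjE) (rule prim)
  qed (fact x)+
qed

end

section \<open>Equivalent representations: characters, irreducibility, realizability\<close>

lemma trace_mult_commute:
  assumes "A \<in> carrier_mat n n" "B \<in> carrier_mat n n"
  shows "(\<Sum>i<n. (A * B) $$ (i, i)) = (\<Sum>i<n. (B * A) $$ (i, i) :: complex)"
proof -
  have "(\<Sum>i<n. (A * B) $$ (i, i)) = (\<Sum>i<n. \<Sum>j<n. A $$ (i, j) * B $$ (j, i))"
    using assms by (auto simp: scalar_prod_def lessThan_atLeast0 intro!: sum.cong)
  also have "\<dots> = (\<Sum>j<n. \<Sum>i<n. B $$ (j, i) * A $$ (i, j))"
    by (subst sum.swap) (simp add: mult.commute)
  also have "\<dots> = (\<Sum>i<n. (B * A) $$ (i, i))"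
    using assms by (auto simp: scalar_prod_def lessThan_atLeast0 intro!: sum.cong)
  finally show ?thesis .
qed

lemma rep_char_sum: "\<rho> g \<in> carrier_mat n n \<Longrightarrow> rep_char \<rho> g = (\<Sum>i<n. \<rho> g $$ (i, i))"
  by (simp add: rep_char_def diag_mat_def sum_list_sum_nth lessThan_atLeast0)

lemma matrix_rep_carrier: "matrix_rep G n \<rho> \<Longrightarrow> g \<in> carrier G \<Longrightarrow> \<rho> g \<in> carrier_mat n n"
  unfolding matrix_rep_def hom_def by (auto simp: units_of_carrier Units_def ring_mat_simps)

lemma rep_char_similar:
  assumes "\<rho> g \<in> carrier_mat n n" "similar_mat_wit (\<rho> g) (\<phi> g) P Q"
  shows "rep_char \<rho> g = rep_char \<phi> g"
proof -
  note w = similar_mat_witD2[OF assms]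
  have "(\<Sum>i<n. \<rho> g $$ (i, i)) = (\<Sum>i<n. (P * (\<phi> g * Q)) $$ (i, i))"
    using w by (simp add: assoc_mult_mat[of _ n n _ n _ n])
  also have "\<dots> = (\<Sum>i<n. (\<phi> g * Q * P) $$ (i, i))"
    using w by (intro trace_mult_commute) auto
  also have "\<phi> g * Q * P = \<phi> g" using w by (simp add: assoc_mult_mat[of _ n n _ n _ n])
  finally show ?thesis using rep_char_sum[of \<rho> g n] rep_char_sum[of \<phi> g n] assms(1) w(5) by simp
qed

lemma irreducible_rep_similar:
  assumes G: "Group.group G" and \<rho>: "irreducible_rep G n \<rho>" and \<phi>: "matrix_rep G n \<phi>"
    and sim: "\<And>g. g \<in> carrier G \<Longrightarrow> similar_mat_wit (\<rho> g) (\<phi> g) P Q"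
  shows "irreducible_rep G n \<phi>"
proof -
  interpret Group.group G by fact
  have \<rho>c: "\<rho> g \<in> carrier_mat n n" if "g \<in> carrier G" for g
    using \<rho> matrix_rep_carrier[OF _ that] by (simp add: irreducible_rep_def)
  note w = similar_mat_witD2[OF \<rho>c sim]
  note P = w(6)[OF one_closed one_closed] and Q = w(7)[OF one_closed one_closed]
    and QP = w(2)[OF one_closed one_closed]
  have QPv: "Q *\<^sub>v (P *\<^sub>v v) = v" if "v \<in> carrier_vec n" for v
    using assoc_mult_mat_vec[OF Q P that] QP that by simp
  have "W = {0\<^sub>v n} \<or> W = carrier_vec n"
    if sub: "VectorSpace.subspace class_ring W (module_vec TYPE(complex) n)"
      and inv: "\<forall>g\<in>carrier G. \<forall>w\<in>W. \<phi> g *\<^sub>v w \<in> W" for W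
  proof -
    have sm: "submodule class_ring W (module_vec TYPE(complex) n)"
      using sub by (simp add: VectorSpace.subspace_def)
    have Wc: "W \<subseteq> carrier_vec n" using submodule.subset[OF sm] by (simp add: module_vec_simps)
    let ?W = "(\<lambda>v. P *\<^sub>v v) ` W"
    have "VectorSpace.subspace class_ring ?W (module_vec TYPE(complex) n)"
    proof (rule subspace_vecI)
      show "?W \<subseteq> carrier_vec n" using P Wc by auto
      show "v + w \<in> ?W" if vw: "v \<in> ?W" "w \<in> ?W" for v w
      proof -
        obtain a b where ab: "v = P *\<^sub>v a" "w = P *\<^sub>v b" "a \<in> W" "b \<in> W" using vw by blast
        then have "a \<in> carrier_vec n" "b \<in> carrier_vec n" using Wc by auto
        then have "v + w = P *\<^sub>v (a + b)" unfolding ab(1,2) by (rule mult_add_distrib_mat_vec[OF P, symmetric])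
        moreover have "a + b \<in> W" using submodule.m_closed[OF sm ab(3,4)] by (simp add: module_vec_simps)
        ultimately show ?thesis by simp
      qed
      show "0\<^sub>v n \<in> ?W"
        using submodule.zero_closed[OF sm] P by (auto simp: module_vec_simps intro!: image_eqI[of _ _ "0\<^sub>v n"])
      show "c \<cdot>\<^sub>v v \<in> ?W" if v: "v \<in> ?W" for c v
      proof -
        obtain a where a: "v = P *\<^sub>v a" "a \<in> W" using v by blast
        then have "c \<cdot>\<^sub>v v = P *\<^sub>v (c \<cdot>\<^sub>v a)" using mult_mat_vec[OF P] Wc by auto
        moreover have "c \<cdot>\<^sub>v a \<in> W"
          using submodule.smult_closed[OF sm _ a(2)] by (simp add: module_vec_simps class_ring_simps)
        ultimately show ?thesis by simp
      qed
    qed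
    moreover have "\<rho> g *\<^sub>v v \<in> ?W" if g: "g \<in> carrier G" and v: "v \<in> ?W" for g v
    proof -
      obtain a where a: "v = P *\<^sub>v a" "a \<in> W" using v by blast
      have ac: "a \<in> carrier_vec n" using a(2) Wc by blast
      note wg = w[OF g g]
      have "\<rho> g *\<^sub>v v = P *\<^sub>v (\<phi> g *\<^sub>v (Q *\<^sub>v (P *\<^sub>v a)))"
        unfolding a(1) wg(3) using wg(5-7) ac
        by (simp add: assoc_mult_mat_vec[of _ n n _ n] assoc_mult_mat[of _ n n _ n _ n])
      then show ?thesis using inv g a(2) QPv[OF ac] by simp
    qed
    ultimately have "?W = {0\<^sub>v n} \<or> ?W = carrier_vec n"
      using \<rho> unfolding irreducible_rep_def by blast
    then show ?thesis
    proof
      assume z: "?W = {0\<^sub>v n}"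
      have "v = 0\<^sub>v n" if "v \<in> W" for v
      proof -
        have "P *\<^sub>v v = 0\<^sub>v n" using z that by blast
        then have "v = Q *\<^sub>v 0\<^sub>v n" using QPv[of v] that Wc by auto
        also have "\<dots> = 0\<^sub>v n" using Q by (intro eq_vecI) auto
        finally show ?thesis .
      qed
      moreover have "0\<^sub>v n \<in> W" using submodule.zero_closed[OF sm] by (simp add: module_vec_simps)
      ultimately show ?thesis by blast
    next
      assume full: "?W = carrier_vec n"
      have "v \<in> W" if v: "v \<in> carrier_vec n" for v
      proof -
        have "P *\<^sub>v v \<in> ?W" unfolding full using P v by simp
        then obtain a where a: "a \<in> W" "P *\<^sub>v v = P *\<^sub>v a" by blast
        then have "v = a" using QPv[OF v] QPv[of a] Wc by auto
        then show ?thesis using a(1) by simp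
      qed
      then show ?thesis using Wc by blast
    qed
  qed
  then show ?thesis using \<rho> \<phi> unfolding irreducible_rep_def by blast
qed

lemma realizable_over_similar:
  assumes sim: "\<And>g. g \<in> carrier G \<Longrightarrow> similar_mat_wit (\<rho> g) (\<phi> g) P Q"
    and "realizable_over G n \<phi> F"
  shows "realizable_over G n \<rho> F"
proof -
  obtain \<psi> P' Q' where "matrix_rep G n \<psi>"
    "\<forall>g\<in>carrier G. elements_mat (\<psi> g) \<subseteq> F \<and> similar_mat_wit (\<phi> g) (\<psi> g) P' Q'"
    using assms(2) unfolding realizable_over_def by blast
  then show ?thesis unfolding realizable_over_def using similar_mat_wit_trans[OF sim] by blast
qed

section \<open>Idempotents and direct sums in the group algebra over the field L\<close>

context galois_block
begin

abbreviation "I \<equiv> {1..n div m}"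

abbreviation "BA \<equiv> block_algebra LG e"

lemma LB_carrier_LG: "LB \<subseteq> carrier LG"
proof
  fix x assume x: "x \<in> LB"
  have "x g = 0" if "g \<notin> carrier G" for g
    using fun_cong[OF blockD[OF LB_block[OF x]], of g] that by (simp add: \<Psi>_def)
  then show "x \<in> carrier LG" using LB_L[OF x] by (simp add: group_algebra_simps)
qed

text \<open>The inverse of the summation map sends y to the family of products
  \<open>conv G y (x p)\<close>: orthogonality recovers the summands, and y = y e gives
  surjectivity.\<close>

lemma direct_orthogonal_sum_LG:
  assumes P: "finite P" and x: "\<And>p. p \<in> P \<Longrightarrow> x p \<in> LB"
    and orth: "\<And>p q. p \<in> P \<Longrightarrow> q \<in> P \<Longrightarrow> conv G (x q) (x p) = (if p = q then x q else 0)"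
    and sum_x: "(\<Sum>p\<in>P. x p) = e"
  shows "direct_orthogonal_sum LG (carrier BA) P x"
proof -
  let ?\<Pi> = "\<Pi>\<^sub>E i\<in>P. Lid (x i)"
  have idl: "Lid (x p) \<subseteq> LB" if "p \<in> P" for p
    unfolding PIdl_LG using conv_LB[OF _ x[OF that]] by auto
  have sum_f: "(\<Oplus>\<^bsub>LG\<^esub>i\<in>P. f i) = sum f P" if "\<And>p. p \<in> P \<Longrightarrow> f p \<in> LB" for f
    by (rule finsum_group_algebra[OF L P]) (use that LB_carrier_LG in blast)
  have conv_sum: "conv G (sum f P) y = (\<Sum>p\<in>P. conv G (f p) y)" for f y
    using P by (induction P) (simp_all add: conv_0 conv_lin)
  have comp: "conv G (sum f P) (x p) = f p" if f: "f \<in> ?\<Pi>" and p: "p \<in> P" for f p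
  proof -
    have "conv G (f q) (x p) = (if q = p then f p else 0)" if q: "q \<in> P" for q
    proof -
      have "f q \<in> Lid (x q)" using f q by (rule PiE_mem)
      then obtain y where y: "f q = conv G y (x q)" unfolding PIdl_LG by blast
      have "conv G (f q) (x p) = conv G y (conv G (x q) (x p))"
        unfolding y by (rule conv_assoc_block[OF LB_block[OF x[OF q]] LB_block[OF x[OF p]]])
      also have "\<dots> = (if q = p then f p else 0)"
        unfolding orth[OF p q] using y by (auto simp: conv_def zero_fun_def)
      finally show ?thesis .
    qed
    then have "(\<Sum>q\<in>P. conv G (f q) (x p)) = (\<Sum>q\<in>P. if q = p then f p else 0)" by (rule sum.cong[OF refl])
    then show ?thesis unfolding conv_sum using P p by simp
  qed
  have fLB: "f p \<in> LB" if "f \<in> ?\<Pi>" "p \<in> P" for f p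
    using PiE_mem[OF that] idl[OF that(2)] by blast
  have "bij_betw (\<lambda>f. \<Oplus>\<^bsub>LG\<^esub>i\<in>P. f i) ?\<Pi> LB"
  proof (rule bij_betw_imageI)
    show "inj_on (\<lambda>f. \<Oplus>\<^bsub>LG\<^esub>i\<in>P. f i) ?\<Pi>"
    proof (rule inj_onI)
      fix f f' assume f: "f \<in> ?\<Pi>" "f' \<in> ?\<Pi>"
        and "(\<Oplus>\<^bsub>LG\<^esub>i\<in>P. f i) = (\<Oplus>\<^bsub>LG\<^esub>i\<in>P. f' i)"
      then have eq: "sum f P = sum f' P" using sum_f[OF fLB[OF f(1)]] sum_f[OF fLB[OF f(2)]] by simp
      show "f = f'"
        by (rule PiE_ext[OF f]) (use comp[OF f(1)] comp[OF f(2)] eq in metis)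
    qed
    show "(\<lambda>f. \<Oplus>\<^bsub>LG\<^esub>i\<in>P. f i) ` ?\<Pi> = LB"
    proof
      show "(\<lambda>f. \<Oplus>\<^bsub>LG\<^esub>i\<in>P. f i) ` ?\<Pi> \<subseteq> LB"
      proof safe
        fix f assume f: "f \<in> ?\<Pi>"
        show "(\<Oplus>\<^bsub>LG\<^esub>i\<in>P. f i) \<in> LB"
          using sum_f[of f, OF fLB[OF f]] LB_sum[of P f, OF fLB[OF f]] by simp
      qed
      show "LB \<subseteq> (\<lambda>f. \<Oplus>\<^bsub>LG\<^esub>i\<in>P. f i) ` ?\<Pi>"
      proof
        fix y assume y: "y \<in> LB"
        define f where "f = (\<lambda>p\<in>P. conv G y (x p))"
        have f: "f \<in> ?\<Pi>"
          unfolding PIdl_LG f_def using LB_L[OF y] by auto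
        have "(\<Oplus>\<^bsub>LG\<^esub>i\<in>P. f i) = sum f P" by (rule sum_f[OF fLB[OF f]])
        also have "\<dots> = conv G y e" unfolding sum_x[symmetric] conv_sum_right by (simp add: f_def)
        also have "\<dots> = y" using block_iff_conv LB_block[OF y] by blast
        finally show "y \<in> (\<lambda>f. \<Oplus>\<^bsub>LG\<^esub>i\<in>P. f i) ` ?\<Pi>" using f by (intro image_eqI[of _ _ f]) simp_all
      qed
    qed
  qed
  moreover have "orthogonal_idems LG P x"
    unfolding orthogonal_idems_def group_algebra_simps(2,3)
    using x LB_carrier_LG orth by auto
  ultimately show ?thesis unfolding direct_orthogonal_sum_def carrier_B by simp
qed

lemma galois_idempotents:
  assumes bij: "bij_betw \<tau> {1..m} S" and \<tau>1: "\<tau> 1 = idL"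
  shows "m dvd n \<and>
    (\<exists>(u :: nat \<Rightarrow> 'a \<Rightarrow> complex) (j :: nat \<Rightarrow> nat).
      j ` I \<subseteq> {1..n} \<and>
      inj_on (\<lambda>s. Lid (l (j s))) I \<and>
      (\<forall>s\<in>I. primitive_idem BA (u s) \<and> u s \<in> Lid (l (j s))) \<and>
      orthogonal_idems BA I u \<and>
      (\<forall>h\<in>{1..m}. \<forall>s\<in>I.
         primitive_idem BA (\<tau> h \<circ> u s) \<and>
         Lid (\<tau> h \<circ> u s) = (\<lambda>x. \<tau> h \<circ> x) ` (Lid (l (j s))) \<and>
         (\<lambda>x. \<tau> h \<circ> x) ` (Lid (l (j s))) = Lid (\<tau> h \<circ> l (j s))) \<and>
      (\<forall>s\<in>I. \<forall>t\<in>I. \<forall>h\<in>{1..m}. \<forall>k\<in>{1..m}.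
         (\<tau> h \<circ> u s) \<otimes>\<^bsub>LG\<^esub> (\<tau> k \<circ> u t) =
           (if k = h \<and> t = s then \<tau> h \<circ> u s else \<zero>\<^bsub>LG\<^esub>)) \<and>
      direct_orthogonal_sum LG (carrier BA) (I \<times> {1..m}) (\<lambda>(s, h). \<tau> h \<circ> u s) \<and>
      e = (\<Oplus>\<^bsub>LG\<^esub>s\<in>I. \<Oplus>\<^bsub>LG\<^esub>h\<in>{1..m}. \<tau> h \<circ> u s) \<and>
      e = (\<Oplus>\<^bsub>LG\<^esub>s\<in>I. \<Oplus>\<^bsub>LG\<^esub>\<sigma>\<in>S. \<sigma> \<circ> u s))"
proof -
  obtain T x w where T: "T \<subseteq> {1..n}" "card T * m = n"
    and x: "\<forall>p\<in>T \<times> S. x p \<in> LB \<and> x p \<noteq> 0 \<and> good p (x p)"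
    and sum_x: "(\<Sum>p\<in>T \<times> S. x p) = e"
    and gx: "\<forall>i\<in>T. \<forall>\<tau>\<in>S. \<tau> \<circ> x (i, idL) = x (i, \<tau>)"
    and ox: "\<forall>q\<in>T \<times> S. \<forall>p\<in>T \<times> S. \<forall>y. good q y \<longrightarrow> conv G y (x p) = (if p = q then y else 0)"
    and xw: "\<forall>p\<in>T \<times> S. x p = conv G (w p) (lg p)" "\<forall>p g. w p g \<in> L"
    using galois_decomposition .
  have finT: "finite T" using T(1) finite_subset by blast
  have m0: "0 < m" using idL_Gal fin_Gal card_Gal card_gt_0_iff by blast
  have nm: "n div m = card T" unfolding T(2)[symmetric] using m0 by simp
  obtain j where j: "bij_betw j I T"
    using ex_bij_betw_nat_finite_1[OF finT] unfolding nm by blast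
  \<comment> \<open>The components at the identity automorphism; conjugation turns them into all the
    others.\<close>
  define u where "u s = x (j s, idL)" for s
  have jT: "j s \<in> T" "j s \<in> {1..n}" if "s \<in> I" for s
    using bij_betw_apply[OF j that] T(1) by auto
  have \<tau>S: "\<tau> h \<in> S" if "h \<in> {1..m}" for h using bij_betw_apply[OF bij that] .
  have \<tau>u: "\<tau>' \<circ> u s = x (j s, \<tau>')" if "s \<in> I" "\<tau>' \<in> S" for s \<tau>'
    unfolding u_def using gx jT(1)[OF that(1)] that(2) by blast
  have xLB: "x p \<in> LB" and xgood: "good p (x p)" and x0: "x p \<noteq> 0" if "p \<in> T \<times> S" for p
    using x that by blast+
  have oxI: "conv G y (x p) = (if p = q then y else 0)" if "p \<in> T \<times> S" "q \<in> T \<times> S" "good q y" for p q y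
    using ox that by blast
  have xx: "conv G (x q) (x p) = (if p = q then x q else 0)" if "p \<in> T \<times> S" "q \<in> T \<times> S" for p q
    by (rule oxI[OF that xgood[OF that(2)]])
  have xprim: "primitive_idem BA (x p)" if p: "p \<in> T \<times> S" for p
    by (rule good_primitive[OF xLB[OF p] xgood[OF p] _ x0[OF p]]) (use xx[OF p p] in simp)
  \<comment> \<open>\<open>x p\<close> is a left multiple of \<open>lg p\<close> by construction,
    and \<open>conv G (lg p) (x p) = lg p\<close> gives the converse. So the new idempotents
    generate the left ideals of the old ones.\<close>
  have xideal: "Lid (x p) = Lid (lg p)" if p: "p \<in> T \<times> S" for p
  proof
    obtain i \<sigma> where isg: "p = (i, \<sigma>)" "i \<in> {1..n}" "\<sigma> \<in> S" using p T(1) by auto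
    have lgLB: "lg p \<in> LB" unfolding isg(1) by (rule lg_LB[OF isg(2,3)])
    show "Lid (x p) \<subseteq> Lid (lg p)"
      unfolding bspec[OF xw(1) p] by (rule PIdl_LG_subset[OF LB_block[OF lgLB]]) (use xw(2) in blast)
    have "good p (conv G e (lg p))" unfolding isg(1) by (rule good_conv_lg[OF isg(2,3)])
    then have "good p (lg p)" unfolding one_block_left[OF LB_block[OF lgLB]] .
    then have "conv G (lg p) (x p) = lg p" using oxI[OF p p] by simp
    then show "Lid (lg p) \<subseteq> Lid (x p)"
      using PIdl_LG_subset[OF LB_block[OF xLB[OF p]], of "lg p"] LB_L[OF lgLB] by simp
  qed
  have idp: "(j s, idL) \<in> T \<times> S" if "s \<in> I" for s using jT(1)[OF that] idL_Gal by simp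
  have lgid: "lg (j s, idL) = l (j s)" if "s \<in> I" for s
    using idL_comp[OF lL[OF jT(2)[OF that]]] by (simp add: lg_def)
  have uLB: "u s \<in> LB" if "s \<in> I" for s unfolding u_def by (rule xLB[OF idp[OF that]])
  have uI: "Lid (u s) = Lid (l (j s))" if "s \<in> I" for s
    unfolding u_def xideal[OF idp[OF that]] lgid[OF that] ..
  define \<nu> where "\<nu> p = (j (fst p), \<tau> (snd p))" for p
  have bij_\<nu>: "bij_betw \<nu> (I \<times> {1..m}) (T \<times> S)"
  proof -
    have "\<nu> = map_prod j \<tau>" by (auto simp: \<nu>_def fun_eq_iff)
    then show ?thesis using bij_betw_map_prod[OF j bij] by simp
  qed
  have jinj: "j s = j t \<longleftrightarrow> s = t" if "s \<in> I" "t \<in> I" for s t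
    using j that unfolding bij_betw_def inj_on_def by blast
  have \<tau>inj: "\<tau> h = \<tau> k \<longleftrightarrow> h = k" if "h \<in> {1..m}" "k \<in> {1..m}" for h k
    using bij that unfolding bij_betw_def inj_on_def by blast
  have 1: "primitive_idem BA (\<tau> h \<circ> u s) \<and>
         Lid (\<tau> h \<circ> u s) = (\<lambda>x. \<tau> h \<circ> x) ` (Lid (l (j s))) \<and>
         (\<lambda>x. \<tau> h \<circ> x) ` (Lid (l (j s))) = Lid (\<tau> h \<circ> l (j s))"
    if h: "h \<in> {1..m}" and s: "s \<in> I" for h s
  proof (intro conjI)
    show "primitive_idem BA (\<tau> h \<circ> u s)"
      unfolding \<tau>u[OF s \<tau>S[OF h]] by (rule xprim) (use jT(1)[OF s] \<tau>S[OF h] in simp)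
    show "Lid (\<tau> h \<circ> u s) = (\<lambda>x. \<tau> h \<circ> x) ` (Lid (l (j s)))"
      unfolding uI[OF s, symmetric] by (rule Gal_PIdl[OF \<tau>S[OF h] LB_L[OF uLB[OF s]], symmetric])
    show "(\<lambda>x. \<tau> h \<circ> x) ` (Lid (l (j s))) = Lid (\<tau> h \<circ> l (j s))"
      by (rule Gal_PIdl[OF \<tau>S[OF h] lL[OF jT(2)[OF s]]])
  qed
  have 2: "conv G (\<tau> h \<circ> u s) (\<tau> k \<circ> u t) = (if k = h \<and> t = s then \<tau> h \<circ> u s else 0)"
    if s: "s \<in> I" and t: "t \<in> I" and h: "h \<in> {1..m}" and k: "k \<in> {1..m}" for s t h k
    unfolding \<tau>u[OF s \<tau>S[OF h]] \<tau>u[OF t \<tau>S[OF k]]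
    using xx[of "(j t, \<tau> k)" "(j s, \<tau> h)"] jT(1)[OF s] jT(1)[OF t] \<tau>S[OF h] \<tau>S[OF k]
      jinj[OF t s] \<tau>inj[OF k h] by auto
  have 3: "direct_orthogonal_sum LG (carrier BA) (I \<times> {1..m}) (\<lambda>(s, h). \<tau> h \<circ> u s)"
  proof (rule direct_orthogonal_sum_LG)
    show "(case p of (s, h) \<Rightarrow> \<tau> h \<circ> u s) \<in> LB" if "p \<in> I \<times> {1..m}" for p
      using that Gal_LB[OF \<tau>S uLB] by auto
    show "conv G (case q of (s, h) \<Rightarrow> \<tau> h \<circ> u s) (case p of (s, h) \<Rightarrow> \<tau> h \<circ> u s) =
        (if p = q then case q of (s, h) \<Rightarrow> \<tau> h \<circ> u s else 0)"
      if "p \<in> I \<times> {1..m}" "q \<in> I \<times> {1..m}" for p q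
      using that 2 by (cases p; cases q) auto
    have "(\<Sum>p\<in>I \<times> {1..m}. case p of (s, h) \<Rightarrow> \<tau> h \<circ> u s) =
        (\<Sum>p\<in>I \<times> {1..m}. x (\<nu> p))"
      by (rule sum.cong) (use \<tau>u \<tau>S in \<open>auto simp: \<nu>_def\<close>)
    also have "\<dots> = e" unfolding sum_x[symmetric] by (rule sum.reindex_bij_betw[OF bij_\<nu>])
    finally show "(\<Sum>p\<in>I \<times> {1..m}. case p of (s, h) \<Rightarrow> \<tau> h \<circ> u s) = e" .
  qed simp
  have inner: "(\<Oplus>\<^bsub>LG\<^esub>\<sigma>\<in>S. \<sigma> \<circ> u s) = (\<Sum>\<sigma>\<in>S. x (j s, \<sigma>))"
    "(\<Oplus>\<^bsub>LG\<^esub>h\<in>{1..m}. \<tau> h \<circ> u s) = (\<Sum>\<sigma>\<in>S. x (j s, \<sigma>))" if s: "s \<in> I" for s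
  proof -
    have c: "\<sigma> \<circ> u s \<in> carrier LG" if "\<sigma> \<in> S" for \<sigma>
      using Gal_LB[OF that uLB[OF s]] LB_carrier_LG by blast
    have "(\<Oplus>\<^bsub>LG\<^esub>\<sigma>\<in>S. \<sigma> \<circ> u s) = (\<Sum>\<sigma>\<in>S. \<sigma> \<circ> u s)" by (rule finsum_group_algebra[OF L fin_Gal c])
    also have "\<dots> = (\<Sum>\<sigma>\<in>S. x (j s, \<sigma>))" by (rule sum.cong) (simp_all add: \<tau>u[OF s])
    finally show "(\<Oplus>\<^bsub>LG\<^esub>\<sigma>\<in>S. \<sigma> \<circ> u s) = (\<Sum>\<sigma>\<in>S. x (j s, \<sigma>))" .
    have "(\<Oplus>\<^bsub>LG\<^esub>h\<in>{1..m}. \<tau> h \<circ> u s) = (\<Sum>h\<in>{1..m}. \<tau> h \<circ> u s)"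
      by (rule finsum_group_algebra[OF L]) (use c \<tau>S in auto)
    also have "\<dots> = (\<Sum>h\<in>{1..m}. x (j s, \<tau> h))" by (rule sum.cong) (simp_all add: \<tau>u[OF s \<tau>S])
    also have "\<dots> = (\<Sum>\<sigma>\<in>S. x (j s, \<sigma>))" by (rule sum.reindex_bij_betw[OF bij])
    finally show "(\<Oplus>\<^bsub>LG\<^esub>h\<in>{1..m}. \<tau> h \<circ> u s) = (\<Sum>\<sigma>\<in>S. x (j s, \<sigma>))" .
  qed
  have outer: "e = (\<Oplus>\<^bsub>LG\<^esub>s\<in>I. f s)" if f: "\<And>s. s \<in> I \<Longrightarrow> f s = (\<Sum>\<sigma>\<in>S. x (j s, \<sigma>))" for f
  proof -
    have "f s \<in> LB" if "s \<in> I" for s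
      unfolding f[OF that] by (rule LB_sum[OF xLB]) (use jT(1)[OF that] in simp)
    then have "(\<Oplus>\<^bsub>LG\<^esub>s\<in>I. f s) = (\<Sum>s\<in>I. f s)"
      using LB_carrier_LG by (intro finsum_group_algebra[OF L]) auto
    also have "\<dots> = (\<Sum>s\<in>I. \<Sum>\<sigma>\<in>S. x (j s, \<sigma>))" by (rule sum.cong[OF refl f])
    also have "\<dots> = (\<Sum>i\<in>T. \<Sum>\<sigma>\<in>S. x (i, \<sigma>))" by (rule sum.reindex_bij_betw[OF j])
    also have "\<dots> = e" unfolding sum_x[symmetric] by (simp add: sum.cartesian_product)
    finally show ?thesis ..
  qed
  \<comment> \<open>If two of the ideals agreed, then \<open>l (j s)\<close> would be a left
    multiple of \<open>l (j t)\<close>; multiplying by \<open>l (j s)\<close> on the right would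
    give 0, although \<open>l (j s)\<close> is a nonzero idempotent.\<close>
  have inj: "inj_on (\<lambda>s. Lid (l (j s))) I"
  proof (rule inj_onI, rule ccontr)
    fix s t assume st: "s \<in> I" "t \<in> I"
      and eq: "Lid (l (j s)) = Lid (l (j t))" and ne: "s \<noteq> t"
    have "l (j s) = conv G (l (j s)) (l (j s))" using l_orth[OF jT(2)[OF st(1)] jT(2)[OF st(1)]] by simp
    then have "l (j s) \<in> Lid (l (j s))" unfolding PIdl_LG using lL[OF jT(2)[OF st(1)]] by blast
    then obtain y where y: "l (j s) = conv G y (l (j t))" unfolding eq unfolding PIdl_LG by blast
    have "l (j s) = conv G (l (j s)) (l (j s))" by fact
    also have "\<dots> = conv G y (conv G (l (j t)) (l (j s)))"
      using conv_assoc_block[OF l_block[OF jT(2)[OF st(2)]] l_block[OF jT(2)[OF st(1)]], of y]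
      unfolding y[symmetric] .
    also have "\<dots> = 0"
      using l_orth[OF jT(2)[OF st(2)] jT(2)[OF st(1)]] jinj[OF st] ne by (auto simp: conv_def zero_fun_def)
    finally show False using l0[OF jT(2)[OF st(1)]] by simp
  qed
  have u1: "u s = \<tau> 1 \<circ> u s" if "s \<in> I" for s
    unfolding \<tau>1 using idL_comp[of "u s", OF LB_L[OF uLB[OF that]]] by simp
  have one: "1 \<in> {1..m}" using m0 by simp
  have prim: "primitive_idem BA (u s)" if "s \<in> I" for s
    unfolding u_def by (rule xprim[OF idp[OF that]])
  have mem: "u s \<in> Lid (l (j s))" if s: "s \<in> I" for s
    unfolding uI[OF s, symmetric] unfolding PIdl_LG
    using xx[OF idp[OF s] idp[OF s]] LB_L[OF uLB[OF s]] by (auto simp: u_def intro!: exI[of _ "u s"])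
  have orthu: "orthogonal_idems BA I u"
    unfolding orthogonal_idems_def carrier_B block_algebra_simps(2-4) group_algebra_simps(2-4)
    using uLB 2[OF _ _ one one] u1 by auto
  show ?thesis
  proof (intro conjI exI[of _ u] exI[of _ j])
    show "m dvd n" using T(2) by (metis dvd_triv_right)
    show "j ` I \<subseteq> {1..n}" using jT(2) by blast
    show "e = (\<Oplus>\<^bsub>LG\<^esub>s\<in>I. \<Oplus>\<^bsub>LG\<^esub>h\<in>{1..m}. \<tau> h \<circ> u s)" by (rule outer[OF inner(2)])
    show "e = (\<Oplus>\<^bsub>LG\<^esub>s\<in>I. \<Oplus>\<^bsub>LG\<^esub>\<sigma>\<in>S. \<sigma> \<circ> u s)" by (rule outer[OF inner(1)])
  qed (use inj prim mem orthu 1 2 3 in \<open>simp_all add: group_algebra_simps(2,3)\<close>)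
qed

end

text \<open>It remains to replace \<open>\<rho>\<close> by an equivalent representation
  \<open>\<phi>\<close> with entries in \<open>L\<close>. Both have the same character, so e and
  \<open>K\<close> are unaffected; and a field that realizes \<open>\<phi>\<close> realizes
  \<open>\<rho>\<close>, so the minimality of m carries over.\<close>

theorem theorem3p3:
  fixes G :: "('g, 'b) monoid_scheme"
    and \<rho> :: "'g \<Rightarrow> complex mat"
    and n m :: nat
    and K L :: "complex set"
    and LG B :: "('g \<Rightarrow> complex) ring"
    and e :: "'g \<Rightarrow> complex"
    and \<tau> :: "nat \<Rightarrow> complex \<Rightarrow> complex"
    and l :: "nat \<Rightarrow> 'g \<Rightarrow> complex"
  defines "m \<equiv> schur_index G n \<rho>"
    and "K \<equiv> character_field G \<rho>"
    and "LG \<equiv> group_algebra L G"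
    and "e \<equiv> central_idem G n \<rho>"
    and "B \<equiv> block_algebra LG e"
  assumes "group G" and "finite (carrier G)"
    and "irreducible_rep G n \<rho>"
    and "subfield L class_ring" and "K \<subseteq> L"
    and "realizable_over G n \<rho> L"
    and "ring.dimension class_ring m K L"
    and "galois_extension \<rat> L"
    and "bij_betw \<tau> {1..m} (Gal L K)" and "\<tau> 1 = (\<lambda>x\<in>L. x)"
    and "\<forall>i\<in>{1..n}. primitive_idem B (l i)"
    and "orthogonal_idems B {1..n} l"
    and "e = (\<Oplus>\<^bsub>LG\<^esub>i\<in>{1..n}. l i)"
  shows "m dvd n \<and>
    (\<exists>(u :: nat \<Rightarrow> 'g \<Rightarrow> complex) (j :: nat \<Rightarrow> nat).
      j ` {1..n div m} \<subseteq> {1..n} \<and>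
      inj_on (\<lambda>s. PIdl\<^bsub>LG\<^esub> (l (j s))) {1..n div m} \<and>
      (\<forall>s\<in>{1..n div m}. primitive_idem B (u s) \<and> u s \<in> PIdl\<^bsub>LG\<^esub> (l (j s))) \<and>
      orthogonal_idems B {1..n div m} u \<and>
      \<comment> \<open>(1)\<close>
      (\<forall>h\<in>{1..m}. \<forall>s\<in>{1..n div m}.
         primitive_idem B (\<tau> h \<circ> u s) \<and>
         PIdl\<^bsub>LG\<^esub> (\<tau> h \<circ> u s) = (\<lambda>x. \<tau> h \<circ> x) ` (PIdl\<^bsub>LG\<^esub> (l (j s))) \<and>
         (\<lambda>x. \<tau> h \<circ> x) ` (PIdl\<^bsub>LG\<^esub> (l (j s))) = PIdl\<^bsub>LG\<^esub> (\<tau> h \<circ> l (j s))) \<and>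
      \<comment> \<open>(2)\<close>
      (\<forall>s\<in>{1..n div m}. \<forall>t\<in>{1..n div m}. \<forall>h\<in>{1..m}. \<forall>k\<in>{1..m}.
         (\<tau> h \<circ> u s) \<otimes>\<^bsub>LG\<^esub> (\<tau> k \<circ> u t) =
           (if k = h \<and> t = s then \<tau> h \<circ> u s else \<zero>\<^bsub>LG\<^esub>)) \<and>
      \<comment> \<open>(3)\<close>
      direct_orthogonal_sum LG (carrier B) ({1..n div m} \<times> {1..m}) (\<lambda>(s, h). \<tau> h \<circ> u s) \<and>
      e = (\<Oplus>\<^bsub>LG\<^esub>s\<in>{1..n div m}. \<Oplus>\<^bsub>LG\<^esub>h\<in>{1..m}. \<tau> h \<circ> u s) \<and>
      e = (\<Oplus>\<^bsub>LG\<^esub>s\<in>{1..n div m}. \<Oplus>\<^bsub>LG\<^esub>\<sigma>\<in>Gal L K. \<sigma> \<circ> u s))"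
proof -
  interpret Group.group G by (rule assms)
  note L = assms(9)
  obtain \<phi> P Q where \<phi>: "matrix_rep G n \<phi>"
    and sim: "\<And>g. g \<in> carrier G \<Longrightarrow> elements_mat (\<phi> g) \<subseteq> L \<and> similar_mat_wit (\<rho> g) (\<phi> g) P Q"
    using assms(11) unfolding realizable_over_def by blast
  have \<rho>c: "\<rho> g \<in> carrier_mat n n" if "g \<in> carrier G" for g
    using assms(8) matrix_rep_carrier[OF _ that] by (simp add: irreducible_rep_def)
  have irr: "irreducible_rep G n \<phi>"
    by (rule irreducible_rep_similar[OF assms(6,8) \<phi>]) (use sim in blast)
  interpret F: finite_irrep G n \<phi>
    by unfold_locales (rule assms(7), rule irr)
  have char: "rep_char \<phi> g = rep_char \<rho> g" if "g \<in> carrier G" for g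
    using rep_char_similar[of \<rho> g n \<phi> P Q] \<rho>c[OF that] sim[OF that] by simp
  have e: "e = F.\<Psi> (idm n)"
  proof
    fix g
    have "trm n (mm n (F.M (inv\<^bsub>G\<^esub> g)) (idm n)) = rep_char \<rho> (inv\<^bsub>G\<^esub> g)" if "g \<in> carrier G"
      using that unfolding mm_idm(2)[OF F.M_msupp]
      by (simp add: char[symmetric] rep_char_sum[of \<phi> _ n] F.\<phi>_carrier trm_def F.M_def)
    then show "e g = F.\<Psi> (idm n) g" by (simp add: e_def central_idem_def F.\<Psi>_def)
  qed
  have K: "subfield K class_ring"
    unfolding K_def character_field_def
    by (rule field.generate_field_is_subfield[OF class_field]) (simp add: class_ring_simps)
  have eK: "e g \<in> K" for g
  proof -
    have "rep_char \<rho> (inv\<^bsub>G\<^esub> g) \<in> K" if "g \<in> carrier G"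
      unfolding K_def character_field_def by (rule generate_field.incl) (use that in simp)
    then show ?thesis
      using subfield_complexD[OF K] subfield_complex_of_nat[OF K] by (simp add: e_def central_idem_def)
  qed
  have B: "carrier B = {x \<in> F.block. \<forall>g. x g \<in> L}"
    unfolding B_def LG_def e by (rule F.carrier_block_algebra[OF L]) (use eK assms(10) e in auto)
  have lB: "l i \<in> carrier B" "l i \<noteq> 0" "conv G (l i) (l i) = l i" if "i \<in> {1..n}" for i
    using assms(16) that unfolding primitive_idem_def B_def LG_def block_algebra_simps(2,3) group_algebra_simps(2,3)
    by blast+
  have lorth: "conv G (l i) (l k) = 0" if "i \<in> {1..n}" "k \<in> {1..n}" "i \<noteq> k" for i k
    using assms(17) that unfolding orthogonal_idems_def B_def LG_def block_algebra_simps(2,3) group_algebra_simps(2,3)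
    by blast
  \<comment> \<open>The enumeration \<open>\<tau>\<close> supplies |Gal(L/K)| = m, which is also the
    degree of L over K.\<close>
  have fin: "finite (Gal L K)" using bij_betw_finite[OF assms(14)] by simp
  have card: "card (Gal L K) = m" using bij_betw_same_card[OF assms(14)] by simp
  interpret GB: galois_block G n \<phi> K L m l
  proof (intro galois_block.intro galois_block_axioms.intro)
    show "finite_irrep G n \<phi>" by (rule F.finite_irrep_axioms)
    show "subfield K class_ring" by (fact K)
    show "subfield L class_ring" by (fact L)
    show "K \<subseteq> L" by (fact assms(10))
    show "ring.dimension class_ring m K L" by (fact assms(12))
    show "finite (Gal L K)" by (fact fin)
    show "card (Gal L K) = m" by (fact card)
    show "\<phi> g $$ (a, b) \<in> L" if "g \<in> carrier G" "a < n" "b < n" for g a b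
      using sim[OF that(1)] elements_matI[OF F.\<phi>_carrier[OF that(1)] that(2,3) refl] by blast
    show "F.\<Psi> (idm n) g \<in> K" for g using eK unfolding e .
    show "m \<le> d" if "subfield E class_ring" "K \<subseteq> E" "ring.dimension class_ring d K E"
      "realizable_over G n \<phi> E" for E d
    proof -
      have "realizable_over G n \<rho> E" by (rule realizable_over_similar[OF _ that(4)]) (use sim in blast)
      then show ?thesis unfolding m_def schur_index_def using that(1-3) unfolding K_def by (intro Least_le) blast
    qed
    fix i assume i: "i \<in> {1..n}"
    show "l i \<in> F.block" "l i g \<in> L" "l i \<noteq> 0" for g using lB[OF i] B by auto
    show "conv G (l i) (l k) = (if i = k then l i else 0)" if "k \<in> {1..n}" for k
      using lB(3)[OF i] lorth[OF i that] by (cases "i = k") simp_all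
  qed
  show ?thesis
    unfolding LG_def B_def e by (rule GB.galois_idempotents[OF assms(14)]) (simp only: assms(15) GB.idL_def)
qed

end
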